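(* Let $n\ge 6$. The sequence $\mathrm{RCL}(\mathcal{T}_n)$ is an orientable sequence of order $n$ of length $L_n$, and it has successor rule $g$, i.e. for each length-$n$ cyclic window $\alpha$ of $\mathrm{RCL}(\mathcal{T}_n)$, the bit following $\alpha$ is $g(\alpha)$.
   Context: Binary strings are compared lexicographically with $0<1$ (a proper prefix is smaller). For $\alpha=a_1\cdots a_n$, $\alpha^R=a_n\cdots a_1$. $[\alpha]$ is the set of rotations; $\alpha$ is a necklace if lexicographically smallest in $[\alpha]$; a bracelet if lexicographically smallest in $[\alpha]\cup[\alpha^R]$; a necklace is symmetric if $\alpha^R\in[\alpha]$, else asymmetric. $\mathbf{A}(n)$: length-$n$ asymmetric bracelets. $\alpha$ is periodic if $\alpha=\gamma^j$ with $j>1$; $\mathrm{ap}(\alpha)$ is the shortest $\gamma$ with $\alpha=\gamma^t$, $t\ge1$; $L_n=\sum_{\alpha\in\mathbf{A}(n)}|\mathrm{ap}(\alpha)|$. For $\alpha=a_1\cdots a_n$: $\mathrm{FirstOne}(\alpha)$ flips the first $1$ to $0$; $\mathrm{LastOne}(\alpha)$ is the necklace of $a_1\cdots a_{n-1}0$; $\mathrm{LastZero}(\alpha)$ flips the last $0$ to $1$. With $r_n=0^{n-4}1011$, $\mathrm{par}(\alpha)$ for $\alpha\in\mathbf{A}(n)\setminus\{r_n\}$ is $\mathrm{FirstOne}(\alpha)$ if this lies in $\mathbf{A}(n)$, else $\mathrm{LastOne}(\alpha)$ if this lies in $\mathbf{A}(n)$, else $\mathrm{LastZero}(\alpha)$.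 The concatenation tree $\mathcal{T}_n$ is the rooted tree defined recursively: the root has label $r_n$ and change index $n$; a node with label $\alpha$ and change index $c$ has no children if $\alpha$ is periodic; otherwise, with $\beta$ the necklace of $[\alpha]$ and $\alpha_k$ the string $\alpha$ with bit $k$ complemented, its children are the nodes labeled $\alpha_k$ with change index $k$, for each $k\in\{1,\dots,n\}$ such that the necklace of $[\alpha_k]$ lies in $\mathbf{A}(n)$ and has $\mathrm{par}$ equal to $\beta$; the children with $k>c$ are the right-children and those with $k<c$ the left-children, each list ordered by increasing $k$. A right-current-left (RCL) traversal visits, recursively, the right-children first to last, then the current node, then the left-children first to last; $\mathrm{RCL}(\mathcal{T}_n)$ is the concatenation of $\mathrm{ap}(\alpha)$ over nodes $\alpha$ in RCL order starting at the root, viewed as a cyclic sequence. $g$ is the function on $\mathbf{S}(n)=\bigcup_{\alpha\in\mathbf{A}(n)}[\alpha]$ defined by: for $\alpha=a_1\cdots a_n$, let $\beta_1=0^{n-i}1a_2\cdots a_i$ ($i$ the largest index with $a_i=1$), $\beta_2=a_2\cdots a_n1$, $\beta_3=a_j\cdots a_n0\,1^{j-2}$ ($j>1$ the smallest index $>1$ with $a_j=0$); $g(\alpha)=\overline{a_1}$ if ($\beta_1,\mathrm{FirstOne}(\beta_1)\in\mathbf{A}(n)$) or ($\beta_2,\mathrm{LastOne}(\beta_2)\in\mathbf{A}(n)$ and $\mathrm{FirstOne}(\beta_2)\notin\mathbf{A}(n)$) or ($\beta_3,\mathrm{LastZero}(\beta_3)\in\mathbf{A}(n)$ and $\mathrm{FirstOne}(\beta_3),\mathrm{LastOne}(\beta_3)\notin\mathbf{A}(n)$),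 and $g(\alpha)=a_1$ otherwise. An orientable sequence of order $n$ is a cyclic binary sequence $s_1\cdots s_m$ such that the $m$ cyclic length-$n$ windows of $s_1\cdots s_m$ together with the $m$ cyclic length-$n$ windows of $s_m\cdots s_1$ are $2m$ pairwise distinct strings; its length is $m$. *)

theory Defs
  imports Complex_Main "HOL-Library.List_Lexorder"
begin

text \<open>
  Binary strings are lists over \<^typ>\<open>bool\<close>, with \<^const>\<open>False\<close> for 0 and \<^const>\<open>True\<close> for 1;
  \<open>\<le>\<close> on lists is the lexicographic order, in which a proper prefix is smaller. Informal
  positions are counted from 1, list positions from 0. A cyclic sequence is given by one of its
  linear representatives.
\<close>

type_synonym bitstring = "bool list"

definition rotations :: "bitstring \<Rightarrow> bitstring set" where
  "rotations \<alpha> = {rotate k \<alpha> |k. True}"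

definition necklace_of :: "bitstring \<Rightarrow> bitstring" where
  "necklace_of \<alpha> = Min (rotations \<alpha>)"

definition bracelet :: "bitstring \<Rightarrow> bool" where
  "bracelet \<alpha> \<longleftrightarrow> (\<forall>\<beta> \<in> rotations \<alpha> \<union> rotations (rev \<alpha>). \<alpha> \<le> \<beta>)"

definition symmetric :: "bitstring \<Rightarrow> bool" where
  "symmetric \<alpha> \<longleftrightarrow> rev \<alpha> \<in> rotations \<alpha>"

definition asym_bracelets :: "nat \<Rightarrow> bitstring set" where
  "asym_bracelets n = {\<alpha>. length \<alpha> = n \<and> bracelet \<alpha> \<and> \<not> symmetric \<alpha>}"

definition S_set :: "nat \<Rightarrow> bitstring set" where
  "S_set n = (\<Union>\<alpha> \<in> asym_bracelets n. rotations \<alpha>)"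

definition periodic :: "bitstring \<Rightarrow> bool" where
  "periodic \<alpha> \<longleftrightarrow> (\<exists>\<gamma> j. j > 1 \<and> \<alpha> = concat (replicate j \<gamma>))"

definition ap :: "bitstring \<Rightarrow> bitstring" where
  "ap \<alpha> = (ARG_MIN length \<gamma>. \<exists>t\<ge>1. \<alpha> = concat (replicate t \<gamma>))"

definition L :: "nat \<Rightarrow> nat" where
  "L n = (\<Sum>\<alpha> \<in> asym_bracelets n. length (ap \<alpha>))"

primrec flip_first :: "bool \<Rightarrow> bitstring \<Rightarrow> bitstring" where
  "flip_first b [] = []"
| "flip_first b (x # xs) = (if x = b then (\<not> x) # xs else x # flip_first b xs)"

definition first_one :: "bitstring \<Rightarrow> bitstring" where
  "first_one \<alpha> = flip_first True \<alpha>"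

definition last_one :: "bitstring \<Rightarrow> bitstring" where
  "last_one \<alpha> = necklace_of (butlast \<alpha> @ [False])"

definition last_zero :: "bitstring \<Rightarrow> bitstring" where
  "last_zero \<alpha> = rev (flip_first False (rev \<alpha>))"

definition root_label :: "nat \<Rightarrow> bitstring" where
  "root_label n = replicate (n - 4) False @ [True, False, True, True]"

text \<open>Meaningful only on \<open>asym_bracelets n - {root_label n}\<close>.\<close>

definition par :: "nat \<Rightarrow> bitstring \<Rightarrow> bitstring" where
  "par n \<alpha> =
     (if first_one \<alpha> \<in> asym_bracelets n then first_one \<alpha>
      else if last_one \<alpha> \<in> asym_bracelets n then last_one \<alpha>
      else last_zero \<alpha>)"

definition complement_at :: "bitstring \<Rightarrow> nat \<Rightarrow> bitstring" where
  "complement_at \<alpha> k = \<alpha>[k - 1 := \<not> \<alpha> ! (k - 1)]"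

definition child_indices :: "nat \<Rightarrow> bitstring \<Rightarrow> nat list" where
  "child_indices n \<alpha> =
     (if periodic \<alpha> then []
      else filter
        (\<lambda>k. necklace_of (complement_at \<alpha> k) \<in> asym_bracelets n - {root_label n} \<and>
             par n (necklace_of (complement_at \<alpha> k)) = necklace_of \<alpha>)
        [1..<n + 1])"

datatype ctree =
  Node (label: bitstring) (change_index: nat) (right_children: "ctree list")
    (left_children: "ctree list")

text \<open>
  The recursion below terminates for every \<open>n\<close>: along \<^const>\<open>par\<close>, the pair (number of leading
  zeros, number of ones) increases lexicographically, since the first two cases of \<^const>\<open>par\<close>
  lengthen the initial block of zeros, and the third keeps it and adds a one.
\<close>

definition leading_zeros :: "bitstring \<Rightarrow> nat" where
  "leading_zeros \<alpha> = length (takeWhile Not \<alpha>)"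

definition par_rank :: "nat \<Rightarrow> bitstring \<Rightarrow> nat" where
  "par_rank n \<alpha> = leading_zeros \<alpha> * (n + 1) + length (filter id \<alpha>)"

lemma rotations_nonempty: "rotations \<alpha> \<noteq> {}"
  by (auto simp: rotations_def)

lemma length_rotations: "\<beta> \<in> rotations \<alpha> \<Longrightarrow> length \<beta> = length \<alpha>"
  by (auto simp: rotations_def)

lemma finite_rotations: "finite (rotations \<alpha>)"
proof (rule finite_subset)
  show "rotations \<alpha> \<subseteq> {\<beta>. set \<beta> \<subseteq> UNIV \<and> length \<beta> = length \<alpha>}"
    by (auto dest: length_rotations)
  show "finite {\<beta> :: bool list. set \<beta> \<subseteq> UNIV \<and> length \<beta> = length \<alpha>}"
    by (rule finite_lists_length_eq) simp
qed

lemma necklace_of_in: "necklace_of \<alpha> \<in> rotations \<alpha>"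
  unfolding necklace_of_def by (rule Min_in[OF finite_rotations rotations_nonempty])

lemma necklace_of_le: "\<beta> \<in> rotations \<alpha> \<Longrightarrow> necklace_of \<alpha> \<le> \<beta>"
  unfolding necklace_of_def by (rule Min_le[OF finite_rotations])

lemma length_necklace_of: "length (necklace_of \<alpha>) = length \<alpha>"
  by (rule length_rotations[OF necklace_of_in])

lemma leading_zeros_antimono:
  "length \<alpha> = length \<beta> \<Longrightarrow> \<alpha> \<le> \<beta> \<Longrightarrow> leading_zeros \<beta> \<le> leading_zeros \<alpha>"
  by (induction \<alpha> \<beta> rule: list_induct2) (auto simp: leading_zeros_def)

lemma length_flip_first: "length (flip_first b \<alpha>) = length \<alpha>"
  by (induction \<alpha>) auto

lemma leading_zeros_first_one:
  "True \<in> set \<alpha> \<Longrightarrow> leading_zeros \<alpha> < leading_zeros (first_one \<alpha>)"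
  by (induction \<alpha>) (auto simp: leading_zeros_def first_one_def)

lemma zeros_ones_symmetric: "symmetric (replicate a False @ replicate b True)"
proof -
  have "rotate a (replicate a False @ replicate b True) = replicate b True @ replicate a False"
    using rotate_append[of "replicate a False" "replicate b True"] by simp
  then show ?thesis
    unfolding symmetric_def rotations_def by (auto intro!: exI[of _ a])
qed

lemma all_eq_replicate: "(\<not> b) \<notin> set \<alpha> \<Longrightarrow> \<exists>a. \<alpha> = replicate a b"
proof (induction \<alpha>)
  case (Cons x \<alpha>)
  then obtain a where "x # \<alpha> = replicate (Suc a) b" by (cases b) auto
  then show ?case ..
qed auto

lemma asymmetric_split:
  assumes "\<not> symmetric \<alpha>"
  obtains \<beta> b where "\<alpha> = \<beta> @ False # replicate b True" "True \<in> set \<beta>"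
proof -
  have "False \<in> set \<alpha>"
  proof (rule ccontr)
    assume "False \<notin> set \<alpha>"
    then obtain a where "\<alpha> = replicate a True" using all_eq_replicate[of True \<alpha>] by auto
    with zeros_ones_symmetric[of 0 a] assms show False by simp
  qed
  then obtain \<beta> \<gamma> where split: "\<alpha> = \<beta> @ False # \<gamma>" "False \<notin> set \<gamma>"
    using split_list_last[of False \<alpha>] by blast
  from split(2) obtain b where \<gamma>: "\<gamma> = replicate b True"
    using all_eq_replicate[of True \<gamma>] by auto
  have "True \<in> set \<beta>"
  proof (rule ccontr)
    assume "True \<notin> set \<beta>"
    then obtain a where "\<beta> = replicate a False" using all_eq_replicate[of False \<beta>] by auto
    with split(1) \<gamma> have "\<alpha> = replicate (Suc a) False @ replicate b True"
      by (simp add: replicate_app_Cons_same)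
    with zeros_ones_symmetric[of "Suc a" b] assms show False by simp
  qed
  with split(1) \<gamma> show ?thesis using that by blast
qed

lemma flip_first_replicate:
  "flip_first False (replicate b True @ False # \<alpha>) = replicate b True @ True # \<alpha>"
  by (induction b) auto

lemma leading_zeros_append:
  "True \<in> set \<alpha> \<Longrightarrow> leading_zeros (\<alpha> @ \<beta>) = leading_zeros \<alpha>"
  by (simp add: leading_zeros_def)

lemma leading_zeros_last_one:
  assumes "True \<in> set \<alpha>"
  shows "leading_zeros \<alpha> < leading_zeros (last_one \<alpha>)"
proof -
  let ?\<beta> = "butlast \<alpha> @ [False]"
  from assms have ne: "\<alpha> \<noteq> []" by auto
  have "False # butlast \<alpha> = rotate (length (butlast \<alpha>)) ?\<beta>"
    by (subst rotate_append) simp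
  then have "False # butlast \<alpha> \<in> rotations ?\<beta>"
    unfolding rotations_def by blast
  then have "necklace_of ?\<beta> \<le> False # butlast \<alpha>"
    by (rule necklace_of_le)
  then have "leading_zeros (False # butlast \<alpha>) \<le> leading_zeros (last_one \<alpha>)"
    unfolding last_one_def
    by (rule leading_zeros_antimono[rotated]) (simp add: length_necklace_of)
  moreover have "leading_zeros \<alpha> \<le> leading_zeros (butlast \<alpha>)"
  proof -
    obtain \<gamma> x where \<alpha>: "\<alpha> = \<gamma> @ [x]" using ne by (cases \<alpha> rule: rev_cases) auto
    show ?thesis
    proof (cases "True \<in> set \<gamma>")
      case True
      then show ?thesis by (simp add: \<alpha> leading_zeros_append)
    next
      case False
      with assms \<alpha> have x: "x = True" by auto
      from False obtain a where "\<gamma> = replicate a False"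
        using all_eq_replicate[of False \<gamma>] by auto
      with x \<alpha> show ?thesis by (simp add: leading_zeros_def takeWhile_append)
    qed
  qed
  ultimately show ?thesis by (simp add: leading_zeros_def)
qed

lemma par_rank_less_par:
  assumes "\<alpha> \<in> asym_bracelets n"
  shows "par_rank n \<alpha> < par_rank n (par n \<alpha>)"
proof -
  from assms have len: "length \<alpha> = n" and asym: "\<not> symmetric \<alpha>"
    by (auto simp: asym_bracelets_def)
  from asym obtain \<beta> b where split: "\<alpha> = \<beta> @ False # replicate b True" "True \<in> set \<beta>"
    by (rule asymmetric_split)
  then have one: "True \<in> set \<alpha>" by simp
  have longer: "par_rank n \<alpha> < par_rank n \<gamma>" if "leading_zeros \<alpha> < leading_zeros \<gamma>" for \<gamma>
  proof -
    have "length (filter id \<alpha>) < n + 1"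
      using len length_filter_le[of id \<alpha>] by simp
    moreover have "(leading_zeros \<alpha> + 1) * (n + 1) \<le> leading_zeros \<gamma> * (n + 1)"
      using that by (intro mult_le_mono1) simp
    ultimately show ?thesis
      unfolding par_rank_def by (simp add: algebra_simps)
  qed
  have "last_zero \<alpha> = \<beta> @ True # replicate b True"
    unfolding last_zero_def split(1) by (simp add: flip_first_replicate)
  then have "par_rank n \<alpha> < par_rank n (last_zero \<alpha>)"
    unfolding par_rank_def using split by (simp add: leading_zeros_append)
  then show ?thesis
    using longer[OF leading_zeros_first_one[OF one]] longer[OF leading_zeros_last_one[OF one]]
    by (simp add: par_def)
qed

function concat_subtree :: "nat \<Rightarrow> bitstring \<Rightarrow> nat \<Rightarrow> ctree" where
  "concat_subtree n \<alpha> c =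
     Node \<alpha> c
       (map (\<lambda>k. concat_subtree n (complement_at \<alpha> k) k) (filter (\<lambda>k. k > c) (child_indices n \<alpha>)))
       (map (\<lambda>k. concat_subtree n (complement_at \<alpha> k) k) (filter (\<lambda>k. k < c) (child_indices n \<alpha>)))"
  by pat_completeness auto
termination
proof (relation "measure (\<lambda>(n, \<alpha>, c). par_rank n (necklace_of \<alpha>))")
  have *: "par_rank n (necklace_of (complement_at \<alpha> k)) < par_rank n (necklace_of \<alpha>)"
    if "k \<in> set (child_indices n \<alpha>)" for n \<alpha> k
    using that par_rank_less_par[of "necklace_of (complement_at \<alpha> k)" n]
    by (auto simp: child_indices_def split: if_splits)
  show "((n, complement_at \<alpha> k, k), (n, \<alpha>, c)) \<in> measure (\<lambda>(n, \<alpha>, c). par_rank n (necklace_of \<alpha>))"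
    if "k \<in> set (filter (\<lambda>k. k > c) (child_indices n \<alpha>))" for n \<alpha> c k
    using that * by simp
  show "((n, complement_at \<alpha> k, k), (n, \<alpha>, c)) \<in> measure (\<lambda>(n, \<alpha>, c). par_rank n (necklace_of \<alpha>))"
    if "k \<in> set (filter (\<lambda>k. k < c) (child_indices n \<alpha>))" for n \<alpha> c k
    using that * by simp
qed simp

declare concat_subtree.simps [simp del]

definition concat_tree :: "nat \<Rightarrow> ctree" where
  "concat_tree n = concat_subtree n (root_label n) n"

primrec rcl_order :: "ctree \<Rightarrow> bitstring list" where
  "rcl_order (Node \<alpha> c rs ls) =
     concat (map rcl_order rs) @ [\<alpha>] @ concat (map rcl_order ls)"

definition RCL :: "ctree \<Rightarrow> bitstring" where
  "RCL T = concat (map ap (rcl_order T))"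

definition window :: "nat \<Rightarrow> bitstring \<Rightarrow> nat \<Rightarrow> bitstring" where
  "window n s i = map (\<lambda>j. s ! ((i + j) mod length s)) [0..<n]"

definition orientable :: "nat \<Rightarrow> bitstring \<Rightarrow> bool" where
  "orientable n s \<longleftrightarrow>
     distinct (map (window n s) [0..<length s] @ map (window n (rev s)) [0..<length s])"

text \<open>
  The indices \<open>i\<close> and \<open>j\<close> exist, and hence \<open>g\<close> is meaningful, for strings in \<open>S_set n\<close>.
\<close>

definition g :: "nat \<Rightarrow> bitstring \<Rightarrow> bool" where
  "g n \<alpha> =
    (let i = (GREATEST i. 1 \<le> i \<and> i \<le> n \<and> \<alpha> ! (i - 1));
         j = (LEAST j. 1 < j \<and> j \<le> n \<and> \<not> \<alpha> ! (j - 1));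
         \<beta>1 = replicate (n - i) False @ [True] @ drop 1 (take i \<alpha>);
         \<beta>2 = drop 1 \<alpha> @ [True];
         \<beta>3 = drop (j - 1) \<alpha> @ [False] @ replicate (j - 2) True;
         A = asym_bracelets n
     in if (\<beta>1 \<in> A \<and> first_one \<beta>1 \<in> A) \<or>
           (\<beta>2 \<in> A \<and> last_one \<beta>2 \<in> A \<and> first_one \<beta>2 \<notin> A) \<or>
           (\<beta>3 \<in> A \<and> last_zero \<beta>3 \<in> A \<and> first_one \<beta>3 \<notin> A \<and> last_one \<beta>3 \<notin> A)
        then \<not> \<alpha> ! 0 else \<alpha> ! 0)"

text \<open>The successor rule is a function on \<open>S_set n\<close>, so the windows have to lie there.\<close>

definition has_successor_rule ::
    "nat \<Rightarrow> bitstring set \<Rightarrow> (bitstring \<Rightarrow> bool) \<Rightarrow> bitstring \<Rightarrow> bool" where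
  "has_successor_rule n D f s \<longleftrightarrow>
     (\<forall>i < length s. window n s i \<in> D \<and> s ! ((i + n) mod length s) = f (window n s i))"

end

theory Submission
  imports Defs "HOL-Library.Multiset" "HOL-Library.Sublist"
begin

text \<open>
  Let $U$ and $V$ be cyclic strings which, when cut open, both read $x$ before and $y$ after the cut,
  where $|x| + |y| = n - 1$. Then $UV$ has the length-$n$ windows of $U$ and $V$ together, and only
  the two windows ending in $xy$ exchange their successors. A subtree of the concatenation
  tree with label $\alpha$ and change index $c$ yields a string that starts, cyclically, with
  $a_1 \cdots a_c$ and ends with $a_c \cdots a_n$; hence every edge of the tree is such a join, with
  $xy$ the rotation of $\alpha$ that starts after the flipped bit, without that bit.
  Counting windows of length $n + 1$ with multiplicity along the recursion gives
  everything, provided that the tree contains every asymmetric bracelet exactly once and that the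
  string $xy$ is determined by the child.

  Write an asymmetric bracelet as $0^a 1 0^B X 0^C 1$ with $X$ starting and ending in 1. Then
  FirstOne stays in $\mathbf{A}(n)$ iff $X 0^C 1$ is smaller than its reversal, and LastOne iff
  $1 0^B X$ is. If both fail, a failure of LastZero would force the form $v 1011$ with $v$ a
  palindrome, which is only possible for the root. All parents are strictly smaller than their
  proper rotations, hence aperiodic. Finally, two flips inside one run of a string that give
  conjugate strings force the remaining bits to form an arithmetic progression modulo $n$, so the
  string is symmetric; this makes the flipped bit unique.
\<close>

subsection \<open>Rotations, necklaces and primitive roots\<close>

text \<open>A window of length n + 1 is a window of length n together with its successor, so one
  multiset identity serves all claims: with last bits removed it gives the windows, hence length and
  orientability; with last bits kept it gives the successor rule. A join removes the windows 0z0 and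
  1z1 and creates 0z1 and 1z0. The removed ones are added on the other side, since multiset
  difference truncates. Without their last bits both corrections coincide and cancel.

  The obstacle is that the tree and \<open>g\<close> identify an edge differently: the tree accepts
  every index whose flip lands in the class of a suitable bracelet, whereas \<open>g\<close> looks
  for the very bit that \<open>par\<close> flips. They agree because an edge admits only one word z.
  The same fact, with the aperiodicity of parents, lets each child arise from one index only; in a
  periodic label the same flip would occur at several indices.

  The bound n >= 6 makes 0^(n-4) longer than every run of zeros in 1011; for n = 5 the word 01011 is
  symmetric.\<close>

lemma rotations_iff_split: "\<beta> \<in> rotations \<alpha> \<longleftrightarrow> (\<exists>u v. \<alpha> = u @ v \<and> \<beta> = v @ u)"
proof
  assume "\<beta> \<in> rotations \<alpha>"
  then obtain k where "\<beta> = rotate k \<alpha>" by (auto simp: rotations_def)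
  then have "\<alpha> = take (k mod length \<alpha>) \<alpha> @ drop (k mod length \<alpha>) \<alpha> \<and>
      \<beta> = drop (k mod length \<alpha>) \<alpha> @ take (k mod length \<alpha>) \<alpha>"
    by (simp add: rotate_drop_take)
  then show "\<exists>u v. \<alpha> = u @ v \<and> \<beta> = v @ u" by blast
next
  assume "\<exists>u v. \<alpha> = u @ v \<and> \<beta> = v @ u"
  then obtain u v where "\<alpha> = u @ v" "\<beta> = v @ u" by blast
  then have "\<beta> = rotate (length u) \<alpha>" by (simp add: rotate_append)
  then show "\<beta> \<in> rotations \<alpha>" by (auto simp: rotations_def)
qed

lemma rotate_in_rotations [simp]: "rotate k \<alpha> \<in> rotations \<alpha>"
  by (auto simp: rotations_def)

lemma append_swap_in_rotations: "v @ u \<in> rotations (u @ v)"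
  by (auto simp: rotations_iff_split)

lemma rotations_refl [simp]: "\<alpha> \<in> rotations \<alpha>"
  using rotate_in_rotations[of 0 \<alpha>] by simp

lemma rotations_sym: "\<beta> \<in> rotations \<alpha> \<Longrightarrow> \<alpha> \<in> rotations \<beta>"
  by (auto simp: rotations_iff_split)

lemma rotations_trans: "\<gamma> \<in> rotations \<beta> \<Longrightarrow> \<beta> \<in> rotations \<alpha> \<Longrightarrow> \<gamma> \<in> rotations \<alpha>"
  by (auto simp: rotations_def rotate_rotate)

lemma rotations_eq: "\<beta> \<in> rotations \<alpha> \<Longrightarrow> rotations \<beta> = rotations \<alpha>"
  by (blast intro: rotations_trans rotations_sym)

lemma rev_in_rotations_rev: "\<beta> \<in> rotations \<alpha> \<Longrightarrow> rev \<beta> \<in> rotations (rev \<alpha>)"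
  unfolding rotations_iff_split by (metis rev_append)

lemma necklace_of_eq_iff: "necklace_of \<beta> = necklace_of \<alpha> \<longleftrightarrow> \<beta> \<in> rotations \<alpha>"
proof
  assume "necklace_of \<beta> = necklace_of \<alpha>"
  then have "necklace_of \<alpha> \<in> rotations \<beta>" using necklace_of_in[of \<beta>] by simp
  then show "\<beta> \<in> rotations \<alpha>"
    using necklace_of_in[of \<alpha>] by (blast intro: rotations_trans rotations_sym)
next
  assume "\<beta> \<in> rotations \<alpha>"
  then show "necklace_of \<beta> = necklace_of \<alpha>" by (simp add: necklace_of_def rotations_eq)
qed

lemma necklace_of_eqI:
  assumes "\<gamma> \<in> rotations \<alpha>" and "\<forall>\<rho> \<in> rotations \<gamma>. \<gamma> \<le> \<rho>"
  shows "necklace_of \<alpha> = \<gamma>"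
  using assms necklace_of_in[of \<alpha>] necklace_of_le[of \<gamma> \<alpha>] rotations_eq[of \<gamma> \<alpha>]
  by (simp add: order_antisym)

definition weight :: "bitstring \<Rightarrow> nat" where "weight \<alpha> = length (filter id \<alpha>)"

lemma weight_append [simp]: "weight (u @ v) = weight u + weight v"
  and weight_Cons [simp]: "weight (b # v) = of_bool b + weight v"
  and weight_Nil [simp]: "weight [] = 0"
  and weight_replicate [simp]: "weight (replicate k b) = (if b then k else 0)"
  by (auto simp: weight_def)

lemma weight_rotations: "\<beta> \<in> rotations \<alpha> \<Longrightarrow> weight \<beta> = weight \<alpha>"
  by (auto simp: rotations_iff_split)

text \<open>In the reversed class, equality is the symmetric case: \<open>symmetric \<gamma>\<close>
  amounts to \<gamma> being a rotation of \<open>rev \<gamma>\<close>. Asymmetry therefore turns the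
  weak comparison with that class into a strict one.\<close>

lemma asym_bracelets_iff:
  "\<gamma> \<in> asym_bracelets n \<longleftrightarrow>
    length \<gamma> = n \<and> (\<forall>\<rho> \<in> rotations \<gamma>. \<gamma> \<le> \<rho>) \<and> (\<forall>\<rho> \<in> rotations (rev \<gamma>). \<gamma> < \<rho>)"
proof -
  have "symmetric \<gamma> \<longleftrightarrow> \<gamma> \<in> rotations (rev \<gamma>)"
    unfolding symmetric_def by (blast intro: rotations_sym)
  then show ?thesis
    unfolding asym_bracelets_def bracelet_def by (auto simp: less_le)
qed

lemma necklace_of_asym_bracelet: "\<gamma> \<in> asym_bracelets n \<Longrightarrow> necklace_of \<gamma> = \<gamma>"
  by (rule necklace_of_eqI) (auto simp: asym_bracelets_iff)

lemma symmetric_rotations: "\<beta> \<in> rotations \<alpha> \<Longrightarrow> symmetric \<beta> \<longleftrightarrow> symmetric \<alpha>"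
  unfolding symmetric_def
  by (metis rotations_eq rev_in_rotations_rev rotations_sym)

section \<open>Comparing bit strings by prefixes and by leading zeros\<close>

lemma take_mono_lex: "\<alpha> \<le> \<beta> \<Longrightarrow> take k \<alpha> \<le> take k (\<beta> :: bitstring)"
proof (induction k arbitrary: \<alpha> \<beta>)
  case (Suc k)
  then show ?case by (cases \<alpha>; cases \<beta>) auto
qed simp

lemma less_if_take_less: "take k \<alpha> < take k \<beta> \<Longrightarrow> \<alpha> < (\<beta> :: bitstring)"
  using take_mono_lex[of \<beta> \<alpha> k] by (meson leD leI)

lemma append_le_append_iff [simp]: "u @ v \<le> u @ w \<longleftrightarrow> v \<le> (w :: bitstring)"
  by (induction u) auto

lemma append_less_append_iff [simp]: "u @ v < u @ w \<longleftrightarrow> v < (w :: bitstring)"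
  by (induction u) auto

lemma append_less_append_eq_length:
  "length u = length u' \<Longrightarrow> u @ v < u' @ v' \<longleftrightarrow> u < u' \<or> u = u' \<and> v < (v' :: bitstring)"
  by (induction u u' rule: list_induct2) auto

lemma less_if_leading_zeros_less:
  "length \<alpha> = length \<beta> \<Longrightarrow> leading_zeros \<beta> < leading_zeros \<alpha> \<Longrightarrow> \<alpha> < \<beta>"
  using leading_zeros_antimono[of \<beta> \<alpha>] by (cases "\<beta> \<le> \<alpha>") auto

lemma leading_zeros_simps [simp]:
  "leading_zeros [] = 0"
  "leading_zeros (True # u) = 0"
  "leading_zeros (False # u) = Suc (leading_zeros u)"
  "leading_zeros (replicate a False @ u) = a + leading_zeros u"
  by (auto simp: leading_zeros_def takeWhile_append)

section \<open>Periods and the primitive root\<close>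

lemma periodic_imp_rotate_eq:
  assumes "periodic \<alpha>" "\<alpha> \<noteq> []"
  shows "\<exists>k. 0 < k \<and> k < length \<alpha> \<and> rotate k \<alpha> = \<alpha>"
proof -
  obtain \<gamma> j where j: "j > 1" "\<alpha> = concat (replicate j \<gamma>)"
    using assms(1) by (auto simp: periodic_def)
  obtain i where i: "j = Suc i" "i > 0" using j(1) by (cases j) auto
  have ne: "\<gamma> \<noteq> []" using j assms(2) by auto
  have "concat (replicate i \<gamma>) @ \<gamma> = concat (replicate j \<gamma>)"
    unfolding i by (induction i) auto
  moreover have "\<alpha> = \<gamma> @ concat (replicate i \<gamma>)" by (simp add: i j)
  ultimately have "rotate (length \<gamma>) \<alpha> = \<alpha>" by (metis j(2) rotate_append)
  moreover have "length \<gamma> < length \<alpha>" using i(2) ne by (cases i) (auto simp: j i)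
  ultimately show ?thesis using ne by auto
qed

lemma ap_props:
  shows ap_root: "\<exists>t\<ge>1. \<alpha> = concat (replicate t (ap \<alpha>))"
    and ap_le: "t \<ge> 1 \<Longrightarrow> \<alpha> = concat (replicate t \<gamma>) \<Longrightarrow> length (ap \<alpha>) \<le> length \<gamma>"
proof -
  let ?P = "\<lambda>\<gamma>. \<exists>t\<ge>1. \<alpha> = concat (replicate t \<gamma>)"
  have "?P \<alpha>" by (intro exI[of _ 1]) simp
  from arg_min_nat_lemma[of ?P, OF this, of length]
  show "\<exists>t\<ge>1. \<alpha> = concat (replicate t (ap \<alpha>))"
    and "t \<ge> 1 \<Longrightarrow> \<alpha> = concat (replicate t \<gamma>) \<Longrightarrow> length (ap \<alpha>) \<le> length \<gamma>"
    unfolding ap_def by blast+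
qed

lemma ap_not_periodic: "\<not> periodic \<alpha> \<Longrightarrow> ap \<alpha> = \<alpha>"
proof -
  assume np: "\<not> periodic \<alpha>"
  obtain t where t: "t \<ge> 1" "\<alpha> = concat (replicate t (ap \<alpha>))" using ap_root by blast
  have "t = 1"
  proof (rule ccontr)
    assume "t \<noteq> 1"
    with t(1) have "t > 1" by simp
    with t(2) np show False unfolding periodic_def by blast
  qed
  with t(2) show ?thesis by simp
qed

lemma length_concat_replicate: "length (concat (replicate t \<gamma>)) = t * length \<gamma>"
  by (induction t) auto

lemma length_ap_eq: "\<exists>t. \<alpha> = concat (replicate t (ap \<alpha>)) \<and> length \<alpha> = t * length (ap \<alpha>)"
proof -
  obtain t where t: "\<alpha> = concat (replicate t (ap \<alpha>))" using ap_root by blast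
  have "length \<alpha> = t * length (ap \<alpha>)" by (subst t) (rule length_concat_replicate)
  with t show ?thesis by blast
qed

lemma ap_not_Nil: "\<alpha> \<noteq> [] \<Longrightarrow> ap \<alpha> \<noteq> []"
  using length_ap_eq[of \<alpha>] by (metis length_0_conv mult_0_right)

lemma length_ap_dvd: "length (ap \<alpha>) dvd length \<alpha>"
  using length_ap_eq[of \<alpha>] by (metis dvd_triv_right)

lemma nth_concat_replicate:
  "i < t * length \<gamma> \<Longrightarrow> concat (replicate t \<gamma>) ! i = \<gamma> ! (i mod length \<gamma>)"
proof (induction t arbitrary: i)
  case (Suc t)
  then show ?case by (auto simp: nth_append mod_if)
qed simp

lemma nth_ap: "i < length \<alpha> \<Longrightarrow> \<alpha> ! i = ap \<alpha> ! (i mod length (ap \<alpha>))"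
  using length_ap_eq[of \<alpha>] nth_concat_replicate[of i _ "ap \<alpha>"] by metis

text \<open>A rotation that fixes the string makes its two parts commute, and commuting words are
  powers of a common word, which is at most as long as \<open>take d \<alpha>\<close>.\<close>

lemma rotate_eq_imp_ap_le:
  assumes "rotate d \<alpha> = \<alpha>" "0 < d" "d < length \<alpha>"
  shows "length (ap \<alpha>) \<le> d"
proof -
  have "take d \<alpha> @ drop d \<alpha> = drop d \<alpha> @ take d \<alpha>"
    using assms by (simp add: rotate_drop_take)
  then obtain m k zs where zs: "concat (replicate m zs) = take d \<alpha>" "concat (replicate k zs) = drop d \<alpha>"
    using comm_append_are_replicate by blast
  have "\<alpha> = concat (replicate (m + k) zs)"
    using zs by (metis append_take_drop_id concat_append replicate_add)
  moreover have m: "m \<ge> 1" using zs(1) assms by (cases m) auto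
  ultimately have "length (ap \<alpha>) \<le> length zs" using ap_le by (metis trans_le_add1)
  also have "\<dots> \<le> length (take d \<alpha>)" using zs(1) m by (cases m) (auto simp flip: zs(1))
  finally show ?thesis by simp
qed

lemma rotate_mod_ap: "rotate i \<alpha> = rotate (i mod length (ap \<alpha>)) \<alpha>"
proof (rule nth_equalityI)
  fix j assume "j < length (rotate i \<alpha>)"
  then have j: "j < length \<alpha>" by simp
  have *: "rotate k \<alpha> ! j = ap \<alpha> ! ((k + j) mod length (ap \<alpha>))" for k
  proof -
    have "\<alpha> \<noteq> []" using j by auto
    then have "\<alpha> ! ((k + j) mod length \<alpha>) = ap \<alpha> ! ((k + j) mod length \<alpha> mod length (ap \<alpha>))"
      by (intro nth_ap) simp
    then show ?thesis
      using j by (simp only: nth_rotate mod_mod_cancel[OF length_ap_dvd])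
  qed
  show "rotate i \<alpha> ! j = rotate (i mod length (ap \<alpha>)) \<alpha> ! j"
    unfolding * by (simp add: mod_add_left_eq)
qed simp

text \<open>Two equal rotations with different offsets below the length of the primitive root would
  contradict \<open>rotate_eq_imp_ap_le\<close>. The resulting number of rotations yields L_n, and
  for an aperiodic label the injectivity recovers a position from the rotation that starts
  there.\<close>

lemma rotations_bij_betw:
  assumes "\<alpha> \<noteq> []"
  shows "bij_betw (\<lambda>i. rotate i \<alpha>) {..<length (ap \<alpha>)} (rotations \<alpha>)"
proof (rule bij_betw_imageI)
  have *: "i = j" if "i \<le> j" "j < length (ap \<alpha>)" "rotate i \<alpha> = rotate j \<alpha>" for i j
  proof (rule ccontr)
    assume "i \<noteq> j"
    have le: "length (ap \<alpha>) \<le> length \<alpha>" using length_ap_dvd assms by (simp add: dvd_imp_le)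
    have "rotate i (rotate (j - i) \<alpha>) = rotate i \<alpha>"
      using that by (simp add: rotate_rotate)
    then have "rotate (j - i) \<alpha> = \<alpha>"
    proof -
      assume eq: "rotate i (rotate (j - i) \<alpha>) = rotate i \<alpha>"
      have "rotate (length \<alpha> * i - i) (rotate i \<gamma>) = \<gamma>" if "length \<gamma> = length \<alpha>" for \<gamma>
      proof -
        have "length \<alpha> * i - i + i = length \<alpha> * i" using assms by (cases \<alpha>) auto
        then show ?thesis using that by (simp add: rotate_rotate rotate_id)
      qed
      from this[of "rotate (j - i) \<alpha>"] this[of \<alpha>] eq show ?thesis by simp
    qed
    moreover have "0 < j - i" "j - i < length (ap \<alpha>)" using that \<open>i \<noteq> j\<close> by auto
    ultimately show False using rotate_eq_imp_ap_le[of "j - i" \<alpha>] le by linarith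
  qed
  show "inj_on (\<lambda>i. rotate i \<alpha>) {..<length (ap \<alpha>)}"
    by (rule inj_onI) (metis * lessThan_iff nat_le_linear)
  show "(\<lambda>i. rotate i \<alpha>) ` {..<length (ap \<alpha>)} = rotations \<alpha>"
  proof
    show "rotations \<alpha> \<subseteq> (\<lambda>i. rotate i \<alpha>) ` {..<length (ap \<alpha>)}"
    proof
      fix \<beta> assume "\<beta> \<in> rotations \<alpha>"
      then obtain k where "\<beta> = rotate k \<alpha>" by (auto simp: rotations_def)
      moreover have "k mod length (ap \<alpha>) < length (ap \<alpha>)" using ap_not_Nil[OF assms] by simp
      ultimately show "\<beta> \<in> (\<lambda>i. rotate i \<alpha>) ` {..<length (ap \<alpha>)}"
        using rotate_mod_ap[of k \<alpha>] by blast
    qed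
  qed auto
qed

lemma card_rotations: "\<alpha> \<noteq> [] \<Longrightarrow> card (rotations \<alpha>) = length (ap \<alpha>)"
  using bij_betw_same_card[OF rotations_bij_betw] by simp

subsection \<open>Cyclic factors and joining\<close>

definition factors :: "nat \<Rightarrow> bitstring \<Rightarrow> bitstring list" where
  "factors k s = map (\<lambda>i. take k (drop i s)) [0..<Suc (length s) - k]"

text \<open>A multiset, so that the place where a cyclic string is cut does not matter while
  repetitions stay visible. Windows longer than \<open>s\<close> wrap around; this always happens
  for \<open>ap \<alpha>\<close> and k = |\<alpha>| + 1.\<close>

definition cyclic_factors :: "nat \<Rightarrow> bitstring \<Rightarrow> bitstring multiset" where
  "cyclic_factors k s = mset (map (window k s) [0..<length s])"

lemma factors_Cons:
  assumes "k \<le> Suc (length s)"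
  shows "factors k (a # s) = take k (a # s) # factors k s"
proof -
  have "[0..<Suc (Suc (length s)) - k] = 0 # map Suc [0..<Suc (length s) - k]"
    using assms by (simp add: Suc_diff_le upt_conv_Cons map_Suc_upt)
  then show ?thesis by (simp add: factors_def)
qed

text \<open>The overlap \<open>v\<close> is one letter too short to contain a factor of length k +
  1, so each such factor lies in exactly one of the two overlapping pieces.\<close>

lemma factors_overlap:
  assumes "length v = k"
  shows "factors (Suc k) (u @ v @ w) = factors (Suc k) (u @ v) @ factors (Suc k) (v @ w)"
proof (induction u)
  case Nil
  show ?case using assms by (simp add: factors_def)
next
  case (Cons a u)
  then show ?case using assms by (simp add: factors_Cons)
qed

lemma factors_single: "length v = k \<Longrightarrow> factors k v = [v]"
  by (simp add: factors_def Suc_diff_le)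

text \<open>
  For nonempty $U$, the condition that $t$ is a prefix of $Ut$ says that $t$ is a prefix of the
  infinite string $UUU\cdots$; dually for suffixes.
\<close>

lemma nth_if_prefix_self:
  assumes "U \<noteq> []" "prefix t (U @ t)" "j < length t"
  shows "t ! j = U ! (j mod length U)"
  using assms(3)
proof (induction j rule: less_induct)
  case (less j)
  from assms(2) obtain v where v: "U @ t = t @ v" by (auto elim: prefixE)
  have tj: "t ! j = (U @ t) ! j" using less.prems by (simp add: v nth_append)
  show ?case
  proof (cases "j < length U")
    case True
    then show ?thesis by (simp add: tj nth_append)
  next
    case False
    with assms(1) less.prems have "t ! (j - length U) = U ! ((j - length U) mod length U)"
      by (intro less.IH) (auto simp: not_less intro!: diff_less order.strict_trans2[of 0 "length U" j])
    with False show ?thesis by (simp add: tj nth_append le_mod_geq)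
  qed
qed

text \<open>Here t is an end of the left-infinite string ...UUU, so position j of t has offset j -
  |t| modulo |U|. The summand \<open>(length U - 1) * length t\<close> is -|t| written without
  subtraction.\<close>

lemma nth_if_suffix_self:
  assumes "U \<noteq> []" "suffix t (t @ U)" "j < length t"
  shows "t ! j = U ! ((j + (length U - 1) * length t) mod length U)"
  using assms(3)
proof (induction "length t - j" arbitrary: j rule: less_induct)
  case less
  let ?m = "length U"
  from assms(2) obtain v where v: "t @ U = v @ t" by (auto elim: suffixE)
  then have len: "length v = ?m" by (metis add_diff_cancel_right' length_append add.commute)
  have tj: "t ! j = (t @ U) ! (?m + j)" using less.prems by (simp add: v nth_append len)
  show ?case
  proof (cases "?m + j < length t")
    case True
    with assms(1) less.prems have "t ! (?m + j) = U ! ((?m + j + (?m - 1) * length t) mod ?m)"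
      by (intro less.hyps) (auto simp: diff_less_mono2)
    moreover have "(?m + j + (?m - 1) * length t) mod ?m = (j + (?m - 1) * length t) mod ?m"
      by (metis add.assoc mod_add_self1)
    ultimately show ?thesis using True by (simp add: tj nth_append)
  next
    case False
    obtain m' where m': "?m = Suc m'" using assms(1) by (cases U) auto
    obtain l where l: "length t = Suc l" using less.prems by (cases "length t") auto
    have eq: "j + m' * Suc l = (Suc m' + j - Suc l) + Suc m' * l"
      using False less.prems by (simp add: m' l algebra_simps)
    have "(j + (?m - 1) * length t) mod ?m = ?m + j - length t"
    proof -
      have "Suc m' + j - Suc l < Suc m'" using less.prems l by simp
      with eq show ?thesis unfolding m' l by (simp add: mod_mult_self2 del: mult_Suc mult_Suc_right)
    qed
    then show ?thesis using False by (simp add: tj nth_append)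
  qed
qed

lemma mset_rotate: "mset (rotate k xs) = mset xs"
  by (simp add: rotate_drop_take) (metis append_take_drop_id mset_append union_commute)

text \<open>With |x| + |y| = k the word x U y is a piece of ...UUU... that has exactly |U| factors
  of length k + 1. Its first letter has offset -|x|, represented by \<open>off\<close>, which merely
  rotates the list of windows. Joins can then be computed with linear words.\<close>

lemma cyclic_factors_eq_factors:
  assumes "U \<noteq> []" "prefix y (U @ y)" "suffix x (x @ U)" "length x + length y = k"
  shows "cyclic_factors (Suc k) U = mset (factors (Suc k) (x @ U @ y))"
proof -
  let ?m = "length U" and ?s = "x @ U @ y"
  define off where "off = (?m - 1) * length x"
  obtain m' where m': "?m = Suc m'" using assms(1) by (cases U) auto
  have off: "off + length x = ?m * length x" by (simp add: off_def m')
  have nth: "?s ! p = U ! ((p + off) mod ?m)" if p: "p < length ?s" for p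
  proof (cases "p < length x")
    case True
    then show ?thesis
      using nth_if_suffix_self[OF assms(1,3) True] by (simp add: nth_append off_def)
  next
    case False
    then have "p + off = (p - length x) + ?m * length x" using off by simp
    then have mod: "(p + off) mod ?m = (p - length x) mod ?m" by simp
    show ?thesis
    proof (cases "p - length x < ?m")
      case True
      with False show ?thesis by (simp add: nth_append mod)
    next
      case False': False
      then have "y ! (p - length x - ?m) = U ! ((p - length x - ?m) mod ?m)"
        using p False by (intro nth_if_prefix_self[OF assms(1,2)]) auto
      then show ?thesis using False False' by (simp add: nth_append mod le_mod_geq)
    qed
  qed
  have "Suc (length ?s) - Suc k = ?m" using assms(4) by simp
  then have "factors (Suc k) ?s = map (\<lambda>i. take (Suc k) (drop i ?s)) [0..<?m]"
    by (simp only: factors_def)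
  also have "\<dots> = map (\<lambda>i. window (Suc k) U ((i + off) mod ?m)) [0..<?m]"
  proof (rule map_cong[OF refl])
    fix i assume "i \<in> set [0..<?m]"
    then have i: "i < ?m" by simp
    show "take (Suc k) (drop i ?s) = window (Suc k) U ((i + off) mod ?m)"
    proof (rule nth_equalityI)
      show "length (take (Suc k) (drop i ?s)) = length (window (Suc k) U ((i + off) mod ?m))"
        using i assms(4) by (simp add: window_def)
      fix j assume "j < length (take (Suc k) (drop i ?s))"
      then have "j < min (length ?s - i) (Suc k)" by (simp only: length_take length_drop)
      then have j: "j < Suc k" "i + j < length ?s" by linarith+
      moreover have "i \<le> length ?s" using i by simp
      ultimately have "take (Suc k) (drop i ?s) ! j = ?s ! (i + j)" by (simp only: nth_take nth_drop)
      also have "\<dots> = U ! ((i + j + off) mod ?m)" using j by (intro nth)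
      also have "(i + j + off) mod ?m = ((i + off) mod ?m + j) mod ?m"
        by (metis mod_add_left_eq add.assoc add.commute)
      also have "U ! \<dots> = window (Suc k) U ((i + off) mod ?m) ! j"
        using j by (simp add: window_def del: upt_Suc)
      finally show "take (Suc k) (drop i ?s) ! j = window (Suc k) U ((i + off) mod ?m) ! j" .
    qed
  qed
  also have "\<dots> = rotate off (map (window (Suc k) U) [0..<?m])"
  proof (rule nth_equalityI)
    fix i assume "i < length (map (\<lambda>i. window (Suc k) U ((i + off) mod ?m)) [0..<?m])"
    then have i: "i < ?m" by simp
    moreover have "(off + i) mod ?m < ?m" using m' by simp
    ultimately show "map (\<lambda>i. window (Suc k) U ((i + off) mod ?m)) [0..<?m] ! i =
        rotate off (map (window (Suc k) U) [0..<?m]) ! i"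
      by (simp add: nth_rotate add.commute)
  qed simp
  finally show ?thesis by (simp add: cyclic_factors_def mset_rotate)
qed

lemma prefix_self_append: "prefix y (U @ y) \<Longrightarrow> prefix y (V @ y) \<Longrightarrow> prefix y ((U @ V) @ y)"
  by (auto intro: prefix_order.trans same_prefix_prefix[THEN iffD2])

lemma suffix_self_append: "suffix x (x @ U) \<Longrightarrow> suffix x (x @ V) \<Longrightarrow> suffix x (x @ U @ V)"
  unfolding suffix_to_prefix using prefix_self_append[of "rev x" "rev V" "rev U"] by simp

lemma prefix_self_butlast: "prefix (y @ z) (U @ y @ z) \<Longrightarrow> prefix y (U @ y)"
  by (rule prefix_length_prefix[of _ "U @ y @ z"]) (auto intro: prefix_order.trans[of _ "y @ z"])

lemma suffix_self_drop: "suffix (z @ x) ((z @ x) @ U) \<Longrightarrow> suffix x (x @ U)"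
  unfolding suffix_to_prefix using prefix_self_butlast[of "rev x" "rev z" "rev U"] by simp

lemma prefix_self_bit: "U \<noteq> [] \<Longrightarrow> prefix (y @ [p]) (U @ y @ [p]) \<Longrightarrow> prefix (y @ [p]) (U @ y)"
  by (rule prefix_length_prefix[of _ "U @ y @ [p]"]) (auto simp: Suc_le_eq)

lemma suffix_self_bit: "U \<noteq> [] \<Longrightarrow> suffix (p # x) (p # x @ U) \<Longrightarrow> suffix (p # x) (x @ U)"
  unfolding suffix_to_prefix using prefix_self_bit[of "rev U" "rev x" p] by simp

text \<open>The bits p and q extend the context of the cuts: U reads p x before and y p after its
  cut, V reads q x and y q. Hence the window over the seam from U to V is p x y q, the one over the
  seam from V back to U is q x y p, and all others are unchanged.\<close>

lemma cyclic_factors_join: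
  assumes ne: "U \<noteq> []" "V \<noteq> []" and len: "length x + length y + 1 = n"
    and pre: "prefix (y @ [p]) (U @ y @ [p])" "prefix (y @ [q]) (V @ y @ [q])"
    and suf: "suffix (p # x) (p # x @ U)" "suffix (q # x) (q # x @ V)"
  shows "cyclic_factors (Suc n) (U @ V) + {#p # x @ y @ [p], q # x @ y @ [q]#} =
    cyclic_factors (Suc n) U + cyclic_factors (Suc n) V + {#p # x @ y @ [q], q # x @ y @ [p]#}"
proof -
  obtain U' V' where U': "x @ U = U' @ p # x" and V': "x @ V = V' @ q # x"
    using suffix_self_bit[OF ne(1) suf(1)] suffix_self_bit[OF ne(2) suf(2)]
    by (auto elim!: suffixE)
  obtain V'' where V'': "V @ y = y @ q # V''"
    using prefix_self_bit[OF ne(2) pre(2)] by (auto elim!: prefixE)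
  have x: "suffix x (x @ U)" "suffix x (x @ V)"
    using suffix_self_drop[of "[p]" x U] suffix_self_drop[of "[q]" x V] suf by auto
  have y: "prefix y (V @ y)" using prefix_self_butlast[OF pre(2)] .
  have UVy: "prefix (y @ [p]) ((U @ V) @ y @ [p])"
  proof -
    have "prefix (y @ [p]) (U @ y)" by (rule prefix_self_bit[OF ne(1) pre(1)])
    also have "prefix (U @ y) (U @ V @ y @ [p])"
      using prefix_order.trans[OF y, of "V @ y @ [p]"] by simp
    finally show ?thesis by simp
  qed
  have single: "factors (Suc n) (c # x @ y @ [d]) = [c # x @ y @ [d]]" for c d
    using len by (intro factors_single) simp
  have *: "factors (Suc n) (W' @ (c # x @ y) @ d # w) =
      factors (Suc n) (W' @ c # x @ y) @ factors (Suc n) (c # x @ y @ d # w)" for W' c d w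
    using factors_overlap[of "c # x @ y" n W' "d # w"] len by simp
  have U: "cyclic_factors (Suc n) U = mset (factors (Suc n) (U' @ p # x @ y)) + {#p # x @ y @ [p]#}"
  proof -
    have "x @ U @ y @ [p] = U' @ (p # x @ y) @ p # []" using U' by (metis append.assoc append_Cons)
    then show ?thesis
      using cyclic_factors_eq_factors[OF ne(1) pre(1) x(1), of n] len
      by (simp only: *) (simp add: single)
  qed
  have V: "factors (Suc n) (x @ V @ y @ [d]) = factors (Suc n) (V' @ q # x @ y) @ [q # x @ y @ [d]]" for d
  proof -
    have "x @ V @ y @ [d] = V' @ (q # x @ y) @ d # []" using V' by (metis append.assoc append_Cons)
    then show ?thesis by (simp only: *) (simp add: single)
  qed
  \<comment> \<open>The opened join is cut at the overlap p x y of length n. The left piece carries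
    the windows of U except p x y p; the right piece starts with p x y q, followed by the windows of
    V, the last of which now ends in p.\<close>
  have "x @ (U @ V) @ y @ [p] = U' @ (p # x @ y) @ q # V'' @ [p]"
    using U' V'' by (metis append.assoc append_Cons)
  then have "factors (Suc n) (x @ (U @ V) @ y @ [p]) =
      factors (Suc n) (U' @ p # x @ y) @ factors (Suc n) (p # x @ y @ q # V'' @ [p])"
    by (simp only: *)
  also have "factors (Suc n) (p # x @ y @ q # V'' @ [p]) =
      (p # x @ y @ [q]) # factors (Suc n) (x @ V @ y @ [p])"
  proof -
    have "factors (Suc n) (x @ y @ q # V'' @ [p]) = factors (Suc n) (x @ V @ y @ [p])"
      using V'' by (metis append.assoc append_Cons)
    moreover have "take (Suc n) (p # x @ y @ q # V'' @ [p]) = p # x @ y @ [q]"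
    proof -
      have "p # x @ y @ q # V'' @ [p] = (p # x @ y @ [q]) @ V'' @ [p]" by simp
      moreover have "Suc n = length (p # x @ y @ [q])" using len by simp
      ultimately show ?thesis by (metis append_eq_conv_conj)
    qed
    moreover have "Suc n \<le> Suc (length (x @ y @ q # V'' @ [p]))" using len by simp
    ultimately show ?thesis by (simp only: factors_Cons)
  qed
  finally have "cyclic_factors (Suc n) (U @ V) = mset (factors (Suc n) (U' @ p # x @ y)) +
      {#p # x @ y @ [q]#} + mset (factors (Suc n) (V' @ q # x @ y)) + {#q # x @ y @ [p]#}"
    using cyclic_factors_eq_factors[OF _ UVy suffix_self_append[OF x], of n] ne len
    by (simp add: V)
  moreover have "cyclic_factors (Suc n) V = mset (factors (Suc n) (V' @ q # x @ y)) + {#q # x @ y @ [q]#}"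
    using cyclic_factors_eq_factors[OF ne(2) pre(2) x(2), of n] len by (simp add: V)
  ultimately show ?thesis using U by simp
qed

text \<open>The length of \<open>ap \<alpha>\<close> divides n, so the letter n places after a
  position equals the letter there; and each rotation of \<alpha> starts at exactly one position of
  the primitive root.\<close>

lemma cyclic_factors_ap:
  assumes "\<alpha> \<noteq> []" "length \<alpha> = n"
  shows "cyclic_factors (Suc n) (ap \<alpha>) = image_mset (\<lambda>s. s @ [hd s]) (mset_set (rotations \<alpha>))"
proof -
  let ?m = "length (ap \<alpha>)"
  have m: "0 < ?m" using ap_not_Nil[OF assms(1)] by simp
  have win: "window (Suc n) (ap \<alpha>) i = rotate i \<alpha> @ [hd (rotate i \<alpha>)]" for i
  proof (rule nth_equalityI)
    fix j assume "j < length (window (Suc n) (ap \<alpha>) i)"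
    then have j: "j < Suc n" by (simp add: window_def)
    have *: "rotate i \<alpha> ! l = ap \<alpha> ! ((i + l) mod ?m)" if "l < n" for l
    proof -
      have "\<alpha> ! ((i + l) mod length \<alpha>) = ap \<alpha> ! ((i + l) mod length \<alpha> mod ?m)"
        using assms(1) by (intro nth_ap) simp
      then have "\<alpha> ! ((i + l) mod length \<alpha>) = ap \<alpha> ! ((i + l) mod ?m)"
        by (simp only: mod_mod_cancel[OF length_ap_dvd])
      then show ?thesis using that assms(2) by (simp add: nth_rotate)
    qed
    have n0: "0 < n" using assms by auto
    have "rotate i \<alpha> \<noteq> []" using assms by simp
    then have "hd (rotate i \<alpha>) = ap \<alpha> ! (i mod ?m)" using *[OF n0] by (simp add: hd_conv_nth)
    moreover have "i mod ?m = (i + n) mod ?m"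
      using length_ap_dvd[of \<alpha>] assms(2) by (auto elim: dvdE)
    moreover have "window (Suc n) (ap \<alpha>) i ! j = ap \<alpha> ! ((i + j) mod ?m)"
      using j by (simp add: window_def del: upt_Suc)
    ultimately show "window (Suc n) (ap \<alpha>) i ! j = (rotate i \<alpha> @ [hd (rotate i \<alpha>)]) ! j"
      using j * assms(2) by (cases "j < n") (auto simp: nth_append less_Suc_eq)
  qed (simp add: window_def assms)
  have "cyclic_factors (Suc n) (ap \<alpha>) = image_mset (\<lambda>i. rotate i \<alpha> @ [hd (rotate i \<alpha>)]) (mset_set {0..<?m})"
    using ext[of "window (Suc n) (ap \<alpha>)", OF win] by (simp add: cyclic_factors_def)
  also have "\<dots> = image_mset (\<lambda>s. s @ [hd s]) (image_mset (\<lambda>i. rotate i \<alpha>) (mset_set {..<?m}))"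
    by (simp add: image_mset.compositionality comp_def atLeast0LessThan)
  also have "image_mset (\<lambda>i. rotate i \<alpha>) (mset_set {..<?m}) = mset_set (rotations \<alpha>)"
    using rotations_bij_betw[OF assms(1)] by (simp add: bij_betw_def image_mset_mset_set)
  finally show ?thesis .
qed

subsection \<open>Flips within a run\<close>

text \<open>Let F, with indicator \<open>f\<close>, be the n-periodic set of integers at which the
  bit differs from v. The hypothesis says that F with k added, shifted by m, is F with k' added. So
  k + m, k + 2m, ... stay in F until step s reaches k', and an element of F off this progression has
  an orbit under +m that never leaves F. Such an orbit is a residue class modulo gcd(m, n), which
  divides k' - k; the class meets the run, where F is empty. Hence F is the progression alone, and
  reflecting i to 2k + sm - i preserves it.\<close>

lemma symmetric_if_flips_in_run_conjugate:
  assumes "k < k'" "k' < length \<beta>" and run: "\<And>j. k \<le> j \<Longrightarrow> j \<le> k' \<Longrightarrow> \<beta> ! j = v"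
    and conj: "\<beta>[k := \<not> v] \<in> rotations (\<beta>[k' := \<not> v])"
  shows "symmetric \<beta>"
proof -
  define n where "n = int (length \<beta>)"
  have n: "n > 0" using assms(2) unfolding n_def by linarith
  define f where "f i = (\<beta> ! nat (i mod n) \<noteq> v)" for i :: int
  have f_cong: "f i = f j" if "n dvd i - j" for i j
  proof -
    have "i mod n = j mod n" using that by (simp add: mod_eq_dvd_iff)
    then show ?thesis by (simp add: f_def)
  qed
  have f_nat: "f (int i) = (\<beta> ! i \<noteq> v)" if "i < length \<beta>" for i
    using that by (simp add: f_def n_def nat_mod_distrib)
  obtain m where m: "\<beta>[k := \<not> v] = rotate m (\<beta>[k' := \<not> v])"
    using conj by (auto simp: rotations_def)
  have step: "f i \<or> n dvd i - int k \<longleftrightarrow> f (i + int m) \<or> n dvd i + int m - int k'" for i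
  proof -
    define i0 where "i0 = nat (i mod n)"
    have i0: "i0 < length \<beta>" "int i0 = i mod n" using n by (auto simp: i0_def n_def nat_less_iff)
    have ne: "\<beta> \<noteq> []" using assms by auto
    have shift: "(m + i0) mod length \<beta> = nat ((i + int m) mod n)"
    proof -
      have "int ((m + i0) mod length \<beta>) = (i + int m) mod n"
        by (simp add: zmod_int i0(2) n_def mod_add_right_eq add.commute)
      then show ?thesis by (metis nat_int)
    qed
    have eqk: "nat (i mod n) = a \<longleftrightarrow> n dvd i - int a" if "a < length \<beta>" for i a
    proof -
      have "nat (i mod n) = a \<longleftrightarrow> i mod n = int a" using n by auto
      also have "int a = int a mod n" using that by (simp add: n_def)
      finally show ?thesis by (simp add: mod_eq_dvd_iff)
    qed
    have "\<beta>[k := \<not> v] ! i0 = \<beta>[k' := \<not> v] ! ((m + i0) mod length \<beta>)"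
      using i0(1) by (simp add: m nth_rotate)
    moreover have "\<beta>[k := \<not> v] ! i0 \<noteq> v \<longleftrightarrow> f i \<or> i0 = k"
      using assms(1,2) by (auto simp: nth_list_update f_def i0_def)
    moreover have "\<beta>[k' := \<not> v] ! ((m + i0) mod length \<beta>) \<noteq> v \<longleftrightarrow>
        f (i + int m) \<or> nat ((i + int m) mod n) = k'"
      using assms(2) ne shift[symmetric] by (auto simp: nth_list_update f_def)
    ultimately show ?thesis
      using eqk[of k i] eqk[of k' "i + int m"] assms i0_def by auto
  qed
  have nf: "\<not> f (int j)" if "k \<le> j" "j \<le> k'" for j
    using that run f_nat[of j] assms(2) by auto
  \<comment> \<open>After n steps the orbit of k is back at k, which lies in the run and so not in
    F; hence a least exit \<open>s\<close> exists.\<close>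
  have "\<exists>s. s \<ge> 1 \<and> \<not> f (int k + int s * int m)"
  proof (intro exI conjI)
    show "nat n \<ge> 1" using n by simp
    have "f (int k + int (nat n) * int m) = f (int k)" using n by (intro f_cong) simp
    then show "\<not> f (int k + int (nat n) * int m)" using nf[of k] assms by simp
  qed
  then obtain s where s: "s \<ge> 1" "\<not> f (int k + int s * int m)"
    and s_min: "\<And>t. 1 \<le> t \<Longrightarrow> t < s \<Longrightarrow> f (int k + int t * int m)"
    using exists_least_iff[of "\<lambda>s. s \<ge> 1 \<and> \<not> f (int k + int s * int m)"] by blast
  have k': "n dvd int k + int s * int m - int k'"
  proof -
    let ?i = "int k + int (s - 1) * int m"
    have i: "?i + int m = int k + int s * int m" using s(1) by (simp add: of_nat_diff algebra_simps)
    have "f ?i \<or> n dvd ?i - int k"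
      using s_min[of "s - 1"] s(1) by (cases "s = 1") auto
    with step[of ?i] i s(2) show ?thesis by metis
  qed
  have chain: "\<exists>t. 1 \<le> t \<and> t < s \<and> n dvd i - (int k + int t * int m)" if fi: "f i" for i
  proof (rule ccontr)
    assume no: "\<not> ?thesis"
    \<comment> \<open>An orbit outside the progression cannot enter it: the predecessor of the entry
      would be in the progression already or be k, which is not in F. The bound u \<le> s in
      \<open>up\<close> includes the end k' of the progression.\<close>
    have closed: "f (i + int t * int m) \<and>
        \<not> (\<exists>u. 1 \<le> u \<and> u < s \<and> n dvd i + int t * int m - (int k + int u * int m))" for t
    proof (induction t)
      case 0
      show ?case using fi no by simp
    next
      case (Suc t)
      let ?j = "i + int t * int m"
      have j: "i + int (Suc t) * int m = ?j + int m" by (simp add: algebra_simps)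
      have nk: "\<not> n dvd ?j - int k"
        using Suc.IH f_cong[of ?j "int k"] nf[of k] assms(1) by auto
      have up: "\<not> n dvd ?j + int m - (int k + int u * int m)" if u: "1 \<le> u" "u \<le> s" for u
      proof
        assume "n dvd ?j + int m - (int k + int u * int m)"
        then have d: "n dvd ?j - (int k + int (u - 1) * int m)"
          using u by (simp add: of_nat_diff algebra_simps)
        show False
        proof (cases "u = 1")
          case True
          with d nk show False by simp
        next
          case False
          with d u Suc.IH show False by (metis Suc_diff_1 Suc_leI diff_Suc_1 le_neq_implies_less less_le_trans lessI not_less_eq_eq One_nat_def Suc_pred)
        qed
      qed
      have "\<not> n dvd ?j + int m - int k'"
      proof
        assume "n dvd ?j + int m - int k'"
        from dvd_diff[OF this k'] have "n dvd ?j + int m - (int k + int s * int m)"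
          by (simp add: algebra_simps)
        with up[of s] s(1) show False by simp
      qed
      with step[of ?j] Suc.IH have "f (?j + int m)" by blast
      with up show ?case unfolding j by (meson less_imp_le)
    qed
    define d where "d = gcd (int m) n"
    have d: "d > 0" using n by (simp add: d_def gcd_pos_int)
    have "d dvd int k' - int k"
    proof -
      have "d dvd int k + int s * int m - int k'" using k' dvd_trans[of d n] by (simp add: d_def)
      moreover have "d dvd int s * int m" by (simp add: d_def)
      ultimately have "d dvd int s * int m - (int k + int s * int m - int k')" by (rule dvd_diff[rotated])
      then show ?thesis by (simp add: algebra_simps)
    qed
    then have d_le: "d \<le> int k' - int k" using assms(1) by (intro zdvd_imp_le) auto
    \<comment> \<open>The representative of the class of i modulo d that lies in the run; it exists
      since d is at most k' - k. Bezout's identity gives the number t of steps that lead from i to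
      j.\<close>
    define j where "j = int k + (i - int k) mod d"
    have j: "int k \<le> j" "j \<le> int k'"
      unfolding j_def using d_le pos_mod_bound[OF d, of "i - int k"] pos_mod_sign[OF d, of "i - int k"]
      by linarith+
    have "d dvd j - i" 
    proof -
      have "j - i = (i - int k) mod d - (i - int k)" by (simp add: j_def)
      also have "d dvd \<dots>" by (simp add: mod_eq_dvd_iff[symmetric])
      finally show ?thesis .
    qed
    then obtain q where q: "j - i = d * q" by (auto elim: dvdE)
    obtain u w where uw: "u * int m + w * n = d" using bezout_int[of "int m" n] by (auto simp: d_def)
    define t where "t = nat ((q * u) mod n)"
    have t: "int t = (q * u) mod n" using n by (simp add: t_def)
    have "n dvd q * u - int t" by (simp add: t mod_eq_dvd_iff[symmetric])
    then have "n dvd (int t - q * u) * int m" by (metis dvd_minus_iff dvd_mult2 minus_diff_eq)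
    moreover have "i + int t * int m - j = (int t - q * u) * int m - n * (w * q)"
    proof -
      have "j - i = (u * int m + w * n) * q" using q uw by simp
      then show ?thesis by (simp add: algebra_simps)
    qed
    ultimately have "n dvd i + int t * int m - j" by simp
    then have "f j" using closed[of t] f_cong by blast
    moreover have "j = int (nat j)" "k \<le> nat j" "nat j \<le> k'" using j by auto
    ultimately show False using nf[of "nat j"] by simp
  qed
  have refl: "f (2 * int k + int s * int m - i)" if fi: "f i" for i
  proof -
    obtain t where t: "1 \<le> t" "t < s" "n dvd i - (int k + int t * int m)" using chain[OF fi] by blast
    then have "f (int k + int (s - t) * int m)" by (intro s_min) auto
    moreover have "n dvd (2 * int k + int s * int m - i) - (int k + int (s - t) * int m)"
    proof -
      have "(2 * int k + int s * int m - i) - (int k + int (s - t) * int m) =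
          - (i - (int k + int t * int m))" using t(2) by (simp add: of_nat_diff algebra_simps)
      then show ?thesis using t(3) by (simp only: dvd_minus_iff)
    qed
    ultimately show ?thesis using f_cong by blast
  qed
  \<comment> \<open>Reflecting position n - 1 - i gives (2k + sm - n + 1) + i, so reversal is the
    rotation by this amount.\<close>
  define r where "r = nat ((2 * int k + int s * int m - n + 1) mod n)"
  have r: "int r = (2 * int k + int s * int m - n + 1) mod n" using n by (simp add: r_def)
  have "rev \<beta> = rotate r \<beta>"
  proof (rule nth_equalityI)
    fix i assume "i < length (rev \<beta>)"
    then have i: "i < length \<beta>" by simp
    let ?j = "length \<beta> - Suc i"
    have "f (int ?j) = f (2 * int k + int s * int m - int ?j)"
      using refl[of "int ?j"] refl[of "2 * int k + int s * int m - int ?j"] by auto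
    also have "\<dots> = f (int ((r + i) mod length \<beta>))"
    proof (rule f_cong)
      have 1: "n dvd 2 * int k + int s * int m - n + 1 - int r" by (simp add: r mod_eq_dvd_iff[symmetric])
      have 2: "n dvd int r + int i - int ((r + i) mod length \<beta>)"
        by (simp add: zmod_int n_def mod_eq_dvd_iff[symmetric])
      have "2 * int k + int s * int m - int ?j - int ((r + i) mod length \<beta>) =
          (2 * int k + int s * int m - n + 1 - int r) + (int r + int i - int ((r + i) mod length \<beta>))"
        using i by (simp add: n_def of_nat_diff)
      then show "n dvd 2 * int k + int s * int m - int ?j - int ((r + i) mod length \<beta>)"
        using 1 2 by (metis dvd_add)
    qed
    finally have "f (int ?j) = f (int ((r + i) mod length \<beta>))" .
    moreover have "0 < length \<beta>" using i by linarith
    then have "?j < length \<beta>" "(r + i) mod length \<beta> < length \<beta>" by simp_all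
    ultimately have "(\<beta> ! ?j \<noteq> v) = (\<beta> ! ((r + i) mod length \<beta>) \<noteq> v)"
      using f_nat[of ?j] f_nat[of "(r + i) mod length \<beta>"] by blast
    then show "rev \<beta> ! i = rotate r \<beta> ! i" using i by (auto simp: rev_nth nth_rotate)
  qed simp
  then show ?thesis unfolding symmetric_def by simp
qed

subsection \<open>Asymmetric bracelets\<close>

lemma strict_rotations_not_periodic:
  assumes "\<And>k. 0 < k \<Longrightarrow> k < length \<beta> \<Longrightarrow> \<beta> < rotate k \<beta>" "\<beta> \<noteq> []"
  shows "\<not> periodic \<beta>"
  using periodic_imp_rotate_eq[of \<beta>] assms by (metis less_irrefl)

lemma strict_rotations_le:
  assumes "\<And>k. 0 < k \<Longrightarrow> k < length \<beta> \<Longrightarrow> \<beta> < rotate k \<beta>" "\<rho> \<in> rotations \<beta>"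
  shows "\<beta> \<le> \<rho>"
proof -
  obtain k where "\<rho> = rotate k \<beta>" using assms(2) by (auto simp: rotations_def)
  then have k: "\<rho> = rotate (k mod length \<beta>) \<beta>" by (metis rotate_conv_mod)
  show ?thesis
  proof (cases "k mod length \<beta> = 0 \<or> \<beta> = []")
    case True
    then show ?thesis using k by auto
  next
    case False
    then have "0 < k mod length \<beta>" by simp
    moreover have "k mod length \<beta> < length \<beta>" using False by auto
    ultimately show ?thesis using assms(1) k by (simp add: less_imp_le)
  qed
qed

section \<open>Strings whose initial run of zeros is the unique longest one\<close>

lemma leading_zeros_less_if_no_run:
  assumes "\<not> sublist (replicate A False) w"
  shows "leading_zeros (drop i w) < A"
proof (rule ccontr)
  assume "\<not> ?thesis"
  then have le: "A \<le> leading_zeros (drop i w)" by simp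
  have "takeWhile Not (drop i w) = replicate (leading_zeros (drop i w)) False"
    unfolding leading_zeros_def by (rule replicate_eqI) (auto dest: set_takeWhileD)
  then have "prefix (replicate (leading_zeros (drop i w)) False) (drop i w)"
    by (metis takeWhile_is_prefix)
  moreover have "prefix (replicate A False) (replicate (leading_zeros (drop i w)) False)"
    using le by (metis le_add_diff_inverse prefixI replicate_add)
  ultimately have "sublist (replicate A False) (drop i w)"
    by (meson prefix_imp_sublist prefix_order.trans)
  then show False using assms by (meson sublist_drop sublist_order.order.trans)
qed

text \<open>As w begins and ends with 1 and contains no run of A zeros, 0^A occurs only once
  cyclically, and every proper rotation has fewer leading zeros.\<close>

lemma leading_run_less_rotate:
  assumes w: "w \<noteq> []" "hd w" "last w" and run: "\<not> sublist (replicate A False) w"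
    and k: "0 < k" "k < length (replicate A False @ w)"
  shows "replicate A False @ w < rotate k (replicate A False @ w)"
proof (rule less_if_leading_zeros_less)
  let ?\<beta> = "replicate A False @ w"
  have lz: "leading_zeros ?\<beta> = A" using w by (cases w) auto
  have A: "0 < A" using leading_zeros_less_if_no_run[OF run] by (metis gr_implies_not0 not_gr0)
  have rot: "rotate k ?\<beta> = drop k ?\<beta> @ take k ?\<beta>" using k by (simp add: rotate_drop_take)
  show "leading_zeros (rotate k ?\<beta>) < leading_zeros ?\<beta>"
  proof (cases "k < A")
    case True
    then have "leading_zeros (drop k ?\<beta> @ take k ?\<beta>) = A - k" using w by (cases w) auto
    then show ?thesis using True k lz rot by simp
  next
    case False
    then have d: "drop k ?\<beta> = drop (k - A) w" by simp
    have lt: "k - A < length w" using k False by auto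
    then have "last (drop (k - A) w)" using w(3) by (simp add: last_drop)
    then have "True \<in> set (drop (k - A) w)"
      using lt last_in_set[of "drop (k - A) w"] by simp
    then have "leading_zeros (rotate k ?\<beta>) = leading_zeros (drop (k - A) w)"
      by (simp only: rot d leading_zeros_append)
    then show ?thesis using leading_zeros_less_if_no_run[OF run] lz by simp
  qed
qed simp

text \<open>Both 0^A w and 0^A followed by the reversal of w are least among their rotations, and
  they represent the two classes to be compared. So only w and its reversal need comparing.\<close>

lemma leading_run_asym_bracelet_iff:
  assumes w: "w \<noteq> []" "hd w" "last w" and run: "\<not> sublist (replicate A False) w"
  shows "replicate A False @ w \<in> asym_bracelets (A + length w) \<longleftrightarrow> w < rev w"
proof
  have "replicate A False @ rev w \<in> rotations (rev (replicate A False @ w))"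
    using append_swap_in_rotations[of "replicate A False" "rev w"] by simp
  moreover assume "replicate A False @ w \<in> asym_bracelets (A + length w)"
  ultimately show "w < rev w" unfolding asym_bracelets_iff by auto
next
  assume less: "w < rev w"
  have "replicate A False @ w \<le> \<rho>" if "\<rho> \<in> rotations (replicate A False @ w)" for \<rho>
    by (rule strict_rotations_le[OF leading_run_less_rotate[OF w run] that])
  moreover have "replicate A False @ w < \<rho>" if "\<rho> \<in> rotations (rev (replicate A False @ w))" for \<rho>
  proof -
    have "replicate A False @ rev w \<in> rotations (rev (replicate A False @ w))"
      using append_swap_in_rotations[of "replicate A False" "rev w"] by simp
    then have \<rho>: "\<rho> \<in> rotations (replicate A False @ rev w)"
      using that rotations_eq by blast
    have "rev w \<noteq> []" "hd (rev w)" "last (rev w)" using w by (auto simp: hd_rev last_rev)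
    moreover have "\<not> sublist (replicate A False) (rev w)"
      using run sublist_rev[of "replicate A False" w] by simp
    ultimately have "replicate A False @ rev w \<le> \<rho>"
      by (intro strict_rotations_le[OF leading_run_less_rotate \<rho>])
    with less show ?thesis by (metis append_less_append_iff order_less_le_trans)
  qed
  ultimately show "replicate A False @ w \<in> asym_bracelets (A + length w)"
    by (simp add: asym_bracelets_iff)
qed

lemma asym_bracelet_no_run:
  assumes "\<gamma> \<in> asym_bracelets n"
  shows "\<not> sublist (replicate (Suc (leading_zeros \<gamma>)) False) \<gamma>"
proof
  assume "sublist (replicate (Suc (leading_zeros \<gamma>)) False) \<gamma>"
  then obtain u v where \<gamma>: "\<gamma> = u @ replicate (Suc (leading_zeros \<gamma>)) False @ v"
    by (auto simp: sublist_def)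
  let ?\<rho> = "(replicate (Suc (leading_zeros \<gamma>)) False @ v) @ u"
  have "?\<rho> \<in> rotations \<gamma>"
    by (subst (2) \<gamma>) (rule append_swap_in_rotations)
  moreover have "leading_zeros \<gamma> < leading_zeros ?\<rho>" by (simp del: replicate_Suc)
  ultimately show False
    using less_if_leading_zeros_less[of ?\<rho> \<gamma>] assms length_rotations[of ?\<rho> \<gamma>]
    unfolding asym_bracelets_iff by (meson leD)
qed

lemma split_first_one:
  assumes "True \<in> set u"
  obtains a v where "u = replicate a False @ True # v"
proof -
  obtain u1 v where u: "u = u1 @ True # v" "True \<notin> set u1"
    using split_list_first[OF assms] by blast
  then show ?thesis using all_eq_replicate[of False u1] that by auto
qed

lemma split_last_one:
  assumes "True \<in> set u"
  obtains v c where "u = v @ True # replicate c False"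
proof -
  obtain u1 v where u: "u = v @ True # u1" "True \<notin> set u1"
    using split_list_last[OF assms] by blast
  then show ?thesis using all_eq_replicate[of False u1] that by auto
qed

text \<open>Strings with fewer than three ones are symmetric, so the block 0^B after the first one
  and the block 0^C before the last one are separated by X, which may be a single 1. The initial 0
  and the final 1 come from minimality: moving a final 0 to the front would decrease the
  string.\<close>

lemma asym_bracelet_form:
  assumes "\<gamma> \<in> asym_bracelets n"
  obtains a B X C where "\<gamma> = replicate a False @ True # replicate B False @ X @ replicate C False @ [True]"
    "a > 0" "X \<noteq> []" "hd X" "last X"
proof -
  have asym: "\<not> symmetric \<gamma>" and neck: "\<And>\<rho>. \<rho> \<in> rotations \<gamma> \<Longrightarrow> \<gamma> \<le> \<rho>"
    using assms by (auto simp: asym_bracelets_def asym_bracelets_iff bracelet_def)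
  from asym obtain P e where P: "\<gamma> = P @ False # replicate e True" "True \<in> set P"
    by (rule asymmetric_split)
  then have "True \<in> set \<gamma>" by simp
  then obtain a y where y: "\<gamma> = replicate a False @ True # y" by (rule split_first_one)
  have a: "a > 0"
  proof (rule ccontr)
    assume "\<not> a > 0"
    then have "\<gamma> = True # y" using y by simp
    moreover have "\<gamma> \<le> (False # replicate e True) @ P"
      using P(1) by (intro neck) (simp only: append_swap_in_rotations)
    ultimately show False by simp
  qed
  have last: "last \<gamma>"
  proof (rule ccontr)
    assume l: "\<not> last \<gamma>"
    have "\<gamma> = butlast \<gamma> @ [last \<gamma>]" using y by (intro append_butlast_last_id[symmetric]) auto
    with l have \<gamma>: "\<gamma> = butlast \<gamma> @ [False]" by simp
    then have "True \<in> set (butlast \<gamma>)" using \<open>True \<in> set \<gamma>\<close>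
      by (metis Un_iff empty_iff empty_set list.set(2) set_append insert_iff)
    then have lz: "leading_zeros \<gamma> = leading_zeros (butlast \<gamma>)" using leading_zeros_append \<gamma> by metis
    have "[False] @ butlast \<gamma> \<in> rotations \<gamma>" by (subst (2) \<gamma>) (rule append_swap_in_rotations)
    moreover have "[False] @ butlast \<gamma> < \<gamma>"
      using lz by (intro less_if_leading_zeros_less) (auto simp: y)
    ultimately show False using neck by (meson leD)
  qed
  have "True \<in> set y"
  proof (rule ccontr)
    assume "True \<notin> set y"
    then obtain b where "y = replicate b False" using all_eq_replicate[of False y] by auto
    with last y have "\<gamma> = replicate a False @ replicate 1 True"
      by (cases "b = 0") (auto simp: last_replicate)
    then show False using asym zeros_ones_symmetric by metis
  qed
  then obtain B u where u: "y = replicate B False @ True # u" by (rule split_first_one)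
  have "u \<noteq> []"
  proof
    assume "u = []"
    then have \<gamma>: "\<gamma> = replicate a False @ [True] @ replicate B False @ [True]" using y u by simp
    have "rev \<gamma> = ([True] @ replicate B False @ [True]) @ replicate a False" by (simp add: \<gamma>)
    also have "\<dots> \<in> rotations \<gamma>" by (subst \<gamma>) (rule append_swap_in_rotations)
    finally show False using asym by (simp add: symmetric_def)
  qed
  with last have ul: "u = butlast u @ [True]" by (simp add: y u) (metis append_butlast_last_id)
  obtain X2 C where X2: "True # butlast u = X2 @ True # replicate C False"
    by (rule split_last_one[of "True # butlast u"]) auto
  have "\<gamma> = replicate a False @ True # replicate B False @ (X2 @ [True]) @ replicate C False @ [True]"
    using X2 ul by (simp add: y u) (metis append.assoc append_Cons)
  moreover have "hd (X2 @ [True])" using X2 by (cases X2) auto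
  ultimately show ?thesis using that[of a B "X2 @ [True]" C] a by simp
qed

text \<open>The word z singles out a position k' of \<beta> whose flip gives a rotation of \<gamma>,
  as the flip at k does. If the positions differ, the two flips are conjugate and lie in a common
  run, which makes \<beta> symmetric. The hypothesis \<open>run\<close> is what each of the three
  parent rules has to supply.\<close>

lemma flip_word_unique:
  assumes "length \<beta> = n" "k < n" "\<beta> ! k = v" "\<not> symmetric \<beta>"
    and "\<beta>[k := \<not> v] \<in> rotations \<gamma>" "v # z \<in> rotations \<beta>" "(\<not> v) # z \<in> rotations \<gamma>"
    and run: "\<And>k' j. k' < n \<Longrightarrow> \<beta> ! k' = v \<Longrightarrow> \<beta>[k' := \<not> v] \<in> rotations \<gamma> \<Longrightarrow>
      min k k' \<le> j \<Longrightarrow> j \<le> max k k' \<Longrightarrow> \<beta> ! j = v"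
  shows "z = drop (Suc k) \<beta> @ take k \<beta>"
proof -
  obtain i where "v # z = rotate i \<beta>" using assms(6) by (auto simp: rotations_def)
  then have i: "v # z = rotate (i mod n) \<beta>" by (metis assms(1) rotate_conv_mod)
  define k' where "k' = i mod n"
  have k': "k' < n" "v # z = drop k' \<beta> @ take k' \<beta>"
    using i assms(1,2) by (auto simp: k'_def rotate_drop_take)
  have drop: "drop k' \<beta> = \<beta> ! k' # drop (Suc k') \<beta>"
    using k'(1) assms(1) by (simp add: Cons_nth_drop_Suc)
  have v: "\<beta> ! k' = v" and z: "z = drop (Suc k') \<beta> @ take k' \<beta>"
    using k'(2) by (auto simp: drop)
  have "\<beta>[k' := \<not> v] = take k' \<beta> @ (\<not> v) # drop (Suc k') \<beta>"
    using k'(1) assms(1) by (simp add: upd_conv_take_nth_drop)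
  then have "(\<not> v) # z \<in> rotations (\<beta>[k' := \<not> v])"
    unfolding z using append_swap_in_rotations[of "(\<not> v) # drop (Suc k') \<beta>" "take k' \<beta>"] by simp
  then have conj: "\<beta>[k' := \<not> v] \<in> rotations \<gamma>"
    using assms(7) by (blast intro: rotations_trans rotations_sym)
  have "k' = k"
  proof (rule ccontr)
    assume ne: "k' \<noteq> k"
    have "\<beta>[min k k' := \<not> v] \<in> rotations (\<beta>[max k k' := \<not> v])"
      using conj assms(5) rotations_eq[OF conj] rotations_eq[OF assms(5)]
      by (auto simp: min_def max_def)
    moreover have "min k k' < max k k'" "max k k' < length \<beta>" using ne k'(1) assms(1,2) by auto
    ultimately have "symmetric \<beta>"
      using run[OF k'(1) v conj] by (intro symmetric_if_flips_in_run_conjugate[of "min k k'" "max k k'" \<beta> v])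
    with assms(4) show False by simp
  qed
  with z show ?thesis by simp
qed

section \<open>The parents given by FirstOne and LastOne\<close>

lemma flip_first_True_replicate:
  "flip_first True (replicate a False @ True # u) = replicate a False @ False # u"
  by (induction a) auto

text \<open>The blocks 0^B and 0^C are what FirstOne and LastOne merge into the initial run: the
  parents are 0^(a+1+B) W and 0^(a+1+C) Y. Since a is the longest run of zeros in \<gamma>, the
  criterion for a unique longest run applies to both.\<close>

locale bracelet_form =
  fixes n :: nat and \<gamma> X :: bitstring and a B C :: nat
  assumes in_A: "\<gamma> \<in> asym_bracelets n"
    and \<gamma>_eq: "\<gamma> = replicate a False @ True # replicate B False @ X @ replicate C False @ [True]"
    and a_pos: "a > 0" and X_ne: "X \<noteq> []" and X_hd: "hd X" and X_last: "last X"
begin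

abbreviation W where "W \<equiv> X @ replicate C False @ [True]"
abbreviation Y where "Y \<equiv> True # replicate B False @ X"

lemma length_\<gamma>: "length \<gamma> = n" and necklace: "\<rho> \<in> rotations \<gamma> \<Longrightarrow> \<gamma> \<le> \<rho>"
  and reverse_greater: "\<rho> \<in> rotations (rev \<gamma>) \<Longrightarrow> \<gamma> < \<rho>"
  using in_A by (auto simp: asym_bracelets_iff)

lemma n_eq: "n = a + B + length X + C + 2"
  using length_\<gamma> by (simp add: \<gamma>_eq)

lemma leading_zeros_\<gamma>: "leading_zeros \<gamma> = a"
  by (simp add: \<gamma>_eq)

lemma no_run:
  assumes "sublist w \<gamma>" "a < A"
  shows "\<not> sublist (replicate A False) w"
proof
  assume "sublist (replicate A False) w"
  moreover have "replicate A False = replicate (Suc a) False @ replicate (A - Suc a) False"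
    using assms(2) by (metis Suc_leI le_add_diff_inverse replicate_add)
  then have "sublist (replicate (Suc a) False) (replicate A False)"
    by (simp only: prefix_imp_sublist prefixI)
  ultimately have "sublist (replicate (Suc a) False) \<gamma>"
    using assms(1) by (meson sublist_order.order.trans)
  then show False using asym_bracelet_no_run[OF in_A] leading_zeros_\<gamma> by simp
qed

lemma W_props: "W \<noteq> []" "hd W" "last W" "\<not> sublist (replicate (a + 1 + B) False) W"
proof -
  show "hd W" using X_ne X_hd by (cases X) auto
  have "sublist W \<gamma>"
    unfolding sublist_def \<gamma>_eq by (metis append.assoc append_Cons append_Nil append_Nil2)
  then show "\<not> sublist (replicate (a + 1 + B) False) W" by (rule no_run) simp
qed auto

lemma Y_props: "Y \<noteq> []" "hd Y" "last Y" "\<not> sublist (replicate (a + 1 + C) False) Y"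
proof -
  show "last Y" using X_ne X_last by simp
  have "\<gamma> = replicate a False @ Y @ replicate C False @ [True]" by (simp add: \<gamma>_eq)
  then have "sublist Y \<gamma>" by (auto simp: sublist_def)
  then show "\<not> sublist (replicate (a + 1 + C) False) Y" by (rule no_run) simp
qed auto

lemma first_one_eq: "first_one \<gamma> = replicate (a + 1 + B) False @ W"
proof -
  have "replicate a False @ False # replicate B False = replicate (a + 1 + B) False"
    by (metis add.assoc append_Cons append_Nil plus_1_eq_Suc replicate_Suc replicate_add)
  then show ?thesis
    unfolding first_one_def \<gamma>_eq by (metis append.assoc append_Cons flip_first_True_replicate)
qed

lemma first_one_in_iff: "first_one \<gamma> \<in> asym_bracelets n \<longleftrightarrow> W < rev W"
proof -
  have "n = a + 1 + B + length W" by (simp add: n_eq)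
  then show ?thesis
    unfolding first_one_eq using leading_run_asym_bracelet_iff[OF W_props] by metis
qed

lemma last_one_eq: "last_one \<gamma> = replicate (a + 1 + C) False @ Y"
proof -
  have "replicate C False @ [False] @ replicate a False = replicate (a + 1 + C) False"
    by (metis add.assoc add.commute replicate_add replicate_Suc replicate_0 One_nat_def)
  then have "replicate (a + 1 + C) False @ Y = (replicate C False @ [False]) @ replicate a False @ Y"
    by (metis append.assoc)
  moreover have "butlast \<gamma> @ [False] = (replicate a False @ Y) @ replicate C False @ [False]"
    by (simp add: \<gamma>_eq butlast_append)
  ultimately have "replicate (a + 1 + C) False @ Y \<in> rotations (butlast \<gamma> @ [False])"
    using append_swap_in_rotations by metis
  then show ?thesis
    unfolding last_one_def
    by (rule necklace_of_eqI) (use strict_rotations_le[OF leading_run_less_rotate[OF Y_props]] in blast)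
qed

lemma last_one_in_iff: "last_one \<gamma> \<in> asym_bracelets n \<longleftrightarrow> Y < rev Y"
proof -
  have "n = a + 1 + C + length Y" by (simp add: n_eq)
  then show ?thesis
    unfolding last_one_eq using leading_run_asym_bracelet_iff[OF Y_props] by metis
qed

text \<open>The parent has one 1 less than \<gamma>, which fixes b. A flip of a parent bit that
  leads back to the class of \<gamma> must lie in the leading zeros of the parent: otherwise the
  result keeps more than a leading zeros and is a rotation of \<gamma> below \<gamma>. So all
  candidate flips lie in one run.\<close>

lemma first_one_link:
  assumes "first_one \<gamma> \<in> asym_bracelets n"
  defines "z0 \<equiv> replicate B False @ W @ replicate a False"
  shows "\<not> periodic (first_one \<gamma>)" "True # z0 \<in> rotations \<gamma>" "False # z0 \<in> rotations (first_one \<gamma>)"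
    "b # z \<in> rotations \<gamma> \<Longrightarrow> (\<not> b) # z \<in> rotations (first_one \<gamma>) \<Longrightarrow> z = z0"
proof -
  let ?\<beta> = "first_one \<gamma>"
  show "\<not> periodic ?\<beta>"
    unfolding first_one_eq
    by (rule strict_rotations_not_periodic[OF leading_run_less_rotate[OF W_props]]) auto
  have \<beta>: "?\<beta> = replicate a False @ False # replicate B False @ W"
    unfolding first_one_def by (simp add: \<gamma>_eq flip_first_True_replicate)
  have \<gamma>: "\<gamma> = replicate a False @ True # replicate B False @ W" by (simp add: \<gamma>_eq)
  show "True # z0 \<in> rotations \<gamma>"
    using append_swap_in_rotations[of "True # replicate B False @ W" "replicate a False"]
    by (simp add: \<gamma> z0_def)
  show "False # z0 \<in> rotations ?\<beta>"
    using append_swap_in_rotations[of "False # replicate B False @ W" "replicate a False"]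
    by (simp add: \<beta> z0_def)
  assume z: "b # z \<in> rotations \<gamma>" "(\<not> b) # z \<in> rotations ?\<beta>"
  have "weight \<gamma> = weight X + 2" "weight ?\<beta> = weight X + 1" by (simp add: \<gamma>_eq, simp add: \<beta>)
  then have b
    using weight_rotations[OF z(1)] weight_rotations[OF z(2)] by (cases b) simp_all
  have asym: "\<not> symmetric ?\<beta>" using assms by (simp add: asym_bracelets_def)
  have len: "length ?\<beta> = n" using assms by (simp add: asym_bracelets_def)
  have "z = drop (Suc a) ?\<beta> @ take a ?\<beta>"
  proof (rule flip_word_unique[where v = False and \<gamma> = \<gamma> and n = n])
    show "a < n" using n_eq by simp
    show "?\<beta> ! a = False" by (simp add: \<beta> nth_append)
    have "?\<beta>[a := \<not> False] = \<gamma>" unfolding \<beta> using \<gamma> by (simp add: list_update_append)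
    then show "?\<beta>[a := \<not> False] \<in> rotations \<gamma>" by simp
    show "False # z \<in> rotations ?\<beta>" "(\<not> False) # z \<in> rotations \<gamma>" using z \<open>b\<close> by auto
    fix k' j assume k': "k' < n" "?\<beta>[k' := \<not> False] \<in> rotations \<gamma>"
      and j: "min a k' \<le> j" "j \<le> max a k'"
    have "k' < a + 1 + B"
    proof (rule ccontr)
      assume "\<not> k' < a + 1 + B"
      then have "?\<beta>[k' := \<not> False] = replicate (a + 1 + B) False @ W[k' - (a + 1 + B) := True]"
        unfolding first_one_eq by (simp only: list_update_append length_replicate if_False not_False_eq_True)
      then have "leading_zeros \<gamma> < leading_zeros (?\<beta>[k' := \<not> False])"
        unfolding leading_zeros_\<gamma> by (simp only: leading_zeros_simps)
      then have "?\<beta>[k' := \<not> False] < \<gamma>"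
        using len length_\<gamma> by (intro less_if_leading_zeros_less) simp_all
      with necklace[OF k'(2)] show False by simp
    qed
    with j have "j < a + 1 + B" by linarith
    then show "?\<beta> ! j = False" unfolding first_one_eq by (simp only: nth_append length_replicate nth_replicate if_True)
  qed (fact asym len)+
  then show "z = z0" by (simp add: \<beta> z0_def)
qed

text \<open>The leading-run argument for FirstOne applies again. As the parent is the rotated
  string, the flipped bit is at position C of its leading run: after the zeros that preceded the
  last 1, before the a initial zeros of \<gamma>.\<close>

lemma last_one_link:
  assumes "last_one \<gamma> \<in> asym_bracelets n"
  defines "z0 \<equiv> replicate a False @ Y @ replicate C False"
  shows "\<not> periodic (last_one \<gamma>)" "True # z0 \<in> rotations \<gamma>" "False # z0 \<in> rotations (last_one \<gamma>)"
    "b # z \<in> rotations \<gamma> \<Longrightarrow> (\<not> b) # z \<in> rotations (last_one \<gamma>) \<Longrightarrow> z = z0"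
proof -
  let ?\<beta> = "last_one \<gamma>"
  show "\<not> periodic ?\<beta>"
    unfolding last_one_eq
    by (rule strict_rotations_not_periodic[OF leading_run_less_rotate[OF Y_props]]) auto
  have rep: "replicate (a + 1 + C) False = replicate C False @ False # replicate a False"
    by (metis add.commute add.assoc replicate_add replicate_Suc append_Cons append_Nil plus_1_eq_Suc)
  have \<beta>: "?\<beta> = replicate C False @ False # replicate a False @ Y"
    unfolding last_one_eq rep by simp
  have \<gamma>: "\<gamma> = (replicate a False @ Y @ replicate C False) @ [True]" by (simp add: \<gamma>_eq)
  show "True # z0 \<in> rotations \<gamma>"
    using append_swap_in_rotations[of "[True]" "replicate a False @ Y @ replicate C False"]
    unfolding \<gamma> z0_def by simp
  show "False # z0 \<in> rotations ?\<beta>"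
    using append_swap_in_rotations[of "False # replicate a False @ Y" "replicate C False"]
    by (simp add: \<beta> z0_def)
  assume z: "b # z \<in> rotations \<gamma>" "(\<not> b) # z \<in> rotations ?\<beta>"
  have "weight \<gamma> = weight X + 2" "weight ?\<beta> = weight X + 1" by (simp add: \<gamma>_eq, simp add: \<beta>)
  then have b
    using weight_rotations[OF z(1)] weight_rotations[OF z(2)] by (cases b) simp_all
  have asym: "\<not> symmetric ?\<beta>" using assms by (simp add: asym_bracelets_def)
  have len: "length ?\<beta> = n" using assms by (simp add: asym_bracelets_def)
  have "z = drop (Suc C) ?\<beta> @ take C ?\<beta>"
  proof (rule flip_word_unique[where v = False and \<gamma> = \<gamma> and n = n])
    show "C < n" using n_eq by simp
    show "?\<beta> ! C = False" by (simp add: \<beta> nth_append)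
    have "?\<beta>[C := \<not> False] = replicate C False @ True # replicate a False @ Y"
      by (simp add: \<beta> list_update_append)
    also have "\<dots> \<in> rotations \<gamma>"
      using append_swap_in_rotations[of "replicate C False @ [True]" "replicate a False @ Y"]
      unfolding \<gamma> by simp
    finally show "?\<beta>[C := \<not> False] \<in> rotations \<gamma>" .
    show "False # z \<in> rotations ?\<beta>" "(\<not> False) # z \<in> rotations \<gamma>" using z \<open>b\<close> by auto
    fix k' j assume k': "k' < n" "?\<beta>[k' := \<not> False] \<in> rotations \<gamma>"
      and j: "min C k' \<le> j" "j \<le> max C k'"
    have "k' < a + 1 + C"
    proof (rule ccontr)
      assume "\<not> k' < a + 1 + C"
      then have "?\<beta>[k' := \<not> False] = replicate (a + 1 + C) False @ Y[k' - (a + 1 + C) := True]"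
        unfolding last_one_eq by (simp only: list_update_append length_replicate if_False not_False_eq_True)
      then have "leading_zeros \<gamma> < leading_zeros (?\<beta>[k' := \<not> False])"
        unfolding leading_zeros_\<gamma> by (simp only: leading_zeros_simps)
      then have "?\<beta>[k' := \<not> False] < \<gamma>"
        using len length_\<gamma> by (intro less_if_leading_zeros_less) simp_all
      with necklace[OF k'(2)] show False by simp
    qed
    with j have "j < a + 1 + C" by linarith
    then show "?\<beta> ! j = False" unfolding last_one_eq by (simp only: nth_append length_replicate nth_replicate if_True)
  qed (fact asym len)+
  then show "z = z0" by (simp add: \<beta> z0_def)
qed

end

subsection \<open>Flipping the last zero\<close>

lemma last_zero_eq: "last_zero (P @ False # replicate e True) = P @ True # replicate e True"
  by (simp add: last_zero_def flip_first_replicate)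

text \<open>A rotation starting at or before the raised letter is compared up to that letter:
  minimality gives a weak inequality for the original string, and the raise makes it strict, since
  the prefix compared with it ends before the raised letter. A rotation starting later begins with
  1, while the string begins with 0.\<close>

lemma last_zero_less_rotate:
  assumes neck: "\<And>\<rho>. \<rho> \<in> rotations (P @ False # replicate e True) \<Longrightarrow> P @ False # replicate e True \<le> \<rho>"
    and P: "True \<in> set P" and k: "0 < k" "k < length (P @ True # replicate e True)"
  shows "P @ True # replicate e True < rotate k (P @ True # replicate e True)"
proof -
  let ?\<gamma> = "P @ False # replicate e True" and ?\<beta> = "P @ True # replicate e True"
  have rot: "rotate k ?\<beta> = drop k ?\<beta> @ take k ?\<beta>" "rotate k ?\<gamma> = drop k ?\<gamma> @ take k ?\<gamma>"
    using k by (simp_all add: rotate_drop_take)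
  show ?thesis
  proof (cases "k \<le> length P")
    case True
    let ?m = "Suc (length P - k)"
    have "take ?m ?\<gamma> \<le> take ?m (rotate k ?\<gamma>)" by (rule take_mono_lex[OF neck]) simp
    moreover have "take ?m (rotate k ?\<gamma>) = drop k P @ [False]"
      and "take ?m (rotate k ?\<beta>) = drop k P @ [True]"
      using True unfolding rot by simp_all
    moreover have "take ?m ?\<beta> = take ?m ?\<gamma>" using True k by simp
    moreover have "drop k P @ [False] < drop k P @ [True]" by simp
    ultimately have "take ?m ?\<beta> < take ?m (rotate k ?\<beta>)" by (metis order_le_less_trans)
    then show ?thesis by (rule less_if_take_less)
  next
    case False
    obtain c P' where P': "P = c # P'" using P by (cases P) auto
    have "?\<gamma> \<le> (False # replicate e True) @ P" by (rule neck) (rule append_swap_in_rotations)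
    then have "\<not> c" by (cases c) (simp_all add: P')
    then have "leading_zeros ?\<beta> > 0" by (simp add: P')
    moreover have "drop k ?\<beta> = replicate (length P + 1 + e - k) True"
      using False k by (simp add: drop_Cons')
    then obtain r where "drop k ?\<beta> = True # r" using k by (cases "length P + 1 + e - k") auto
    then have "leading_zeros (rotate k ?\<beta>) = 0" by (simp add: rot)
    ultimately show ?thesis by (intro less_if_leading_zeros_less) simp_all
  qed
qed

lemma weight_eq_length_imp_replicate: "weight u = length u \<Longrightarrow> u = replicate (length u) True"
proof (induction u)
  case (Cons c u)
  have "weight u \<le> length u" by (simp add: weight_def)
  with Cons.prems have c "weight u = length u" by (cases c; simp)+
  with Cons.IH show ?case by simp
qed simp

text \<open>The raised string is least among its rotations, so it fails only through some rotation
  \<rho>' of its reversal that is not larger. Lowering the raised bit turns \<rho>' into a rotation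
  \<rho> of the reversal of the original string, which is larger than that string. The two
  comparisons have opposite directions although each pair differs in one bit; the position of that
  bit leaves only the palindromic case.\<close>

lemma last_zero_not_asym_imp:
  assumes A: "P @ False # replicate e True \<in> asym_bracelets n" and P: "True \<in> set P"
    and notA: "P @ True # replicate e True \<notin> asym_bracelets n"
  shows "\<exists>v f. 0 < f \<and> f < e \<and> P = v @ replicate f True \<and> rev v = v"
proof -
  let ?\<gamma> = "P @ False # replicate e True" and ?\<beta> = "P @ True # replicate e True"
  have len: "length ?\<gamma> = n" and neck: "\<And>\<rho>. \<rho> \<in> rotations ?\<gamma> \<Longrightarrow> ?\<gamma> \<le> \<rho>"
    and reverse: "\<And>\<rho>. \<rho> \<in> rotations (rev ?\<gamma>) \<Longrightarrow> ?\<gamma> < \<rho>"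
    using A by (auto simp: asym_bracelets_iff)
  have "?\<beta> \<le> \<rho>" if "\<rho> \<in> rotations ?\<beta>" for \<rho>
    by (rule strict_rotations_le[OF last_zero_less_rotate[OF neck P] that])
  with notA len obtain \<rho>' where \<rho>': "\<rho>' \<in> rotations (rev ?\<beta>)" "\<rho>' \<le> ?\<beta>"
    unfolding asym_bracelets_iff by (auto simp: not_less)
  obtain u v where uv: "rev ?\<beta> = u @ v" "\<rho>' = v @ u"
    using \<rho>'(1) by (auto simp: rotations_iff_split)
  obtain c P' where P': "P = c # P'" using P by (cases P) auto
  have "?\<gamma> \<le> (False # replicate e True) @ P" by (rule neck) (rule append_swap_in_rotations)
  then have c: "\<not> c" by (cases c) (simp_all add: P')
  have uv': "replicate (Suc e) True @ rev P = u @ v"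
    using uv(1) by (simp add: replicate_append_same flip: replicate_Suc)
  have ge: "Suc e \<le> length u"
  proof (rule ccontr)
    assume lt: "\<not> Suc e \<le> length u"
    have "v = drop (length u) (replicate (Suc e) True @ rev P)" using uv' by simp
    also have "\<dots> = True # replicate (e - length u) True @ rev P"
      using lt by (simp add: Suc_diff_le del: replicate_Suc) simp
    finally show False using \<rho>'(2) uv(2) c by (simp add: P')
  qed
  define u' where "u' = drop (Suc e) u"
  have u: "u = replicate (Suc e) True @ u'" and rP: "rev P = u' @ v"
    using arg_cong[OF uv', of "take (Suc e)"] arg_cong[OF uv', of "drop (Suc e)"] ge
    by (auto simp: u'_def simp del: replicate_Suc)
  have lenP: "length P = length u' + length v" using arg_cong[OF rP, of length] by simp
  let ?\<rho> = "v @ replicate e True @ False # u'"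
  have \<rho>_in: "?\<rho> \<in> rotations (rev ?\<gamma>)"
  proof -
    have "rev ?\<gamma> = (replicate e True @ False # u') @ v" using rP by simp
    then show ?thesis using append_swap_in_rotations by metis
  qed
  have \<rho>'_eq: "\<rho>' = v @ replicate e True @ True # u'"
    using uv(2) u by (simp add: replicate_append_same)
  have less: "?\<gamma> < ?\<rho>" by (rule reverse[OF \<rho>_in])
  \<comment> \<open>Otherwise the bit in which \<rho> and \<rho>' differ, at position |v| + e, lies
    within P, where the raised and the original string still agree. Then
    \<open>?\<gamma> < ?\<rho>\<close> would put the raised string strictly below \<rho>'.\<close>
  have "length u' \<le> e"
  proof (rule ccontr)
    assume "\<not> length u' \<le> e"
    then have lt: "length v + e < length P" using lenP by simp
    let ?m = "Suc (length v + e)"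
    have "take ?m ?\<beta> = take ?m ?\<gamma>" using lt by simp
    also have "\<dots> \<le> take ?m ?\<rho>" using less by (intro take_mono_lex) simp
    also have "take ?m ?\<rho> = (v @ replicate e True) @ [False]" by simp
    also have "\<dots> < (v @ replicate e True) @ [True]" by (simp only: append_less_append_iff) simp
    also have "\<dots> = take ?m \<rho>'" by (simp add: \<rho>'_eq)
    finally show False using less_if_take_less \<rho>'(2) by (meson leD)
  qed
  define f where "f = length u'"
  have tk: "take (length P) (v @ replicate e True @ b # u') = v @ replicate f True" for b
    using lenP \<open>length u' \<le> e\<close> by (simp add: f_def)
  have P_eq: "P = v @ replicate f True"
  proof (rule ccontr)
    assume ne: "P \<noteq> v @ replicate f True"
    have "take (length P) ?\<gamma> \<le> take (length P) ?\<rho>" using less by (intro take_mono_lex) simp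
    then have "P \<le> v @ replicate f True" by (simp only: tk) simp
    with ne have "take (length P) ?\<beta> < take (length P) \<rho>'" by (simp only: \<rho>'_eq tk) simp
    then show False using less_if_take_less \<rho>'(2) by (meson leD)
  qed
  have "weight ?\<rho> = weight ?\<gamma>"
    using weight_rotations[OF \<rho>_in] by (simp add: weight_def rev_filter[symmetric])
  then have "weight u' = length u'" by (simp add: P_eq f_def)
  then have u': "u' = replicate f True" unfolding f_def by (rule weight_eq_length_imp_replicate)
  have pal: "rev v = v"
  proof -
    have "rev P = replicate f True @ rev v" using P_eq by simp
    with rP u' show ?thesis by simp
  qed
  have "f \<noteq> e"
  proof
    assume "f = e"
    then have "?\<rho> = ?\<gamma>" using P_eq u' by simp
    with less show False by simp
  qed
  \<comment> \<open>For f = 0 the rotation \<rho> ends with 0, and moving this 0 to the front gives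
    a member of the reversed class with more leading zeros than \<open>?\<gamma>\<close>.\<close>
  have "f \<noteq> 0"
  proof
    assume "f = 0"
    then have "?\<rho> = (P @ replicate e True) @ [False]" using P_eq u' by simp
    then have "[False] @ P @ replicate e True \<in> rotations ?\<rho>" by (metis append_swap_in_rotations)
    then have "?\<gamma> < [False] @ P @ replicate e True"
      using reverse rotations_trans[OF _ \<rho>_in] by blast
    moreover have "[False] @ P @ replicate e True < ?\<gamma>"
      using P by (intro less_if_leading_zeros_less) (simp_all add: leading_zeros_append)
    ultimately show False by simp
  qed
  with \<open>f \<noteq> e\<close> \<open>length u' \<le> e\<close> have "0 < f" "f < e" by (auto simp: f_def)
  with P_eq pal show ?thesis by blast
qed

text \<open>Here the candidate flips lie in the final ones of the parent: turning a 1 of P into 0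
  would give a rotation of \<gamma> that is below \<gamma> at that very bit. The parent has one 1
  more than \<gamma>, so b is 0.\<close>

lemma last_zero_link:
  assumes A: "\<gamma> \<in> asym_bracelets n" and \<gamma>: "\<gamma> = P @ False # replicate e True" and P: "True \<in> set P"
    and \<beta>A: "last_zero \<gamma> \<in> asym_bracelets n"
  shows "\<not> periodic (last_zero \<gamma>)" "False # replicate e True @ P \<in> rotations \<gamma>"
    "True # replicate e True @ P \<in> rotations (last_zero \<gamma>)"
    "b # z \<in> rotations \<gamma> \<Longrightarrow> (\<not> b) # z \<in> rotations (last_zero \<gamma>) \<Longrightarrow> z = replicate e True @ P"
proof -
  let ?\<beta> = "last_zero \<gamma>"
  have \<beta>: "?\<beta> = P @ True # replicate e True" by (simp add: \<gamma> last_zero_eq)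
  have len: "length \<gamma> = n" "length ?\<beta> = n" and neck: "\<And>\<rho>. \<rho> \<in> rotations \<gamma> \<Longrightarrow> \<gamma> \<le> \<rho>"
    using A \<beta>A by (auto simp: asym_bracelets_iff)
  show "\<not> periodic ?\<beta>"
    unfolding \<beta> by (rule strict_rotations_not_periodic[OF last_zero_less_rotate[OF neck[unfolded \<gamma>] P]]) auto
  show "False # replicate e True @ P \<in> rotations \<gamma>"
    using append_swap_in_rotations[of "False # replicate e True" P] by (simp add: \<gamma>)
  show "True # replicate e True @ P \<in> rotations ?\<beta>"
    using append_swap_in_rotations[of "True # replicate e True" P] by (simp add: \<beta>)
  assume z: "b # z \<in> rotations \<gamma>" "(\<not> b) # z \<in> rotations ?\<beta>"
  have "weight \<gamma> = weight P + e" "weight ?\<beta> = weight P + e + 1" by (simp add: \<gamma>, simp add: \<beta>)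
  then have b: "\<not> b"
    using weight_rotations[OF z(1)] weight_rotations[OF z(2)] by (cases b) simp_all
  have "z = drop (Suc (length P)) ?\<beta> @ take (length P) ?\<beta>"
  proof (rule flip_word_unique[where v = True and \<gamma> = \<gamma> and n = n])
    show "length P < n" using len by (simp add: \<gamma>)
    show "?\<beta> ! length P = True" by (simp add: \<beta> nth_append)
    have "?\<beta>[length P := \<not> True] = \<gamma>" unfolding \<beta> using \<gamma> by (simp add: list_update_append)
    then show "?\<beta>[length P := \<not> True] \<in> rotations \<gamma>" by simp
    show "True # z \<in> rotations ?\<beta>" "(\<not> True) # z \<in> rotations \<gamma>" using z b by auto
    show "\<not> symmetric ?\<beta>" using \<beta>A by (simp add: asym_bracelets_def)
    fix k' j assume k': "k' < n" "?\<beta> ! k' = True" "?\<beta>[k' := \<not> True] \<in> rotations \<gamma>"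
      and j: "min (length P) k' \<le> j" "j \<le> max (length P) k'"
    have "length P \<le> k'"
    proof (rule ccontr)
      assume "\<not> length P \<le> k'"
      then have lt: "k' < length P" by simp
      then have Pk: "P ! k'" using k'(2) by (simp add: \<beta> nth_append)
      have "take (Suc k') (?\<beta>[k' := \<not> True]) = take k' P @ [False]"
        using lt by (simp add: \<beta> list_update_append take_Suc_conv_app_nth take_update_cancel)
      moreover have "take (Suc k') \<gamma> = take k' P @ [True]"
        using lt Pk by (simp add: \<gamma> take_Suc_conv_app_nth)
      ultimately have "take (Suc k') (?\<beta>[k' := \<not> True]) < take (Suc k') \<gamma>" by simp
      then have "?\<beta>[k' := \<not> True] < \<gamma>" by (rule less_if_take_less)
      with neck[OF k'(3)] show False by simp
    qed
    moreover have "n = length P + Suc e" using len by (simp add: \<gamma>)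
    ultimately show "?\<beta> ! j = True"
      using j k'(1) by (auto simp: \<beta> nth_append nth_Cons' )
  qed (fact len)
  then show "z = replicate e True @ P" by (simp add: \<beta>)
qed

section \<open>LastZero when FirstOne and LastOne both fail\<close>

lemma append_True_le: "X @ [True] \<le> True # X"
  by (induction X) auto

context bracelet_form
begin

text \<open>For B = 0 the comparison of \<gamma> with its reversed class forces C = 0 and X smaller
  than its reversal. Then W = X1 \<le> 1X, and 1X is below 1 \<open>rev X\<close> =
  \<open>rev W\<close>, so FirstOne would succeed.\<close>

lemma B_pos:
  assumes F: "rev W \<le> W"
  shows "B > 0"
proof (rule ccontr)
  assume "\<not> B > 0"
  then have B: "B = 0" by simp
  have "rev \<gamma> = (True # replicate C False @ rev X @ [True]) @ replicate a False"
    by (simp add: \<gamma>_eq B)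
  then have "replicate a False @ True # replicate C False @ rev X @ [True] \<in> rotations (rev \<gamma>)"
    using append_swap_in_rotations by metis
  then have "\<gamma> < replicate a False @ True # replicate C False @ rev X @ [True]"
    by (rule reverse_greater)
  then have less: "W < replicate C False @ rev X @ [True]" by (simp add: \<gamma>_eq B)
  obtain X' where X': "X = True # X'" using X_ne X_hd by (cases X) auto
  have C: "C = 0" using less by (cases C) (auto simp: X')
  then have "X < rev X" using less append_less_append_eq_length[of X "rev X" "[True]" "[True]"] by simp
  then have "True # X < rev W" by (simp add: C)
  moreover have "W \<le> True # X" using append_True_le[of X] by (simp add: C)
  ultimately show False using F by (meson leD order_trans)
qed

text \<open>Failure of LastZero gives \<gamma> = v 1^f 0 1^e with v a palindrome, and failure of
  LastOne cuts the tail down to 1011. If v contains a 1, failure of LastOne also forces B = 1,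
  failure of FirstOne bounds W from below by a word starting with 1101, and a rotation of \<gamma>
  read off the palindrome bounds W from above by a smaller word.\<close>

lemma last_zero_in:
  assumes F: "rev W \<le> W" and L: "rev Y \<le> Y" and nr: "\<gamma> \<noteq> root_label n"
  shows "last_zero \<gamma> \<in> asym_bracelets n"
proof (rule ccontr)
  assume notA: "last_zero \<gamma> \<notin> asym_bracelets n"
  obtain B' where B': "B = Suc B'" using B_pos[OF F] by (cases B) auto
  have "\<not> symmetric \<gamma>" using in_A by (simp add: asym_bracelets_def)
  then obtain P e where P: "\<gamma> = P @ False # replicate e True" "True \<in> set P"
    by (rule asymmetric_split)
  obtain v f where f: "0 < f" "f < e" and v: "P = v @ replicate f True" and pal: "rev v = v"
    using last_zero_not_asym_imp[of P e n] P in_A notA by (auto simp: last_zero_eq)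
  have rev1: "rev \<gamma> = True # replicate C False @ rev X @ replicate B False @ True # replicate a False"
    by (simp add: \<gamma>_eq)
  have rev2: "rev \<gamma> = replicate e True @ False # replicate f True @ v"
    by (simp add: P v pal)
  obtain e' where e': "e = Suc (Suc e')" using f by (cases e; cases "e - 1") auto
  have C: "C = 0" using rev1 rev2 by (cases C) (auto simp: e')
  obtain rX where rX: "rev X = True # rX" using X_ne X_last by (cases "rev X") (auto simp: hd_rev[symmetric])
  \<comment> \<open>Y begins with 10, so \<open>rev Y\<close> does not begin with 11. Hence X ends
    in a single 1, and with C = 0 the string ends in exactly two ones.\<close>
  have "rX @ replicate B False @ [True] \<le> False # replicate B' False @ X" using L by (simp add: rX B' replicate_app_Cons_same)
  then have "e = 2"
    using rev1 rev2 by (cases rX; cases e') (auto simp: e' C rX B')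
  with f have "f = 1" by simp
  have \<gamma>v: "\<gamma> = v @ [True, False, True, True]" by (simp add: P v \<open>e = 2\<close> \<open>f = 1\<close> numeral_2_eq_2)
  have "True \<in> set v"
  proof (rule ccontr)
    assume "True \<notin> set v"
    then obtain m where "v = replicate m False" using all_eq_replicate[of False v] by auto
    then have "\<gamma> = root_label n" using length_\<gamma> by (auto simp: \<gamma>v root_label_def)
    with nr show False by simp
  qed
  then obtain a' v' where v': "v = replicate a' False @ True # v'" by (rule split_first_one)
  have "a' = a" using leading_zeros_\<gamma> by (simp add: \<gamma>v v')
  note v' = v'[unfolded this]
  have tail: "v' @ [True, False, True, True] = replicate B False @ X @ [True]"
    using \<gamma>v by (simp add: \<gamma>_eq v' C)
  obtain v'' where v'': "v' = replicate B False @ v''" "v'' @ [True, False, True, True] = X @ [True]"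
  proof -
    from tail obtain us where "v' = replicate B False @ us \<and> us @ [True, False, True, True] = X @ [True] \<or>
        v' @ us = replicate B False \<and> [True, False, True, True] = us @ X @ [True]"
      by (auto simp: append_eq_append_conv2)
    then show ?thesis
    proof (elim disjE conjE)
      assume us: "v' @ us = replicate B False" "[True, False, True, True] = us @ X @ [True]"
      have "us = []"
      proof (cases us)
        case (Cons c us')
        then have "c \<in> set (replicate B False)" by (simp flip: us(1))
        with us(2) Cons show ?thesis by simp
      qed simp
      with us that[of "[]"] show ?thesis by simp
    qed (use that in blast)
  qed
  have X_eq: "X = v'' @ [True, False, True]" using v''(2) by (cases X rule: rev_cases) auto
  \<comment> \<open>\<open>rev Y\<close> begins with 101, whereas for B at least 2 the word Y would
    begin with 100.\<close>
  have "B = 1" using L by (cases B') (auto simp: X_eq B')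
  have F': "True # True # False # True # rev v'' \<le> W" using F by (simp add: X_eq C)
  have W: "W = v'' @ [True, False, True, True]" by (simp add: X_eq C)
  have \<gamma>W: "\<gamma> = replicate a False @ True # False # W" by (simp add: \<gamma>_eq \<open>B = 1\<close>)
  obtain a'' where a'': "a = Suc a''" using a_pos by (cases a) auto
  show False
  proof (cases a'')
    case 0
    \<comment> \<open>For a = 1 the palindrome also ends in 010. The rotation of \<gamma> that
      starts at this end begins with 0101011 and bounds W by a word starting with 1011.\<close>
    have "v = [False, True, False] @ v''" using v' v''(1) by (simp add: a'' 0 \<open>B = 1\<close>)
    then have "v = rev v'' @ [False, True, False]" using pal by (metis rev_append rev.simps append.assoc append_Cons append_Nil)
    then have \<gamma>: "\<gamma> = rev v'' @ [False, True, False, True, False, True, True]" using \<gamma>v by simp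
    have "\<gamma> \<le> [False, True, False, True, False, True, True] @ rev v''"
      by (rule necklace) (subst \<gamma>, rule append_swap_in_rotations)
    then have "W \<le> True # False # True # True # rev v''" using \<gamma>W by (simp add: a'' 0)
    with F' have "True # True # False # True # rev v'' \<le> True # False # True # True # rev v''"
      by (rule order_trans)
    then show False by simp
  next
    case (Suc a3)
    \<comment> \<open>The palindrome v is R followed by its final a zeros, and R itself begins with
      two zeros since a is at least 2. The rotation 0^a 1011 R of \<gamma> bounds W by a word
      starting with 1100.\<close>
    define R where "R = rev v' @ [True]"
    have R: "R @ replicate a False = replicate a False @ True # v'"
      using pal by (simp add: v' R_def)
    have "\<gamma> = R @ replicate a False @ [True, False, True, True]"
      using \<gamma>v v' R by (metis append.assoc)
    then have "(replicate a False @ [True, False, True, True]) @ R \<in> rotations \<gamma>"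
      using append_swap_in_rotations by metis
    then have "\<gamma> \<le> (replicate a False @ [True, False, True, True]) @ R" by (rule necklace)
    then have WR: "W \<le> True # True # R" using \<gamma>W by simp
    have "last R" by (simp add: R_def)
    moreover have "R \<noteq> []" by (simp add: R_def)
    ultimately obtain R2 where "R = False # False # R2"
      using R by (cases R; cases "tl R") (auto simp: a'' Suc)
    with WR F' have "True # True # False # True # rev v'' \<le> True # True # False # False # R2"
      by (metis order_trans)
    then show False by simp
  qed
qed

end

text \<open>
  The string $z$ such that $0z$ and $1z$ are rotations of the bracelet and of its parent, in one
  order or the other.
\<close>

definition swap_word :: "nat \<Rightarrow> bitstring \<Rightarrow> bitstring" where
  "swap_word n \<gamma> =
    (if first_one \<gamma> \<in> asym_bracelets n
     then drop (Suc (leading_zeros \<gamma>)) \<gamma> @ replicate (leading_zeros \<gamma>) False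
     else if last_one \<gamma> \<in> asym_bracelets n then butlast \<gamma>
     else replicate (length (takeWhile id (rev \<gamma>))) True @
       take (n - Suc (length (takeWhile id (rev \<gamma>)))) \<gamma>)"

lemma swap_word_first_one:
  assumes "\<gamma> = replicate a False @ True # y" "first_one \<gamma> \<in> asym_bracelets n"
  shows "swap_word n \<gamma> = y @ replicate a False"
  using assms(2) unfolding swap_word_def by (simp add: assms(1))

lemma swap_word_last_zero:
  assumes "\<gamma> = P @ False # replicate e True" "length \<gamma> = n"
    "first_one \<gamma> \<notin> asym_bracelets n" "last_one \<gamma> \<notin> asym_bracelets n"
  shows "swap_word n \<gamma> = replicate e True @ P"
proof -
  have "takeWhile id (rev \<gamma>) = replicate e True"
    unfolding assms(1) by (simp add: takeWhile_append)
  moreover have "take (n - Suc e) \<gamma> = P" using assms(1,2) by auto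
  ultimately show ?thesis using assms(3,4) by (simp add: swap_word_def)
qed

text \<open>What the tree needs of \<open>par\<close>, whichever rule applies: iteration stays
  inside A(n), a parent has pairwise distinct rotations, and the edge between the two classes has
  exactly one word. Membership in the LastZero case rests on \<open>last_zero_in\<close>.\<close>

lemma par_link:
  assumes A: "\<gamma> \<in> asym_bracelets n" and nr: "\<gamma> \<noteq> root_label n"
  shows "par n \<gamma> \<in> asym_bracelets n" (is ?in)
    and "\<not> periodic (par n \<gamma>)" (is ?np)
    and "\<exists>b. b # swap_word n \<gamma> \<in> rotations \<gamma> \<and> (\<not> b) # swap_word n \<gamma> \<in> rotations (par n \<gamma>)" (is ?ex)
    and "b # z \<in> rotations \<gamma> \<Longrightarrow> (\<not> b) # z \<in> rotations (par n \<gamma>) \<Longrightarrow> z = swap_word n \<gamma>"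
proof -
  obtain a B X C where "bracelet_form n \<gamma> X a B C"
    using asym_bracelet_form[OF A] A by (metis bracelet_form.intro)
  then interpret bracelet_form n \<gamma> X a B C .
  have "?in \<and> ?np \<and> ?ex \<and> (\<forall>b z. b # z \<in> rotations \<gamma> \<longrightarrow> (\<not> b) # z \<in> rotations (par n \<gamma>) \<longrightarrow> z = swap_word n \<gamma>)"
  proof (cases "first_one \<gamma> \<in> asym_bracelets n")
    case True
    have "swap_word n \<gamma> = replicate B False @ W @ replicate a False"
      using swap_word_first_one[OF \<gamma>_eq True] by simp
    moreover have "par n \<gamma> = first_one \<gamma>" using True by (simp add: par_def)
    ultimately show ?thesis using True first_one_link[OF True] by metis
  next
    case F: False
    show ?thesis
    proof (cases "last_one \<gamma> \<in> asym_bracelets n")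
      case True
      have "swap_word n \<gamma> = replicate a False @ Y @ replicate C False"
        using F True by (simp add: swap_word_def \<gamma>_eq butlast_append)
      moreover have "par n \<gamma> = last_one \<gamma>" using F True by (simp add: par_def)
      ultimately show ?thesis using True last_one_link[OF True] by metis
    next
      case False
      have in_A': "last_zero \<gamma> \<in> asym_bracelets n"
        using F False first_one_in_iff last_one_in_iff by (intro last_zero_in nr) (auto simp: not_less)
      have "\<not> symmetric \<gamma>" using in_A by (simp add: asym_bracelets_def)
      then obtain P e where P: "\<gamma> = P @ False # replicate e True" "True \<in> set P"
        by (rule asymmetric_split)
      have "swap_word n \<gamma> = replicate e True @ P"
        by (rule swap_word_last_zero[OF P(1) length_\<gamma> F False])
      moreover have "par n \<gamma> = last_zero \<gamma>" using F False by (simp add: par_def)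
      ultimately show ?thesis using in_A' last_zero_link[OF in_A P in_A'] by metis
    qed
  qed
  then show ?in ?np ?ex "b # z \<in> rotations \<gamma> \<Longrightarrow> (\<not> b) # z \<in> rotations (par n \<gamma>) \<Longrightarrow> z = swap_word n \<gamma>"
    by blast+
qed

subsection \<open>Concatenating the sequences of the children\<close>

definition edge_word :: "bitstring \<Rightarrow> nat \<Rightarrow> bitstring" where
  "edge_word \<alpha> k = drop k \<alpha> @ take (k - 1) \<alpha>"

text \<open>The windows of length n + 1 that a join at z destroys; \<open>swapped_ends\<close> holds
  those it creates. Both have the prefixes 0z and 1z, so a join only exchanges successors.\<close>

definition same_ends :: "bitstring \<Rightarrow> bitstring multiset" where
  "same_ends z = {#False # z @ [False], True # z @ [True]#}"

definition swapped_ends :: "bitstring \<Rightarrow> bitstring multiset" where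
  "swapped_ends z = {#False # z @ [True], True # z @ [False]#}"

lemma cyclic_factors_join_at:
  assumes "U \<noteq> []" "V \<noteq> []" "length \<alpha> = n" "1 \<le> k" "k \<le> n"
    and "prefix (take (k - 1) \<alpha> @ [p]) (U @ take (k - 1) \<alpha> @ [p])"
    and "prefix (take (k - 1) \<alpha> @ [\<not> p]) (V @ take (k - 1) \<alpha> @ [\<not> p])"
    and "suffix (p # drop k \<alpha>) ((p # drop k \<alpha>) @ U)"
    and "suffix ((\<not> p) # drop k \<alpha>) (((\<not> p) # drop k \<alpha>) @ V)"
  shows "cyclic_factors (Suc n) (U @ V) + same_ends (edge_word \<alpha> k) =
    cyclic_factors (Suc n) U + cyclic_factors (Suc n) V + swapped_ends (edge_word \<alpha> k)"
proof -
  have "length (drop k \<alpha>) + length (take (k - 1) \<alpha>) + 1 = n" using assms(3-5) by simp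
  from cyclic_factors_join[OF assms(1,2) this assms(6,7)] assms(8,9) show ?thesis
    by (cases p) (simp_all add: same_ends_def swapped_ends_def edge_word_def ac_simps add_mset_commute)
qed

lemma prefix_self_prefix: "prefix s t \<Longrightarrow> prefix t (U @ t) \<Longrightarrow> prefix s (U @ s)"
  unfolding prefix_def[of s t] using prefix_self_butlast by blast

lemma suffix_self_suffix: "suffix s t \<Longrightarrow> suffix t (t @ U) \<Longrightarrow> suffix s (s @ U)"
  unfolding suffix_def[of s t] using suffix_self_drop by blast

lemma complement_at_split:
  assumes "1 \<le> k" "k \<le> length \<alpha>"
  shows "complement_at \<alpha> k = take (k - 1) \<alpha> @ (\<not> \<alpha> ! (k - 1)) # drop k \<alpha>"
    and "\<alpha> = take (k - 1) \<alpha> @ \<alpha> ! (k - 1) # drop k \<alpha>"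
  using assms upd_conv_take_nth_drop[of "k - 1" \<alpha> "\<not> \<alpha> ! (k - 1)"] id_take_nth_drop[of "k - 1" \<alpha>]
  by (simp_all add: complement_at_def)

lemma length_complement_at [simp]: "length (complement_at \<alpha> k) = length \<alpha>"
  by (simp add: complement_at_def)

lemma add_rearrange:
  fixes a :: "'a multiset"
  assumes "a + e = u + v + s" "v + S = w + T"
  shows "a + (e + S) = w + (u + s + T)"
proof -
  have "a + (e + S) = (a + e) + S" by (simp only: add.assoc)
  also have "\<dots> = (u + v + s) + S" by (simp only: assms(1))
  also have "\<dots> = u + s + (v + S)" by (simp add: ac_simps)
  also have "\<dots> = u + s + (w + T)" by (simp only: assms(2))
  also have "\<dots> = w + (u + s + T)" by (simp add: ac_simps)
  finally show ?thesis .
qed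

lemma add_rearrange2:
  fixes a :: "'a multiset"
  assumes "a + S = v + T" "v + S' = w + T'"
  shows "a + (S' + S) = w + (T' + T)"
proof -
  have "a + (S' + S) = (a + S) + S'" by (simp add: ac_simps)
  also have "\<dots> = (v + T) + S'" by (simp only: assms(1))
  also have "\<dots> = (v + S') + T" by (simp add: ac_simps)
  also have "\<dots> = (w + T') + T" by (simp only: assms(2))
  finally show ?thesis by (simp only: add.assoc)
qed

text \<open>What the recursion provides for the sequence of each child: its cyclic cut is followed
  by the first k bits of the child label and preceded by the bits from k on. As this label differs
  from \<alpha> only in bit k, these are the contexts that a join with \<alpha> at bit k
  requires.\<close>

locale child_sequences =
  fixes n :: nat and \<alpha> :: bitstring and U :: "nat \<Rightarrow> bitstring" and K :: "nat set"
  assumes length_\<alpha>: "length \<alpha> = n"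
    and K: "k \<in> K \<Longrightarrow> 1 \<le> k \<and> k \<le> n"
    and U_ne: "k \<in> K \<Longrightarrow> U k \<noteq> []"
    and U_prefix: "k \<in> K \<Longrightarrow> prefix (take k (complement_at \<alpha> k)) (U k @ take k (complement_at \<alpha> k))"
    and U_suffix: "k \<in> K \<Longrightarrow>
      suffix (drop (k - 1) (complement_at \<alpha> k)) (drop (k - 1) (complement_at \<alpha> k) @ U k)"
begin

lemma child_ends:
  assumes "k \<in> K"
  shows "take k (complement_at \<alpha> k) = take (k - 1) \<alpha> @ [\<not> \<alpha> ! (k - 1)]"
    "drop (k - 1) (complement_at \<alpha> k) = (\<not> \<alpha> ! (k - 1)) # drop k \<alpha>"
    "take k \<alpha> = take (k - 1) \<alpha> @ [\<alpha> ! (k - 1)]"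
    "drop (k - 1) \<alpha> = \<alpha> ! (k - 1) # drop k \<alpha>"
proof -
  have k: "1 \<le> k" "k \<le> length \<alpha>" using K[OF assms] length_\<alpha> by auto
  have len: "length (take (k - 1) \<alpha>) = k - 1" using k by simp
  show "take k (complement_at \<alpha> k) = take (k - 1) \<alpha> @ [\<not> \<alpha> ! (k - 1)]"
    "drop (k - 1) (complement_at \<alpha> k) = (\<not> \<alpha> ! (k - 1)) # drop k \<alpha>"
    unfolding complement_at_split(1)[OF k] using k by simp_all
  show "take k \<alpha> = take (k - 1) \<alpha> @ [\<alpha> ! (k - 1)]" using k take_Suc_conv_app_nth[of "k - 1" \<alpha>] by simp
  show "drop (k - 1) \<alpha> = \<alpha> ! (k - 1) # drop k \<alpha>" using k Cons_nth_drop_Suc[of "k - 1" \<alpha>] by simp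
qed

text \<open>Children are attached from the last to the first, each in front of what has been built.
  That sequence still opens with the first k bits of \<alpha>, because the children already present
  have larger indices and agree with \<alpha> so far; and its end is always \<alpha>. This is why
  right-children stand before the node in increasing order.\<close>

lemma right_children_join:
  assumes "sorted_wrt (<) ks" "set ks \<subseteq> K" "n > 0"
  defines "V \<equiv> concat (map U ks) @ \<alpha>"
  shows "(\<forall>m \<le> n. (\<forall>k \<in> set ks. m < k) \<longrightarrow> prefix (take m \<alpha>) (V @ take m \<alpha>)) \<and>
    cyclic_factors (Suc n) V + (\<Sum>k\<leftarrow>ks. same_ends (edge_word \<alpha> k)) =
    cyclic_factors (Suc n) \<alpha> + (\<Sum>k\<leftarrow>ks. cyclic_factors (Suc n) (U k) + swapped_ends (edge_word \<alpha> k))"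
  using assms(1,2) unfolding V_def
proof (induction ks)
  case Nil
  have "prefix (take m \<alpha>) (\<alpha> @ take m \<alpha>)" for m
    by (metis take_is_prefix prefix_prefix)
  then show ?case by simp
next
  case (Cons k ks)
  let ?V = "concat (map U ks) @ \<alpha>"
  have kK: "k \<in> K" and gt: "\<And>k'. k' \<in> set ks \<Longrightarrow> k < k'" using Cons.prems by auto
  note ends = child_ends[OF kK]
  have IH1: "prefix (take m \<alpha>) (?V @ take m \<alpha>)" if "m \<le> n" "\<forall>k\<in>set ks. m < k" for m
    using Cons that by simp
  have IH2: "cyclic_factors (Suc n) ?V + (\<Sum>k\<leftarrow>ks. same_ends (edge_word \<alpha> k)) =
    cyclic_factors (Suc n) \<alpha> + (\<Sum>k\<leftarrow>ks. cyclic_factors (Suc n) (U k) + swapped_ends (edge_word \<alpha> k))"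
    using Cons by simp
  have Vne: "?V \<noteq> []" using length_\<alpha> assms(3) by auto
  have "suffix (drop (k - 1) \<alpha>) (drop (k - 1) \<alpha> @ ?V)"
    by (meson suffix_drop suffix_appendI)
  then have join: "cyclic_factors (Suc n) (U k @ ?V) + same_ends (edge_word \<alpha> k) =
      cyclic_factors (Suc n) (U k) + cyclic_factors (Suc n) ?V + swapped_ends (edge_word \<alpha> k)"
    using U_prefix[OF kK] U_suffix[OF kK] K[OF kK] IH1[of k] gt unfolding ends
    by (intro cyclic_factors_join_at[OF U_ne[OF kK] Vne length_\<alpha>, of k "\<not> \<alpha> ! (k - 1)"]) auto
  have "prefix (take m \<alpha>) ((U k @ ?V) @ take m \<alpha>)" if m: "m \<le> n" "\<forall>k\<in>set (k # ks). m < k" for m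
  proof (rule prefix_self_append)
    have "prefix (take m \<alpha>) (take k (complement_at \<alpha> k))"
    proof -
      have "m \<le> k - 1" using m by auto
      then have "prefix (take m \<alpha>) (take (k - 1) \<alpha>)" by (metis min.absorb1 take_is_prefix take_take)
      then show ?thesis unfolding ends by (rule prefix_prefix)
    qed
    then show "prefix (take m \<alpha>) (U k @ take m \<alpha>)" using U_prefix[OF kK] by (rule prefix_self_prefix)
    show "prefix (take m \<alpha>) (?V @ take m \<alpha>)" using m by (intro IH1) auto
  qed
  moreover have "cyclic_factors (Suc n) (U k @ ?V) + (\<Sum>k\<leftarrow>k # ks. same_ends (edge_word \<alpha> k)) =
    cyclic_factors (Suc n) \<alpha> + (\<Sum>k\<leftarrow>k # ks. cyclic_factors (Suc n) (U k) + swapped_ends (edge_word \<alpha> k))"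
    using add_rearrange[OF join IH2] by simp
  ultimately show ?case by simp
qed

text \<open>Mirror image of the right-children: the sequence opens with the first c bits of
  \<alpha>, enough since l < c, and after child l its end agrees with \<alpha> from position l + 1
  on, as a later child of larger index needs. In terms of \<open>drop m\<close> this is the bound l
  \<le> m.\<close>

lemma left_children_join:
  assumes "sorted_wrt (<) ls" "set ls \<subseteq> K" "\<forall>l \<in> set ls. l < c" "c \<le> n"
    and V: "V \<noteq> []" "prefix (take c \<alpha>) V" "suffix \<alpha> V"
  shows "(\<forall>m \<le> n. (\<forall>l \<in> set ls. l \<le> m) \<longrightarrow>
      suffix (drop m \<alpha>) (drop m \<alpha> @ V @ concat (map U ls))) \<and>
    cyclic_factors (Suc n) (V @ concat (map U ls)) + (\<Sum>l\<leftarrow>ls. same_ends (edge_word \<alpha> l)) =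
    cyclic_factors (Suc n) V + (\<Sum>l\<leftarrow>ls. cyclic_factors (Suc n) (U l) + swapped_ends (edge_word \<alpha> l))"
  using assms(1-3)
proof (induction ls rule: rev_induct)
  case Nil
  have "suffix (drop m \<alpha>) (drop m \<alpha> @ V)" for m
    using V(3) by (meson suffix_drop suffix_appendI suffix_order.trans)
  then show ?case by simp
next
  case (snoc l ls)
  let ?V = "V @ concat (map U ls)"
  have lK: "l \<in> K" and gt: "\<And>l'. l' \<in> set ls \<Longrightarrow> l' < l" and lc: "l < c"
    using snoc.prems by (auto simp: sorted_wrt_append)
  note ends = child_ends[OF lK]
  have IH1: "suffix (drop m \<alpha>) (drop m \<alpha> @ ?V)" if "m \<le> n" "\<forall>l\<in>set ls. l \<le> m" for m
    using snoc that by (simp add: sorted_wrt_append)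
  have IH2: "cyclic_factors (Suc n) ?V + (\<Sum>l\<leftarrow>ls. same_ends (edge_word \<alpha> l)) =
    cyclic_factors (Suc n) V + (\<Sum>l\<leftarrow>ls. cyclic_factors (Suc n) (U l) + swapped_ends (edge_word \<alpha> l))"
    using snoc by (simp add: sorted_wrt_append)
  have Vne: "?V \<noteq> []" using V by auto
  have "prefix (take l \<alpha>) (?V @ take l \<alpha>)"
  proof -
    have "prefix (take l \<alpha>) (take c \<alpha>)"
      using lc by (metis less_imp_le min.absorb1 take_is_prefix take_take)
    with V(2) have "prefix (take l \<alpha>) V" by (rule prefix_order.trans[rotated])
    then show ?thesis by (simp add: prefix_prefix)
  qed
  moreover have "suffix (drop (l - 1) \<alpha>) (drop (l - 1) \<alpha> @ ?V)"
    using K[OF lK] gt by (intro IH1) (fastforce)+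
  ultimately have join: "cyclic_factors (Suc n) (?V @ U l) + same_ends (edge_word \<alpha> l) =
      cyclic_factors (Suc n) ?V + cyclic_factors (Suc n) (U l) + swapped_ends (edge_word \<alpha> l)"
    using U_prefix[OF lK] U_suffix[OF lK] K[OF lK] unfolding ends
    by (intro cyclic_factors_join_at[OF Vne U_ne[OF lK] length_\<alpha>, of l "\<alpha> ! (l - 1)"]) auto
  have "suffix (drop m \<alpha>) (drop m \<alpha> @ ?V @ U l)" if m: "m \<le> n" "\<forall>l\<in>set (ls @ [l]). l \<le> m" for m
  proof (rule suffix_self_append)
    have "drop m \<alpha> = drop (m - l) (drop l \<alpha>)" using m by simp
    then have "suffix (drop m \<alpha>) (drop (l - 1) (complement_at \<alpha> l))"
      unfolding ends by (metis suffix_ConsI suffix_drop)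
    then show "suffix (drop m \<alpha>) (drop m \<alpha> @ U l)" using U_suffix[OF lK] by (rule suffix_self_suffix)
    show "suffix (drop m \<alpha>) (drop m \<alpha> @ ?V)" using m by (intro IH1) auto
  qed
  moreover have "cyclic_factors (Suc n) (?V @ U l) + (\<Sum>l\<leftarrow>ls @ [l]. same_ends (edge_word \<alpha> l)) =
    cyclic_factors (Suc n) V + (\<Sum>l\<leftarrow>ls @ [l]. cyclic_factors (Suc n) (U l) + swapped_ends (edge_word \<alpha> l))"
    using add_rearrange[OF join[unfolded add.commute[of "cyclic_factors (Suc n) ?V"]] IH2]
    by (simp add: ac_simps)
  ultimately show ?case by simp
qed

text \<open>The first two conclusions are the boundary conditions of \<open>child_sequences\<close>
  one level up, where c is the index at which this node was created.\<close>

lemma children_join: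
  assumes "sorted_wrt (<) ks" "sorted_wrt (<) ls" "set ks \<subseteq> K" "set ls \<subseteq> K"
    and "\<forall>k \<in> set ks. c < k" "\<forall>l \<in> set ls. l < c" "1 \<le> c" "c \<le> n"
  defines "R \<equiv> concat (map U ks) @ \<alpha> @ concat (map U ls)"
  shows "prefix (take c \<alpha>) (R @ take c \<alpha>)" "suffix (drop (c - 1) \<alpha>) (drop (c - 1) \<alpha> @ R)"
    "cyclic_factors (Suc n) R + (\<Sum>k \<in> set ks \<union> set ls. same_ends (edge_word \<alpha> k)) =
      cyclic_factors (Suc n) \<alpha> +
      (\<Sum>k \<in> set ks \<union> set ls. cyclic_factors (Suc n) (U k) + swapped_ends (edge_word \<alpha> k))"
proof -
  let ?V = "concat (map U ks) @ \<alpha>"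
  have R: "R = ?V @ concat (map U ls)" by (simp add: R_def)
  have n: "n > 0" using assms by simp
  note right = right_children_join[OF assms(1,3) n]
  have Vne: "?V \<noteq> []" using length_\<alpha> n by auto
  have "prefix (take c \<alpha>) (?V @ take c \<alpha>)" using right assms(5,8) by simp
  \<comment> \<open>The sequence is at least as long as \<alpha>, so the prefix is reached without
    wrapping around.\<close>
  then have pre: "prefix (take c \<alpha>) ?V"
    by (rule prefix_length_prefix) (use length_\<alpha> in auto)
  then show "prefix (take c \<alpha>) (R @ take c \<alpha>)" unfolding R
    using prefix_prefix[of "take c \<alpha>" ?V "concat (map U ls) @ take c \<alpha>"] by simp
  note left = left_children_join[OF assms(2,4,6,8) Vne pre suffixI[OF refl]]
  note right2 = conjunct2[OF right] and left2 = conjunct2[OF left]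
  show "suffix (drop (c - 1) \<alpha>) (drop (c - 1) \<alpha> @ R)"
  proof -
    have "\<forall>l\<in>set ls. l \<le> c - 1" using assms(6) by fastforce
    with conjunct1[OF left, rule_format, of "c - 1"] show ?thesis using assms(8) unfolding R by auto
  qed
  have disj: "set ks \<inter> set ls = {}" using assms(5,6) by fastforce
  have sum: "(\<Sum>k \<in> set ks \<union> set ls. f k) = (\<Sum>k\<leftarrow>ks. f k) + (\<Sum>k\<leftarrow>ls. f k)"
    for f :: "nat \<Rightarrow> bitstring multiset"
    using assms(1,2) disj
    by (simp add: sum.union_disjoint sum_list_distinct_conv_sum_set strict_sorted_iff)
  show "cyclic_factors (Suc n) R + (\<Sum>k \<in> set ks \<union> set ls. same_ends (edge_word \<alpha> k)) =
      cyclic_factors (Suc n) \<alpha> +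
      (\<Sum>k \<in> set ks \<union> set ls. cyclic_factors (Suc n) (U k) + swapped_ends (edge_word \<alpha> k))"
    unfolding sum R using add_rearrange2[OF left2 right2] by simp
qed

end

lemma RCL_concat_subtree:
  "RCL (concat_subtree n \<alpha> c) =
    concat (map (\<lambda>k. RCL (concat_subtree n (complement_at \<alpha> k) k)) (filter (\<lambda>k. k > c) (child_indices n \<alpha>))) @
    ap \<alpha> @
    concat (map (\<lambda>k. RCL (concat_subtree n (complement_at \<alpha> k) k)) (filter (\<lambda>k. k < c) (child_indices n \<alpha>)))"
proof -
  have *: "concat (map ap (concat (map f ks))) = concat (map (\<lambda>k. concat (map ap (f k))) ks)"
    for f and ks :: "nat list"
    by (induction ks) auto
  show ?thesis by (subst concat_subtree.simps) (simp add: RCL_def * comp_def)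
qed

subsection \<open>The tree of parents\<close>

definition parent_rel :: "nat \<Rightarrow> (bitstring \<times> bitstring) set" where
  "parent_rel n = {(\<gamma>, par n \<gamma>) |\<gamma>. \<gamma> \<in> asym_bracelets n - {root_label n}}"

definition descendants :: "nat \<Rightarrow> bitstring \<Rightarrow> bitstring set" where
  "descendants n \<beta> = {\<gamma>. (\<gamma>, \<beta>) \<in> (parent_rel n)\<^sup>*}"

definition children :: "nat \<Rightarrow> bitstring \<Rightarrow> bitstring set" where
  "children n \<beta> = {\<gamma> \<in> asym_bracelets n - {root_label n}. par n \<gamma> = \<beta>}"

lemma finite_asym_bracelets: "finite (asym_bracelets n)"
proof (rule finite_subset)
  show "asym_bracelets n \<subseteq> {\<beta>. set \<beta> \<subseteq> UNIV \<and> length \<beta> = n}" by (auto simp: asym_bracelets_def)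
  show "finite {\<beta> :: bool list. set \<beta> \<subseteq> UNIV \<and> length \<beta> = n}"
    by (rule finite_lists_length_eq) simp
qed

lemma finite_children: "finite (children n \<beta>)"
  by (rule finite_subset[OF _ finite_asym_bracelets[of n]]) (auto simp: children_def)

lemma par_rank_descendants: "\<gamma> \<in> descendants n \<beta> \<Longrightarrow> par_rank n \<gamma> \<le> par_rank n \<beta>"
  unfolding descendants_def mem_Collect_eq
proof (induction rule: rtrancl_induct)
  case (step y z)
  then show ?case using par_rank_less_par[of y n] by (auto simp: parent_rel_def)
qed simp

lemma descendants_subset: "\<beta> \<in> asym_bracelets n \<Longrightarrow> descendants n \<beta> \<subseteq> asym_bracelets n"
proof
  fix \<gamma> assume \<beta>: "\<beta> \<in> asym_bracelets n" and "\<gamma> \<in> descendants n \<beta>"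
  then have "(\<gamma>, \<beta>) \<in> (parent_rel n)\<^sup>*" by (simp add: descendants_def)
  then show "\<gamma> \<in> asym_bracelets n"
    by (cases rule: converse_rtranclE) (auto simp: \<beta> parent_rel_def)
qed

lemma finite_descendants: "\<beta> \<in> asym_bracelets n \<Longrightarrow> finite (descendants n \<beta>)"
  using finite_subset[OF descendants_subset finite_asym_bracelets] .

lemma descendants_unfold: "descendants n \<beta> = insert \<beta> (\<Union>\<gamma> \<in> children n \<beta>. descendants n \<gamma>)"
proof -
  have "(\<gamma>, \<beta>) \<in> (parent_rel n)\<^sup>* \<longleftrightarrow> \<gamma> = \<beta> \<or> (\<exists>\<delta> \<in> children n \<beta>. (\<gamma>, \<delta>) \<in> (parent_rel n)\<^sup>*)" for \<gamma>
  proof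
    assume "(\<gamma>, \<beta>) \<in> (parent_rel n)\<^sup>*"
    then show "\<gamma> = \<beta> \<or> (\<exists>\<delta> \<in> children n \<beta>. (\<gamma>, \<delta>) \<in> (parent_rel n)\<^sup>*)"
      by (cases rule: rtranclE) (auto simp: parent_rel_def children_def)
  next
    assume "\<gamma> = \<beta> \<or> (\<exists>\<delta> \<in> children n \<beta>. (\<gamma>, \<delta>) \<in> (parent_rel n)\<^sup>*)"
    moreover have "(\<delta>, \<beta>) \<in> parent_rel n" if "\<delta> \<in> children n \<beta>" for \<delta>
      using that by (auto simp: parent_rel_def children_def)
    ultimately show "(\<gamma>, \<beta>) \<in> (parent_rel n)\<^sup>*" by (meson rtrancl.rtrancl_refl rtrancl_into_rtrancl)
  qed
  then show ?thesis by (auto simp: descendants_def)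
qed

lemma children_rank: "\<gamma> \<in> children n \<beta> \<Longrightarrow> par_rank n \<gamma> < par_rank n \<beta>"
  using par_rank_less_par[of \<gamma> n] by (auto simp: children_def)

lemma not_in_child_descendants: "\<gamma> \<in> children n \<beta> \<Longrightarrow> \<beta> \<notin> descendants n \<gamma>"
  using par_rank_descendants children_rank by (metis leD)

lemma single_valued_parent_rel: "single_valued (parent_rel n)"
  by (auto simp: single_valued_def parent_rel_def)

text \<open>As \<open>par\<close> is a function, a common descendant would put one child below the
  other. The path between them would pass through \<beta>, making \<beta> a descendant of its own
  child against the rank.\<close>

lemma child_descendants_disjoint:
  assumes "\<gamma> \<in> children n \<beta>" "\<gamma>' \<in> children n \<beta>" "\<gamma> \<noteq> \<gamma>'"
  shows "descendants n \<gamma> \<inter> descendants n \<gamma>' = {}"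
proof -
  have *: False if h: "(\<gamma>, \<gamma>') \<in> (parent_rel n)\<^sup>*" "\<gamma> \<in> children n \<beta>" "\<gamma>' \<in> children n \<beta>" "\<gamma> \<noteq> \<gamma>'" for \<gamma> \<gamma>'
  proof -
    obtain \<delta> where "(\<gamma>, \<delta>) \<in> parent_rel n" "(\<delta>, \<gamma>') \<in> (parent_rel n)\<^sup>*"
      using h(1,4) by (cases rule: converse_rtranclE) auto
    then have "\<beta> \<in> descendants n \<gamma>'" using h(2) by (auto simp: parent_rel_def children_def descendants_def)
    with not_in_child_descendants[OF h(3)] show False ..
  qed
  show ?thesis
  proof (rule ccontr)
    assume "\<not> ?thesis"
    then obtain \<delta> where "(\<delta>, \<gamma>) \<in> (parent_rel n)\<^sup>*" "(\<delta>, \<gamma>') \<in> (parent_rel n)\<^sup>*"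
      by (auto simp: descendants_def)
    then have "(\<gamma>, \<gamma>') \<in> (parent_rel n)\<^sup>* \<or> (\<gamma>', \<gamma>) \<in> (parent_rel n)\<^sup>*"
      using single_valued_confluent[OF single_valued_parent_rel] by blast
    with * assms show False by blast
  qed
qed

lemma sum_descendants:
  assumes "\<beta> \<in> asym_bracelets n"
  shows "(\<Sum>\<gamma> \<in> descendants n \<beta> - {\<beta>}. f \<gamma>) = (\<Sum>\<gamma> \<in> children n \<beta>. \<Sum>\<delta> \<in> descendants n \<gamma>. f \<delta>)"
proof -
  have "descendants n \<beta> - {\<beta>} = (\<Union>\<gamma> \<in> children n \<beta>. descendants n \<gamma>)"
    using descendants_unfold[of n \<beta>] not_in_child_descendants[of _ n \<beta>] by auto
  moreover have "\<forall>\<gamma> \<in> children n \<beta>. finite (descendants n \<gamma>)"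
    by (auto simp: children_def intro: finite_descendants)
  ultimately show ?thesis
    using child_descendants_disjoint by (simp add: sum.UNION_disjoint finite_children)
qed

text \<open>\<open>par_rank\<close> is bounded on A(n) and strictly increases along
  \<open>par\<close>, which stays in A(n) away from the root. So iterating \<open>par\<close> must
  arrive at the root.\<close>

lemma descendants_root:
  assumes "root_label n \<in> asym_bracelets n"
  shows "descendants n (root_label n) = asym_bracelets n"
proof
  show "descendants n (root_label n) \<subseteq> asym_bracelets n" by (rule descendants_subset[OF assms])
  have bound: "par_rank n \<gamma> \<le> n * (n + 1) + n" if "\<gamma> \<in> asym_bracelets n" for \<gamma>
  proof -
    have "length \<gamma> = n" using that by (simp add: asym_bracelets_def)
    then have "leading_zeros \<gamma> \<le> n" "length (filter id \<gamma>) \<le> n"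
      unfolding leading_zeros_def by (metis length_takeWhile_le, metis length_filter_le)
    then show ?thesis unfolding par_rank_def by (intro add_mono mult_right_mono) auto
  qed
  show "asym_bracelets n \<subseteq> descendants n (root_label n)"
  proof
    fix \<gamma> assume "\<gamma> \<in> asym_bracelets n"
    then show "\<gamma> \<in> descendants n (root_label n)"
    proof (induction "n * (n + 1) + n - par_rank n \<gamma>" arbitrary: \<gamma> rule: less_induct)
      case less
      show ?case
      proof (cases "\<gamma> = root_label n")
        case True
        then show ?thesis by (simp add: descendants_def)
      next
        case False
        have "par n \<gamma> \<in> asym_bracelets n" by (rule par_link(1)[OF less.prems False])
        moreover have "par_rank n \<gamma> < par_rank n (par n \<gamma>)" by (rule par_rank_less_par[OF less.prems])
        ultimately have "par n \<gamma> \<in> descendants n (root_label n)"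
          using bound by (intro less.hyps diff_less_mono2) (auto intro: less_le_trans)
        moreover have "(\<gamma>, par n \<gamma>) \<in> parent_rel n" using less.prems False by (auto simp: parent_rel_def)
        ultimately show ?thesis by (auto simp: descendants_def)
      qed
    qed
  qed
qed

section \<open>Matching child bracelets with bit positions of a label\<close>

lemma length_ap_rotations: "\<beta> \<in> rotations \<alpha> \<Longrightarrow> length (ap \<beta>) = length (ap \<alpha>)"
proof (cases "\<alpha> = []")
  case True
  assume "\<beta> \<in> rotations \<alpha>"
  then show ?thesis using True length_rotations by fastforce
next
  case False
  assume b: "\<beta> \<in> rotations \<alpha>"
  with False have "\<beta> \<noteq> []" using length_rotations by fastforce
  with False show ?thesis using card_rotations rotations_eq[OF b] by metis
qed

lemma length_ap_less_if_periodic: "periodic \<alpha> \<Longrightarrow> \<alpha> \<noteq> [] \<Longrightarrow> length (ap \<alpha>) < length \<alpha>"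
  using periodic_imp_rotate_eq[of \<alpha>] rotate_eq_imp_ap_le by (metis le_less_trans)

lemma periodic_rotations: "\<beta> \<in> rotations \<alpha> \<Longrightarrow> \<alpha> \<noteq> [] \<Longrightarrow> periodic \<beta> \<Longrightarrow> periodic \<alpha>"
proof (rule ccontr)
  assume b: "\<beta> \<in> rotations \<alpha>" "\<alpha> \<noteq> []" "periodic \<beta>" "\<not> periodic \<alpha>"
  then have "\<beta> \<noteq> []" using length_rotations by fastforce
  with b have "length (ap \<beta>) < length \<beta>" by (intro length_ap_less_if_periodic)
  with b show False using length_ap_rotations[OF b(1)] length_rotations[OF b(1)] ap_not_periodic by simp
qed

lemma edge_word_rotation:
  assumes "1 \<le> k" "k \<le> length \<alpha>"
  shows "\<alpha> ! (k - 1) # edge_word \<alpha> k = rotate (k - 1) \<alpha>"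
    and "(\<not> \<alpha> ! (k - 1)) # edge_word \<alpha> k \<in> rotations (complement_at \<alpha> k)"
proof -
  have "rotate (k - 1) \<alpha> = drop (k - 1) \<alpha> @ take (k - 1) \<alpha>" using assms by (simp add: rotate_drop_take)
  then show "\<alpha> ! (k - 1) # edge_word \<alpha> k = rotate (k - 1) \<alpha>"
    using assms Cons_nth_drop_Suc[of "k - 1" \<alpha>] by (simp add: edge_word_def)
  show "(\<not> \<alpha> ! (k - 1)) # edge_word \<alpha> k \<in> rotations (complement_at \<alpha> k)"
    unfolding complement_at_split(1)[OF assms]
    using append_swap_in_rotations[of "(\<not> \<alpha> ! (k - 1)) # drop k \<alpha>" "take (k - 1) \<alpha>"]
    by (simp add: edge_word_def)
qed

text \<open>Surjectivity: the word of a child, preceded by a bit, is a rotation of \<alpha>, and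
  complementing this bit of \<alpha> gives the child; moreover \<alpha> is aperiodic as soon as a
  child exists. Injectivity: indices with the same child have the same edge word, hence by weight
  the same rotation of \<alpha>, and the rotations of an aperiodic label are distinct.\<close>

lemma child_indices_bij_betw:
  assumes A: "necklace_of \<alpha> \<in> asym_bracelets n"
  shows "bij_betw (\<lambda>k. necklace_of (complement_at \<alpha> k)) (set (child_indices n \<alpha>)) (children n (necklace_of \<alpha>))"
    and "k \<in> set (child_indices n \<alpha>) \<Longrightarrow> edge_word \<alpha> k = swap_word n (necklace_of (complement_at \<alpha> k))"
proof -
  let ?\<beta> = "necklace_of \<alpha>" and ?\<gamma> = "\<lambda>k. necklace_of (complement_at \<alpha> k)"
  have len: "length \<alpha> = n" using A length_necklace_of[of \<alpha>] by (simp add: asym_bracelets_def)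
  have \<beta>\<alpha>: "rotations ?\<beta> = rotations \<alpha>" by (rule rotations_eq[OF necklace_of_in])
  have \<gamma>: "rotations (?\<gamma> k) = rotations (complement_at \<alpha> k)" for k
    by (rule rotations_eq[OF necklace_of_in])
  have ci: "k \<in> set (child_indices n \<alpha>) \<longleftrightarrow> \<not> periodic \<alpha> \<and> 1 \<le> k \<and> k \<le> n \<and> ?\<gamma> k \<in> children n ?\<beta>" for k
    by (auto simp: child_indices_def children_def)
  show edge: "edge_word \<alpha> k = swap_word n (?\<gamma> k)" if "k \<in> set (child_indices n \<alpha>)" for k
  proof -
    have k: "1 \<le> k" "k \<le> length \<alpha>" and c: "?\<gamma> k \<in> asym_bracelets n" "?\<gamma> k \<noteq> root_label n" "par n (?\<gamma> k) = ?\<beta>"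
      using that ci len by (auto simp: children_def)
    show ?thesis
    proof (rule par_link(4)[OF c(1,2)])
      show "(\<not> \<alpha> ! (k - 1)) # edge_word \<alpha> k \<in> rotations (?\<gamma> k)"
        unfolding \<gamma> by (rule edge_word_rotation(2)[OF k])
      show "(\<not> (\<not> \<alpha> ! (k - 1))) # edge_word \<alpha> k \<in> rotations (par n (?\<gamma> k))"
        unfolding c(3) \<beta>\<alpha> using edge_word_rotation(1)[OF k] by simp
    qed
  qed
  show "bij_betw ?\<gamma> (set (child_indices n \<alpha>)) (children n ?\<beta>)"
  proof (rule bij_betw_imageI)
    show "inj_on ?\<gamma> (set (child_indices n \<alpha>))"
    proof (rule inj_onI)
      fix k k' assume k: "k \<in> set (child_indices n \<alpha>)" and k': "k' \<in> set (child_indices n \<alpha>)"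
        and eq: "?\<gamma> k = ?\<gamma> k'"
      have r: "1 \<le> k" "k \<le> length \<alpha>" "1 \<le> k'" "k' \<le> length \<alpha>" "\<not> periodic \<alpha>" using k k' ci len by auto
      have z: "edge_word \<alpha> k = edge_word \<alpha> k'" using edge k k' eq by simp
      have "weight (\<alpha> ! (k - 1) # edge_word \<alpha> k) = weight (\<alpha> ! (k' - 1) # edge_word \<alpha> k')"
        by (simp only: edge_word_rotation(1)[OF r(1,2)] edge_word_rotation(1)[OF r(3,4)]
            weight_rotations[OF rotate_in_rotations])
      then have "\<alpha> ! (k - 1) = \<alpha> ! (k' - 1)"
        unfolding z weight_Cons by (simp only: add_right_cancel of_bool_eq_iff)
      then have rot: "rotate (k - 1) \<alpha> = rotate (k' - 1) \<alpha>"
        by (simp only: z flip: edge_word_rotation(1)[OF r(1,2)] edge_word_rotation(1)[OF r(3,4)])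
      have inj: "inj_on (\<lambda>i. rotate i \<alpha>) {..<length \<alpha>}"
        using rotations_bij_betw[of \<alpha>] r ap_not_periodic[of \<alpha>] by (cases "\<alpha> = []") (auto simp: bij_betw_def)
      have "k - 1 \<in> {..<length \<alpha>}" "k' - 1 \<in> {..<length \<alpha>}" using r by auto
      with inj rot have "k - 1 = k' - 1" by (rule inj_onD)
      then show "k = k'" using r by simp
    qed
    show "?\<gamma> ` set (child_indices n \<alpha>) = children n ?\<beta>"
    proof
      show "children n ?\<beta> \<subseteq> ?\<gamma> ` set (child_indices n \<alpha>)"
      proof
        fix \<delta> assume \<delta>: "\<delta> \<in> children n ?\<beta>"
        then have c: "\<delta> \<in> asym_bracelets n" "\<delta> \<noteq> root_label n" "par n \<delta> = ?\<beta>" by (auto simp: children_def)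
        let ?z = "swap_word n \<delta>"
        obtain b where b: "b # ?z \<in> rotations \<delta>" "(\<not> b) # ?z \<in> rotations \<alpha>"
          using par_link(3)[OF c(1,2)] \<beta>\<alpha> by (auto simp: c(3))
        have ne: "\<alpha> \<noteq> []" using length_rotations[OF b(2)] by auto
        have "?\<beta> \<noteq> []" using ne length_necklace_of[of \<alpha>] by (metis length_0_conv)
        then have np: "\<not> periodic \<alpha>"
          using par_link(2)[OF c(1,2)] periodic_rotations[of \<alpha> ?\<beta>] \<beta>\<alpha> ne length_rotations[OF necklace_of_in[of \<alpha>]]
          by (auto simp: c(3))
        obtain i where "(\<not> b) # ?z = rotate i \<alpha>" using b(2) by (auto simp: rotations_def)
        then have i: "(\<not> b) # ?z = rotate (i mod n) \<alpha>" by (metis len rotate_conv_mod)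
        define k where "k = Suc (i mod n)"
        have k: "1 \<le> k" "k \<le> length \<alpha>" using ne len by (auto simp: k_def Suc_le_eq)
        have "\<alpha> ! (k - 1) # edge_word \<alpha> k = (\<not> b) # ?z"
          using edge_word_rotation(1)[OF k] i by (simp add: k_def)
        then have "b # ?z \<in> rotations (complement_at \<alpha> k)" using edge_word_rotation(2)[OF k] by simp
        then have "complement_at \<alpha> k \<in> rotations \<delta>" using b(1) by (blast intro: rotations_trans rotations_sym)
        then have "?\<gamma> k = \<delta>" using necklace_of_eq_iff necklace_of_asym_bracelet[OF c(1)] by metis
        with \<delta> ci np k len show "\<delta> \<in> ?\<gamma> ` set (child_indices n \<alpha>)" by auto
      qed
    qed (use ci in auto)
  qed
qed

lemma ap_self_prefix_suffix:
  shows "prefix \<alpha> (ap \<alpha> @ \<alpha>)" "suffix \<alpha> (\<alpha> @ ap \<alpha>)"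
proof -
  obtain t where t: "\<alpha> = concat (replicate t (ap \<alpha>))" using length_ap_eq by blast
  have "concat (replicate t p) @ p = p @ concat (replicate t p)" for p :: bitstring
    by (induction t) auto
  then have "\<alpha> @ ap \<alpha> = ap \<alpha> @ \<alpha>" using t by metis
  then show "prefix \<alpha> (ap \<alpha> @ \<alpha>)" "suffix \<alpha> (\<alpha> @ ap \<alpha>)" by (metis prefixI, metis suffixI)
qed

definition closed_rotations :: "bitstring \<Rightarrow> bitstring multiset" where
  "closed_rotations \<gamma> = image_mset (\<lambda>s. s @ [hd s]) (mset_set (rotations \<gamma>))"

text \<open>The condition that c is no child index prevents a child from being lost between the
  strict comparisons k > c and k < c. The final equation balances the windows of the sequence and
  those destroyed at the edges below against the windows of the separate strings
  \<open>ap \<gamma>\<close> and those created.\<close>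

lemma concat_subtree_cyclic_factors:
  assumes "necklace_of \<alpha> \<in> asym_bracelets n" "1 \<le> c" "c \<le> n" "c \<notin> set (child_indices n \<alpha>)"
  defines "R \<equiv> RCL (concat_subtree n \<alpha> c)" and "D \<equiv> descendants n (necklace_of \<alpha>)"
  shows "R \<noteq> []" "prefix (take c \<alpha>) (R @ take c \<alpha>)" "suffix (drop (c - 1) \<alpha>) (drop (c - 1) \<alpha> @ R)"
    "cyclic_factors (Suc n) R + (\<Sum>\<gamma> \<in> D - {necklace_of \<alpha>}. same_ends (swap_word n \<gamma>)) =
      (\<Sum>\<gamma> \<in> D. closed_rotations \<gamma>) + (\<Sum>\<gamma> \<in> D - {necklace_of \<alpha>}. swapped_ends (swap_word n \<gamma>))"
proof -
  have "R \<noteq> [] \<and> prefix (take c \<alpha>) (R @ take c \<alpha>) \<and> suffix (drop (c - 1) \<alpha>) (drop (c - 1) \<alpha> @ R) \<and>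
    cyclic_factors (Suc n) R + (\<Sum>\<gamma> \<in> D - {necklace_of \<alpha>}. same_ends (swap_word n \<gamma>)) =
      (\<Sum>\<gamma> \<in> D. closed_rotations \<gamma>) + (\<Sum>\<gamma> \<in> D - {necklace_of \<alpha>}. swapped_ends (swap_word n \<gamma>))"
    using assms(1-4) unfolding R_def D_def
  proof (induction n \<alpha> c rule: concat_subtree.induct)
    case (1 n \<alpha> c)
    let ?\<beta> = "necklace_of \<alpha>" and ?\<gamma> = "\<lambda>k. necklace_of (complement_at \<alpha> k)"
    let ?U = "\<lambda>k. RCL (concat_subtree n (complement_at \<alpha> k) k)"
    let ?K = "set (child_indices n \<alpha>)"
    let ?ks = "filter (\<lambda>k. k > c) (child_indices n \<alpha>)" and ?ls = "filter (\<lambda>k. k < c) (child_indices n \<alpha>)"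
    have len: "length \<alpha> = n" using 1 length_necklace_of[of \<alpha>] by (simp add: asym_bracelets_def)
    have ne: "\<alpha> \<noteq> []" using len 1 by auto
    have K: "?K = set ?ks \<union> set ?ls" using "1.prems"(4) by (auto simp: not_less) (metis le_neq_implies_less)
    note bij = child_indices_bij_betw[OF "1.prems"(1)]
    have IH: "?U k \<noteq> [] \<and> prefix (take k (complement_at \<alpha> k)) (?U k @ take k (complement_at \<alpha> k)) \<and>
      suffix (drop (k - 1) (complement_at \<alpha> k)) (drop (k - 1) (complement_at \<alpha> k) @ ?U k) \<and>
      cyclic_factors (Suc n) (?U k) + (\<Sum>\<gamma> \<in> descendants n (?\<gamma> k) - {?\<gamma> k}. same_ends (swap_word n \<gamma>)) =
      (\<Sum>\<gamma> \<in> descendants n (?\<gamma> k). closed_rotations \<gamma>) +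
      (\<Sum>\<gamma> \<in> descendants n (?\<gamma> k) - {?\<gamma> k}. swapped_ends (swap_word n \<gamma>))"
      if k: "k \<in> ?K" for k
    proof -
      have child: "?\<gamma> k \<in> children n ?\<beta>" using bij_betwE[OF bij(1)] k by blast
      have kn: "1 \<le> k" "k \<le> n" using k by (auto simp: child_indices_def split: if_splits)
      \<comment> \<open>Flipping bit k of the child label again returns to \<alpha>. Were \<alpha>
        in turn a child of its child, \<open>par_rank\<close> would increase around a cycle; so a
        change index is never a child index of its own node.\<close>
      have "complement_at (complement_at \<alpha> k) k = \<alpha>"
        using kn len by (simp add: complement_at_def)
      then have "k \<notin> set (child_indices n (complement_at \<alpha> k))"
        using par_rank_less_par[OF "1.prems"(1)] children_rank[OF child]
        by (auto simp: child_indices_def split: if_splits)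
      moreover have "?\<gamma> k \<in> asym_bracelets n" using child by (simp add: children_def)
      moreover have "k \<in> set ?ks \<or> k \<in> set ?ls" using k K by blast
      ultimately show ?thesis using "1.IH"[of k] kn by blast
    qed
    have CK: "child_sequences n \<alpha> ?U ?K"
      using IH len by unfold_locales (auto simp: child_indices_def split: if_splits)
    have sorted: "sorted_wrt (<) ?ks" "sorted_wrt (<) ?ls"
      by (simp_all add: child_indices_def sorted_wrt_filter del: upt_Suc)
    let ?R = "RCL (concat_subtree n \<alpha> c)"
    have R: "?R = concat (map ?U ?ks) @ ap \<alpha> @ concat (map ?U ?ls)" by (rule RCL_concat_subtree)
    have boundary: "prefix (take c \<alpha>) (?R @ take c \<alpha>) \<and> suffix (drop (c - 1) \<alpha>) (drop (c - 1) \<alpha> @ ?R)"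
      and factors: "cyclic_factors (Suc n) ?R + (\<Sum>k \<in> ?K. same_ends (edge_word \<alpha> k)) =
        closed_rotations \<alpha> + (\<Sum>k \<in> ?K. cyclic_factors (Suc n) (?U k) + swapped_ends (edge_word \<alpha> k))"
    proof -
      have cr: "cyclic_factors (Suc n) (ap \<alpha>) = closed_rotations \<alpha>"
        unfolding closed_rotations_def by (rule cyclic_factors_ap[OF ne len])
      have "(prefix (take c \<alpha>) (?R @ take c \<alpha>) \<and> suffix (drop (c - 1) \<alpha>) (drop (c - 1) \<alpha> @ ?R)) \<and>
        cyclic_factors (Suc n) ?R + (\<Sum>k \<in> ?K. same_ends (edge_word \<alpha> k)) =
        closed_rotations \<alpha> + (\<Sum>k \<in> ?K. cyclic_factors (Suc n) (?U k) + swapped_ends (edge_word \<alpha> k))"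
      proof (cases "periodic \<alpha>")
        case True
        then have e: "child_indices n \<alpha> = []" by (simp add: child_indices_def)
        then have "?R = ap \<alpha>" by (simp add: R)
        then show ?thesis
          using e cr prefix_self_prefix[OF take_is_prefix ap_self_prefix_suffix(1)]
            suffix_self_suffix[OF suffix_drop ap_self_prefix_suffix(2)] by simp
      next
        case False
        then have R': "?R = concat (map ?U ?ks) @ \<alpha> @ concat (map ?U ?ls)"
          and cr': "cyclic_factors (Suc n) \<alpha> = closed_rotations \<alpha>"
          using cr by (simp_all only: R ap_not_periodic[OF False])
        have sub: "set ?ks \<subseteq> ?K" "set ?ls \<subseteq> ?K" "\<forall>k \<in> set ?ks. c < k" "\<forall>k \<in> set ?ls. k < c"
          by auto
        note join = child_sequences.children_join[OF CK sorted sub "1.prems"(2,3), folded R']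
        show ?thesis using join(1,2) join(3)[folded K, unfolded cr'] by blast
      qed
      then show "prefix (take c \<alpha>) (?R @ take c \<alpha>) \<and> suffix (drop (c - 1) \<alpha>) (drop (c - 1) \<alpha> @ ?R)"
        and "cyclic_factors (Suc n) ?R + (\<Sum>k \<in> ?K. same_ends (edge_word \<alpha> k)) =
        closed_rotations \<alpha> + (\<Sum>k \<in> ?K. cyclic_factors (Suc n) (?U k) + swapped_ends (edge_word \<alpha> k))" by blast+
    qed
    have sum_K: "(\<Sum>k \<in> ?K. f (?\<gamma> k)) = (\<Sum>\<gamma> \<in> children n ?\<beta>. f \<gamma>)" for f :: "bitstring \<Rightarrow> bitstring multiset"
      by (rule sum.reindex_bij_betw[OF bij(1)])
    define E0 where "E0 \<gamma> = (\<Sum>\<delta> \<in> descendants n \<gamma> - {\<gamma>}. same_ends (swap_word n \<delta>))" for \<gamma>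
    define E1 where "E1 \<gamma> = (\<Sum>\<delta> \<in> descendants n \<gamma> - {\<gamma>}. swapped_ends (swap_word n \<delta>))" for \<gamma>
    define N where "N \<gamma> = (\<Sum>\<delta> \<in> descendants n \<gamma>. closed_rotations \<delta>)" for \<gamma>
    have desc: "(\<Sum>\<delta> \<in> descendants n \<gamma>. f \<delta>) = f \<gamma> + (\<Sum>\<delta> \<in> descendants n \<gamma> - {\<gamma>}. f \<delta>)"
      if "\<gamma> \<in> asym_bracelets n" for \<gamma> and f :: "bitstring \<Rightarrow> bitstring multiset"
      using finite_descendants[OF that] by (rule sum.remove) (simp add: descendants_def)
    have child_desc: "(\<Sum>\<delta> \<in> descendants n (?\<gamma> k). f \<delta>) = f (?\<gamma> k) + (\<Sum>\<delta> \<in> descendants n (?\<gamma> k) - {?\<gamma> k}. f \<delta>)"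
      if "k \<in> ?K" for k and f :: "bitstring \<Rightarrow> bitstring multiset"
      using bij_betwE[OF bij(1)] that by (intro desc) (auto simp: children_def)
    have total: "(\<Sum>\<delta> \<in> descendants n ?\<beta> - {?\<beta>}. f \<delta>) = (\<Sum>k \<in> ?K. \<Sum>\<delta> \<in> descendants n (?\<gamma> k). f \<delta>)"
      for f :: "bitstring \<Rightarrow> bitstring multiset"
      using sum_K[of "\<lambda>\<gamma>. \<Sum>\<delta> \<in> descendants n \<gamma>. f \<delta>"] sum_descendants[OF "1.prems"(1), of f] by simp
    have cr: "closed_rotations \<alpha> = closed_rotations ?\<beta>"
      unfolding closed_rotations_def using rotations_eq[OF necklace_of_in[of \<alpha>]] by simp
    have "cyclic_factors (Suc n) ?R + E0 ?\<beta> =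
        cyclic_factors (Suc n) ?R + (\<Sum>k \<in> ?K. same_ends (edge_word \<alpha> k)) + (\<Sum>k \<in> ?K. E0 (?\<gamma> k))"
    proof -
      have "E0 ?\<beta> = (\<Sum>k \<in> ?K. same_ends (edge_word \<alpha> k) + E0 (?\<gamma> k))"
        unfolding E0_def[of ?\<beta>] total
        by (rule sum.cong[OF refl]) (simp add: child_desc E0_def bij(2))
      then show ?thesis by (simp add: sum.distrib add.assoc)
    qed
    also have "\<dots> = closed_rotations ?\<beta> +
        (\<Sum>k \<in> ?K. (cyclic_factors (Suc n) (?U k) + E0 (?\<gamma> k)) + swapped_ends (edge_word \<alpha> k))"
      unfolding factors cr by (simp add: sum.distrib ac_simps)
    also have "\<dots> = closed_rotations ?\<beta> + (\<Sum>k \<in> ?K. N (?\<gamma> k) + (E1 (?\<gamma> k) + swapped_ends (edge_word \<alpha> k)))"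
    proof -
      have "cyclic_factors (Suc n) (?U k) + E0 (?\<gamma> k) = N (?\<gamma> k) + E1 (?\<gamma> k)" if "k \<in> ?K" for k
        using IH[OF that] by (simp add: E0_def E1_def N_def)
      then show ?thesis by (simp add: add.assoc)
    qed
    also have "\<dots> = N ?\<beta> + E1 ?\<beta>"
    proof -
      have "E1 ?\<beta> = (\<Sum>k \<in> ?K. E1 (?\<gamma> k) + swapped_ends (edge_word \<alpha> k))"
        unfolding E1_def[of ?\<beta>] total
        by (rule sum.cong[OF refl]) (simp add: child_desc E1_def bij(2) add.commute)
      moreover have "N ?\<beta> = closed_rotations ?\<beta> + (\<Sum>k \<in> ?K. N (?\<gamma> k))"
        unfolding N_def desc[OF "1.prems"(1)] total by simp
      ultimately show ?thesis by (simp add: sum.distrib add.assoc)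
    qed
    finally have "cyclic_factors (Suc n) ?R + E0 ?\<beta> = N ?\<beta> + E1 ?\<beta>" .
    moreover have "?R \<noteq> []" unfolding R using ap_not_Nil[OF ne] by simp
    ultimately show ?case using boundary unfolding E0_def E1_def N_def by blast
  qed
  then show "R \<noteq> []" "prefix (take c \<alpha>) (R @ take c \<alpha>)" "suffix (drop (c - 1) \<alpha>) (drop (c - 1) \<alpha> @ R)"
    "cyclic_factors (Suc n) R + (\<Sum>\<gamma> \<in> D - {necklace_of \<alpha>}. same_ends (swap_word n \<gamma>)) =
      (\<Sum>\<gamma> \<in> D. closed_rotations \<gamma>) + (\<Sum>\<gamma> \<in> D - {necklace_of \<alpha>}. swapped_ends (swap_word n \<gamma>))"
    by blast+
qed

subsection \<open>The successor rule\<close>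

lemma root_label_in:
  assumes "n \<ge> 6"
  shows "root_label n \<in> asym_bracelets n"
proof -
  have "\<not> sublist (replicate (n - 4) False) [True, False, True, True]"
  proof
    assume "sublist (replicate (n - 4) False) [True, False, True, True]"
    moreover have "replicate (n - 4) False = [False, False] @ replicate (n - 6) False"
      using assms by (simp flip: replicate_Suc add: Suc_diff_le numeral_eq_Suc)
    ultimately have "sublist [False, False] [True, False, True, True]"
      by (metis prefixI prefix_imp_sublist sublist_order.order.trans)
    then show False by (simp add: sublist_Cons_right)
  qed
  then have "root_label n \<in> asym_bracelets (n - 4 + length [True, False, True, True])"
    unfolding root_label_def by (subst leading_run_asym_bracelet_iff) simp_all
  moreover have "n - 4 + length [True, False, True, True] = n" using assms by simp
  ultimately show ?thesis by simp
qed

lemma not_asym_if_rotation_symmetric: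
  "symmetric \<alpha> \<Longrightarrow> \<gamma> \<in> rotations \<alpha> \<Longrightarrow> \<gamma> \<notin> asym_bracelets n"
  using symmetric_rotations by (auto simp: asym_bracelets_def)

lemma zeros_1010_symmetric: "symmetric (replicate (Suc m) False @ [True, False, True, False])"
proof -
  have "rev (replicate (Suc m) False @ [True, False, True, False]) =
      [False, True, False, True, False] @ replicate m False" by (simp add: replicate_append_same)
  moreover have "replicate (Suc m) False @ [True, False, True, False] =
      replicate m False @ [False, True, False, True, False]" by (simp add: replicate_app_Cons_same)
  ultimately show ?thesis unfolding symmetric_def by (metis append_swap_in_rotations)
qed

text \<open>The candidates are 0^(n-2) 11, a rotation of 0^(n-4) 1010, and 0^(n-4) 1111, all
  symmetric. So no condition in \<open>g\<close> is met by the root. The last claim admits n as the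
  change index of the root: flipping bit n gives 0^(n-4) 1010 once more.\<close>

lemma root_label_no_parent:
  assumes "n \<ge> 6"
  shows "first_one (root_label n) \<notin> asym_bracelets n" "last_one (root_label n) \<notin> asym_bracelets n"
    "last_zero (root_label n) \<notin> asym_bracelets n" "n \<notin> set (child_indices n (root_label n))"
proof -
  obtain m where m: "n - 4 = Suc m" "length (root_label n) = n"
    using assms by (cases "n - 4") (auto simp: root_label_def)
  have sym: "symmetric (replicate (n - 4) False @ [True, False, True, False])"
    unfolding m by (rule zeros_1010_symmetric)
  have "first_one (root_label n) = replicate (n - 2) False @ replicate 2 True"
  proof -
    have "replicate (n - 2) False = replicate (n - 4) False @ [False, False]"
    proof -
      have "n - 2 = n - 4 + 2" using assms by simp
      then show ?thesis by (simp only: replicate_add) (simp add: numeral_2_eq_2)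
    qed
    then show ?thesis
      by (simp add: first_one_def root_label_def flip_first_True_replicate numeral_2_eq_2)
  qed
  then show "first_one (root_label n) \<notin> asym_bracelets n"
    using zeros_ones_symmetric by (simp add: asym_bracelets_def)
  have "last_zero (root_label n) = replicate (n - 4) False @ replicate 4 True"
    using last_zero_eq[of "replicate (n - 4) False @ [True]" 2]
    by (simp add: root_label_def numeral_eq_Suc)
  then show "last_zero (root_label n) \<notin> asym_bracelets n"
    using zeros_ones_symmetric by (simp add: asym_bracelets_def)
  show "last_one (root_label n) \<notin> asym_bracelets n"
    using not_asym_if_rotation_symmetric[OF sym necklace_of_in]
    by (simp add: last_one_def root_label_def butlast_append)
  have "complement_at (root_label n) n = replicate (n - 4) False @ [True, False, True, False]"
  proof -
    have "root_label n ! (n - 1)"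
    proof -
      have "last (root_label n)" "root_label n \<noteq> []" by (simp_all add: root_label_def)
      then show ?thesis using last_conv_nth m(2) by metis
    qed
    moreover have "take (n - 1) (root_label n) = replicate (n - 4) False @ [True, False, True]"
      using assms by (simp add: root_label_def numeral_eq_Suc)
    ultimately show ?thesis
      using complement_at_split(1)[of n "root_label n"] assms m(2) by simp
  qed
  then show "n \<notin> set (child_indices n (root_label n))"
    using not_asym_if_rotation_symmetric[OF sym necklace_of_in]
    by (simp add: child_indices_def del: upt_Suc)
qed

section \<open>Evaluating g\<close>

lemma replicate_Cons_inject:
  "x \<noteq> y \<Longrightarrow> replicate a x @ y # u = replicate b x @ y # v \<longleftrightarrow> a = b \<and> u = v"
proof (induction a arbitrary: b)
  case 0
  then show ?case by (cases b) auto
next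
  case (Suc a)
  then show ?case by (cases b) auto
qed

lemma append_Cons_replicate_inject:
  assumes "x \<noteq> y" "u @ y # replicate a x = v @ y # replicate b x"
  shows "a = b" "u = v"
proof -
  have "replicate a x @ y # rev u = replicate b x @ y # rev v"
    using arg_cong[OF assms(2), of rev] by simp
  then show "a = b" "u = v" using assms(1) by (auto simp: replicate_Cons_inject)
qed

lemma split_first_zero:
  assumes "False \<in> set u"
  obtains e v where "u = replicate e True @ False # v"
proof -
  obtain u1 v where u: "u = u1 @ False # v" "False \<notin> set u1"
    using split_list_first[OF assms] by blast
  then show ?thesis using all_eq_replicate[of True u1] that by auto
qed

lemma S_set_Cons_bits:
  assumes "p # z \<in> S_set n"
  shows "True \<in> set z" "False \<in> set z" "length z = n - 1" "n > 0"
proof -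
  obtain \<gamma> where \<gamma>: "\<gamma> \<in> asym_bracelets n" "p # z \<in> rotations \<gamma>" using assms by (auto simp: S_set_def)
  then have asym: "\<not> symmetric (p # z)" using symmetric_rotations by (auto simp: asym_bracelets_def)
  have len: "length (p # z) = n" using \<gamma>(1) length_rotations[OF \<gamma>(2)] by (simp add: asym_bracelets_def)
  then show "length z = n - 1" "n > 0" by auto
  show "True \<in> set z"
  proof (rule ccontr)
    assume "True \<notin> set z"
    then obtain m where z: "z = replicate m False" using all_eq_replicate[of False z] by auto
    have "rev (p # z) \<in> rotations (p # z)"
      using append_swap_in_rotations[of z "[p]"] by (simp add: z)
    with asym show False by (simp add: symmetric_def)
  qed
  show "False \<in> set z"
  proof (rule ccontr)
    assume "False \<notin> set z"
    then obtain m where z: "z = replicate m True" using all_eq_replicate[of True z] by auto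
    have "rev (p # z) \<in> rotations (p # z)"
      using append_swap_in_rotations[of z "[p]"] by (simp add: z)
    with asym show False by (simp add: symmetric_def)
  qed
qed

text \<open>The formulas for \<open>swap_word\<close> can be inverted rule by rule: the trailing
  zeros of z recover the bracelet for FirstOne, an appended 1 the one for LastOne, and the leading
  ones of z the one for LastZero. These are the strings \<beta>1, \<beta>2, \<beta>3, and the side
  conditions in \<open>g\<close> state which rule \<open>par\<close> applies to them.\<close>

lemma g_eq:
  assumes n: "n \<ge> 6" and S: "p # z \<in> S_set n"
  shows "g n (p # z) = (if z \<in> swap_word n ` (asym_bracelets n - {root_label n}) then \<not> p else p)"
proof -
  let ?A = "asym_bracelets n" and ?w = "p # z"
  note bits = S_set_Cons_bits[OF S]
  obtain z1 a where z1: "z = z1 @ True # replicate a False" by (rule split_last_one[OF bits(1)])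
  obtain e z2 where z2: "z = replicate e True @ False # z2" by (rule split_first_zero[OF bits(2)])
  have n1: "n = length z1 + a + 2" using bits(3,4) z1 by simp
  have n2: "n = e + length z2 + 2" using bits(3,4) z2 by simp
  have i: "(GREATEST i. 1 \<le> i \<and> i \<le> n \<and> ?w ! (i - 1)) = length z1 + 2"
  proof (rule Greatest_equality)
    show "1 \<le> length z1 + 2 \<and> length z1 + 2 \<le> n \<and> ?w ! (length z1 + 2 - 1)"
      by (simp add: n1 z1 nth_append)
    fix i assume i: "1 \<le> i \<and> i \<le> n \<and> ?w ! (i - 1)"
    show "i \<le> length z1 + 2"
    proof (rule ccontr)
      assume "\<not> i \<le> length z1 + 2"
      then obtain j where j: "i = length z1 + 3 + j" by (metis add.assoc le_iff_add nat_less_le not_le numeral_3_eq_3 numeral_2_eq_2 add_Suc_right Suc_leI)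
      with i n1 have "j < a" by simp
      with i show False by (simp add: j z1 nth_append)
    qed
  qed
  have j: "(LEAST j. 1 < j \<and> j \<le> n \<and> \<not> ?w ! (j - 1)) = e + 2"
  proof (rule Least_equality)
    show "1 < e + 2 \<and> e + 2 \<le> n \<and> \<not> ?w ! (e + 2 - 1)" by (simp add: n2 z2 nth_append)
    fix j assume j: "1 < j \<and> j \<le> n \<and> \<not> ?w ! (j - 1)"
    show "e + 2 \<le> j"
    proof (rule ccontr)
      assume "\<not> e + 2 \<le> j"
      moreover obtain j' where j': "j = Suc (Suc j')" using j by (cases j; cases "j - 1") auto
      ultimately have "j' < e" by simp
      with j show False by (simp add: j' z2 nth_append)
    qed
  qed
  define \<beta>1 where "\<beta>1 = replicate a False @ True # z1 @ [True]"
  define \<beta>2 where "\<beta>2 = z @ [True]"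
  define \<beta>3 where "\<beta>3 = (False # z2) @ False # replicate e True"
  have g: "g n ?w = (if (\<beta>1 \<in> ?A \<and> first_one \<beta>1 \<in> ?A) \<or>
           (\<beta>2 \<in> ?A \<and> last_one \<beta>2 \<in> ?A \<and> first_one \<beta>2 \<notin> ?A) \<or>
           (\<beta>3 \<in> ?A \<and> last_zero \<beta>3 \<in> ?A \<and> first_one \<beta>3 \<notin> ?A \<and> last_one \<beta>3 \<notin> ?A)
        then \<not> p else p)"
  proof -
    have 1: "replicate (n - (length z1 + 2)) False @ [True] @ drop 1 (take (length z1 + 2) ?w) = \<beta>1"
      by (simp add: n1 \<beta>1_def z1)
    have 2: "drop 1 ?w @ [True] = \<beta>2" by (simp add: \<beta>2_def)
    have 3: "drop (e + 2 - 1) ?w @ [False] @ replicate (e + 2 - 2) True = \<beta>3"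
      by (simp add: \<beta>3_def z2)
    show ?thesis unfolding g_def i j Let_def 1 2 3 by simp
  qed
  have "(\<beta>1 \<in> ?A \<and> first_one \<beta>1 \<in> ?A) \<or>
      (\<beta>2 \<in> ?A \<and> last_one \<beta>2 \<in> ?A \<and> first_one \<beta>2 \<notin> ?A) \<or>
      (\<beta>3 \<in> ?A \<and> last_zero \<beta>3 \<in> ?A \<and> first_one \<beta>3 \<notin> ?A \<and> last_one \<beta>3 \<notin> ?A) \<longleftrightarrow>
    z \<in> swap_word n ` (?A - {root_label n})" (is "?cond \<longleftrightarrow> _")
  proof
    assume ?cond
    then consider (1) "\<beta>1 \<in> ?A" "first_one \<beta>1 \<in> ?A"
      | (2) "\<beta>2 \<in> ?A" "last_one \<beta>2 \<in> ?A" "first_one \<beta>2 \<notin> ?A"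
      | (3) "\<beta>3 \<in> ?A" "last_zero \<beta>3 \<in> ?A" "first_one \<beta>3 \<notin> ?A" "last_one \<beta>3 \<notin> ?A" by blast
    then show "z \<in> swap_word n ` (?A - {root_label n})"
    proof cases
      case 1
      have "swap_word n \<beta>1 = z" using swap_word_first_one[OF \<beta>1_def 1(2)] by (simp add: z1)
      moreover have "\<beta>1 \<noteq> root_label n" using 1(2) root_label_no_parent(1)[OF n] by auto
      ultimately show ?thesis using 1(1) by blast
    next
      case 2
      have "swap_word n \<beta>2 = z" using 2 by (simp add: swap_word_def \<beta>2_def)
      moreover have "\<beta>2 \<noteq> root_label n" using 2(2) root_label_no_parent(2)[OF n] by auto
      ultimately show ?thesis using 2(1) by blast
    next
      case 3
      have "length \<beta>3 = n" using 3(1) by (simp add: asym_bracelets_def)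
      then have "swap_word n \<beta>3 = z" using swap_word_last_zero[OF \<beta>3_def _ 3(3,4)] by (simp add: z2)
      moreover have "\<beta>3 \<noteq> root_label n" using 3(2) root_label_no_parent(3)[OF n] by auto
      ultimately show ?thesis using 3(1) by blast
    qed
  next
    assume "z \<in> swap_word n ` (?A - {root_label n})"
    then obtain \<gamma> where \<gamma>: "\<gamma> \<in> ?A" "\<gamma> \<noteq> root_label n" "z = swap_word n \<gamma>" by auto
    obtain c B X C where form: "\<gamma> = replicate c False @ True # replicate B False @ X @ replicate C False @ [True]"
      "c > 0" by (rule asym_bracelet_form[OF \<gamma>(1)])
    show ?cond
    proof (cases "first_one \<gamma> \<in> ?A")
      case True
      have "z = (replicate B False @ X @ replicate C False) @ True # replicate c False"
        using swap_word_first_one[OF form(1) True] \<gamma>(3) by simp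
      then have "z1 = replicate B False @ X @ replicate C False" "a = c"
        using append_Cons_replicate_inject[of False True z1 a] z1 by auto
      then have "\<gamma> = \<beta>1" by (simp add: form(1) \<beta>1_def)
      then show ?thesis using \<gamma>(1) True by blast
    next
      case F: False
      show ?thesis
      proof (cases "last_one \<gamma> \<in> ?A")
        case True
        then have "z = butlast \<gamma>" using \<gamma>(3) F by (simp add: swap_word_def)
        then have "\<gamma> = \<beta>2" by (simp add: \<beta>2_def form(1) butlast_append)
        then show ?thesis using \<gamma>(1) F True by blast
      next
        case False
        have "\<not> symmetric \<gamma>" using \<gamma>(1) by (simp add: asym_bracelets_def)
        then obtain P f where P: "\<gamma> = P @ False # replicate f True" "True \<in> set P"
          by (rule asymmetric_split)
        have len: "length \<gamma> = n" using \<gamma>(1) by (simp add: asym_bracelets_def)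
        have "P \<noteq> []" using P(2) by auto
        then have "hd P = hd \<gamma>" by (simp add: P(1))
        also have "\<dots> = False" using form by (cases c) auto
        finally obtain P' where P': "P = False # P'" using \<open>P \<noteq> []\<close> by (cases P) auto
        have "z = replicate f True @ False # P'"
          using swap_word_last_zero[OF P(1) len F False] \<gamma>(3) P' by simp
        then have "f = e" "P' = z2" using z2 replicate_Cons_inject[of True False f P' e z2] by auto
        then have "\<gamma> = \<beta>3" by (simp add: P(1) P' \<beta>3_def)
        \<comment> \<open>With the other two rules failing, this is the statement that
          \<open>par\<close> does not leave A(n).\<close>
        moreover have "last_zero \<gamma> \<in> ?A" using par_link(1)[OF \<gamma>(1,2)] F False by (simp add: par_def)
        ultimately show ?thesis using \<gamma>(1) F False by blast
      qed
    qed
  qed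
  then show ?thesis unfolding g by simp
qed

section \<open>Reversed windows and the union of the classes\<close>

lemma window_Suc: "window (Suc k) s i = window k s i @ [s ! ((i + k) mod length s)]"
  by (simp add: window_def)

lemma window_rev:
  assumes "i < length s"
  shows "\<exists>i' < length s. window n (rev s) i = rev (window n s i')"
proof -
  let ?m = "length s"
  have m: "0 < ?m" using assms by linarith
  \<comment> \<open>Modulo the length m of s this is -n - i, where the reversed window starts; the
    multiple m * n keeps it a natural number.\<close>
  define c where "c = ?m * n - n + (?m - i)"
  have "window n (rev s) i = rev (window n s (c mod ?m))"
  proof (rule nth_equalityI)
    fix j assume "j < length (window n (rev s) i)"
    then have j: "j < n" by (simp add: window_def)
    define q r where "q = (i + j) div ?m" and "r = (i + j) mod ?m"
    have ij: "i + j = q * ?m + r" and r: "r < ?m" using m by (simp_all add: q_def r_def)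
    have "n \<le> ?m * n" using m by (metis Suc_leI One_nat_def mult_le_mono1 nat_mult_1)
    then have sum: "c + (n - Suc j) + (i + j) = ?m * n + (?m - 1)"
      unfolding c_def using assms j by linarith
    have "q \<le> n"
    proof (rule ccontr)
      assume "\<not> q \<le> n"
      then have "Suc n * ?m \<le> q * ?m" by (intro mult_le_mono1) simp
      moreover have "Suc n * ?m = ?m * n + ?m" by simp
      ultimately show False using ij sum m by linarith
    qed
    then have "c + (n - Suc j) = ?m * (n - q) + (?m - 1 - r)"
      using sum ij r by (simp add: algebra_simps diff_mult_distrib2)
    moreover have "(?m * (n - q) + (?m - 1 - r)) mod ?m = ?m - 1 - r"
      using m by (simp only: mod_mult_self4 mod_less)
    ultimately have "(c + (n - Suc j)) mod ?m = ?m - 1 - r" by simp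
    then have "(c mod ?m + (n - Suc j)) mod ?m = ?m - Suc r" by (simp add: mod_add_left_eq)
    moreover have "rev s ! r = s ! (?m - Suc r)" using r by (simp add: rev_nth)
    ultimately show "window n (rev s) i ! j = rev (window n s (c mod ?m)) ! j"
      using j by (simp add: window_def rev_nth r_def)
  qed (simp add: window_def)
  then show ?thesis using m by (metis mod_less_divisor)
qed

lemma set_windows_rev:
  "window n (rev s) ` {0..<length s} = rev ` window n s ` {0..<length s}"
proof
  show "window n (rev s) ` {0..<length s} \<subseteq> rev ` window n s ` {0..<length s}"
    using window_rev[of _ s n] by fastforce
  show "rev ` window n s ` {0..<length s} \<subseteq> window n (rev s) ` {0..<length s}"
  proof (clarsimp)
    fix i assume "i < length s"
    then obtain i' where "i' < length s" "window n s i = rev (window n (rev s) i')"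
      using window_rev[of i "rev s" n] by auto
    then show "rev (window n s i) \<in> window n (rev s) ` {0..<length s}" by auto
  qed
qed

lemma rotations_disjoint:
  assumes "\<gamma> \<in> asym_bracelets n" "\<gamma>' \<in> asym_bracelets n" "\<gamma> \<noteq> \<gamma>'"
  shows "rotations \<gamma> \<inter> rotations \<gamma>' = {}"
proof (rule ccontr)
  assume "\<not> ?thesis"
  then obtain w where "w \<in> rotations \<gamma>" "w \<in> rotations \<gamma>'" by auto
  then have "necklace_of \<gamma> = necklace_of \<gamma>'" by (metis necklace_of_eq_iff)
  then show False using assms necklace_of_asym_bracelet by metis
qed

lemma finite_S_set: "finite (S_set n)"
  unfolding S_set_def by (intro finite_UN_I finite_asym_bracelets finite_rotations)

lemma sum_mset_set_rotations: "(\<Sum>\<gamma> \<in> asym_bracelets n. mset_set (rotations \<gamma>)) = mset_set (S_set n)"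
proof -
  have "(\<Sum>\<gamma> \<in> B. mset_set (rotations \<gamma>)) = mset_set (\<Union>\<gamma> \<in> B. rotations \<gamma>)"
    if "finite B" "B \<subseteq> asym_bracelets n" for B
    using that
  proof (induction B rule: finite_induct)
    case (insert \<gamma> B)
    then have "rotations \<gamma> \<inter> (\<Union>\<gamma> \<in> B. rotations \<gamma>) = {}"
      using rotations_disjoint by fastforce
    with insert show ?case by (simp add: mset_set_Union finite_rotations)
  qed simp
  from this[OF finite_asym_bracelets] show ?thesis by (simp add: S_set_def)
qed

lemma image_mset_sum: "image_mset f (\<Sum>x \<in> B. h x) = (\<Sum>x \<in> B. image_mset f (h x))"
  by (induction B rule: infinite_finite_induct) auto

text \<open>Strictness against the reversed class, applied in both directions, gives \<gamma> <
  \<gamma>' and \<gamma>' < \<gamma>; this covers the case of a single bracelet too.\<close>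

lemma S_set_rev_disjoint: "w \<in> S_set n \<Longrightarrow> rev w \<notin> S_set n"
proof
  assume "w \<in> S_set n" "rev w \<in> S_set n"
  then obtain \<gamma> \<gamma>' where \<gamma>: "\<gamma> \<in> asym_bracelets n" "w \<in> rotations \<gamma>" "\<gamma>' \<in> asym_bracelets n" "rev w \<in> rotations \<gamma>'"
    by (auto simp: S_set_def)
  have "rev w \<in> rotations (rev \<gamma>)" "w \<in> rotations (rev \<gamma>')"
    using rev_in_rotations_rev[OF \<gamma>(2)] rev_in_rotations_rev[OF \<gamma>(4)] by auto
  then have "\<gamma>' \<in> rotations (rev \<gamma>)" "\<gamma> \<in> rotations (rev \<gamma>')"
    using \<gamma> by (blast intro: rotations_trans rotations_sym)+
  then have "\<gamma> < \<gamma>'" "\<gamma>' < \<gamma>" using \<gamma> unfolding asym_bracelets_iff by blast+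
  then show False by simp
qed

theorem theorem4:
  fixes n :: nat
  assumes "n \<ge> 6"
  shows "orientable n (RCL (concat_tree n)) \<and>
         length (RCL (concat_tree n)) = L n \<and>
         has_successor_rule n (S_set n) (g n) (RCL (concat_tree n))"
proof -
  let ?A = "asym_bracelets n" and ?r = "root_label n"
  define s where "s = RCL (concat_tree n)"
  define Z where "Z = swap_word n ` (?A - {?r})"
  define E0 where "E0 = (\<Sum>\<gamma> \<in> ?A - {?r}. same_ends (swap_word n \<gamma>))"
  define E1 where "E1 = (\<Sum>\<gamma> \<in> ?A - {?r}. swapped_ends (swap_word n \<gamma>))"
  define N where "N = (\<Sum>\<gamma> \<in> ?A. closed_rotations \<gamma>)"
  have r: "?r \<in> ?A" by (rule root_label_in[OF assms])
  have fin: "finite (?A - {?r})" using finite_asym_bracelets by simp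
  have id: "cyclic_factors (Suc n) s + E0 = N + E1"
    using concat_subtree_cyclic_factors(4)[of ?r n n] assms root_label_no_parent(4)[OF assms]
      descendants_root[OF r] necklace_of_asym_bracelet[OF r] r
    by (simp add: s_def concat_tree_def E0_def E1_def N_def)
  have "image_mset butlast N = mset_set (S_set n)"
    unfolding N_def image_mset_sum sum_mset_set_rotations[symmetric]
    by (simp add: closed_rotations_def image_mset.compositionality comp_def)
  moreover have "image_mset butlast E0 = image_mset butlast E1"
    by (simp add: E0_def E1_def image_mset_sum same_ends_def swapped_ends_def)
  moreover have "image_mset butlast (cyclic_factors (Suc n) s) = mset (map (window n s) [0..<length s])"
  proof -
    have "butlast (window (Suc n) s i) = window n s i" for i by (simp add: window_Suc)
    then show ?thesis
      unfolding cyclic_factors_def by (simp only: mset_map[symmetric] map_map comp_def)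
  qed
  ultimately have windows: "mset (map (window n s) [0..<length s]) = mset_set (S_set n)"
    using arg_cong[OF id, of "image_mset butlast"] by simp
  have set_windows: "set (map (window n s) [0..<length s]) = S_set n"
    by (metis windows finite_S_set finite_set_mset_mset_set set_mset_mset)
  have dist: "distinct (map (window n s) [0..<length s])"
    unfolding distinct_count_atmost_1 windows using finite_S_set set_windows
    by (simp add: count_mset_set')
  have len: "length s = card (S_set n)"
    using distinct_card[OF dist] set_windows by simp
  have "card (S_set n) = L n"
  proof -
    have "card (S_set n) = (\<Sum>\<gamma> \<in> ?A. card (rotations \<gamma>))"
      unfolding S_set_def using rotations_disjoint
      by (intro card_UN_disjoint) (auto simp: finite_asym_bracelets finite_rotations)
    also have "\<dots> = L n"
      unfolding L_def using assms
      by (intro sum.cong refl card_rotations) (auto simp: asym_bracelets_def)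
    finally show ?thesis .
  qed
  with len have length_s: "length s = L n" by simp
  have "orientable n s"
  proof -
    have set_rev: "set (map (window n (rev s)) [0..<length s]) = rev ` S_set n"
      using set_windows_rev[of n s] set_windows by simp
    then have "card (set (map (window n (rev s)) [0..<length s])) = length s"
      by (simp add: len card_image)
    then have "distinct (map (window n (rev s)) [0..<length s])"
      by (intro card_distinct) simp
    moreover have "S_set n \<inter> rev ` S_set n = {}" using S_set_rev_disjoint by auto
    ultimately show ?thesis
      unfolding orientable_def using dist set_rev set_windows by simp
  qed
  moreover have "has_successor_rule n (S_set n) (g n) s"
    unfolding has_successor_rule_def
  proof (intro allI impI conjI)
    fix i assume i: "i < length s"
    show S: "window n s i \<in> S_set n" using i set_windows by auto
    obtain p z where w: "window n s i = p # z" using assms by (cases "window n s i") (auto simp: window_def)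
    let ?b = "s ! ((i + n) mod length s)" and ?v = "window (Suc n) s i"
    have v: "?v = p # z @ [?b]" by (simp add: window_Suc w)
    have v_in: "?v \<in># cyclic_factors (Suc n) s" using i by (simp add: cyclic_factors_def)
    \<comment> \<open>Every window of a separate \<open>ap \<gamma>\<close> repeats its first bit n
      places later, so different ends can only come from a join.\<close>
    have N_ends: "hd u = last u" if u: "u \<in># N" for u
    proof -
      obtain \<gamma> where "u \<in># closed_rotations \<gamma>" "\<gamma> \<in> ?A"
        using u finite_asym_bracelets by (auto simp: N_def set_mset_sum)
      then obtain t where "t \<in> rotations \<gamma>" "u = t @ [hd t]" "length \<gamma> = n"
        by (auto simp: closed_rotations_def finite_rotations asym_bracelets_def)
      then show ?thesis using assms length_rotations by (cases t) fastforce+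
    qed
    have "?b = (if z \<in> Z then \<not> p else p)"
    proof (cases "?b = p")
      case True
      have "z \<notin> Z"
      proof
        \<comment> \<open>The window would be counted both in s and among the destroyed ones.
          Created windows have different ends, so it would occur twice in \<open>N\<close>, although
          removing last bits from \<open>N\<close> gives every string of \<open>S_set n\<close> only
          once.\<close>
        assume "z \<in> Z"
        then have "?v \<in># E0"
          using fin by (auto simp: E0_def Z_def set_mset_sum same_ends_def v True)
        then have "2 \<le> count (cyclic_factors (Suc n) s + E0) ?v"
          using v_in by (simp flip: count_greater_zero_iff)
        moreover have "?v \<notin># E1"
          using fin by (auto simp: E1_def set_mset_sum swapped_ends_def v True)
        ultimately have "2 \<le> count N ?v" unfolding id by (simp add: not_in_iff)
        then have "replicate_mset 2 ?v \<subseteq># N" by (simp only: count_le_replicate_mset_subset_eq)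
        from image_mset_subseteq_mono[OF this, of butlast]
        have "2 \<le> count (image_mset butlast N) (butlast ?v)"
          by (simp only: image_replicate_mset count_le_replicate_mset_subset_eq)
        then show False
          using \<open>image_mset butlast N = mset_set (S_set n)\<close> by (simp add: count_mset_set' split: if_splits)
      qed
      with True show ?thesis by simp
    next
      case False
      then have "?v \<notin># N" using N_ends[of ?v] v by auto
      moreover have "?v \<in># N + E1" using v_in unfolding id[symmetric] by simp
      ultimately have "?v \<in># E1" by simp
      then obtain \<gamma> where "\<gamma> \<in> ?A - {?r}" "?v \<in># swapped_ends (swap_word n \<gamma>)"
        using fin by (auto simp: E1_def set_mset_sum)
      then have "z \<in> Z" by (auto simp: swapped_ends_def v Z_def)
      with False show ?thesis by auto
    qed
    then show "?b = g n (window n s i)"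
      using g_eq[OF assms] S unfolding w Z_def by simp
  qed
  ultimately show ?thesis using length_s by (simp add: s_def)
qed

end
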